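(* Let $\nu$ be a probability measure on $[0,\infty[$ with $\nu\ne\delta_0$ and compact support, and thus with finite moments $m_k:=\int_0^\infty x^k\,d\nu(x)\in]0,\infty[$ ($k\in\mathbb N$). Let $\alpha\ge\beta\ge-1/2$ with $\alpha>-1/2$, $\rho:=\alpha+\beta+1$, and $r\in]0,1/2[$. Then the random variables $S_n^{(\alpha,\beta,n^{-r})}$ have the following behavior for $n\to\infty$. (1) If $r\in]1/6,1/2[$, then $$\frac{S_n^{(\alpha,\beta,n^{-r})}-\frac{\rho m_2}{2(\alpha+1)}\,n^{1-2r}}{n^{1/2-r}}$$ tends in distribution to $N\bigl(0,\frac{m_2}{2(\alpha+1)}\bigr)$. (2) If $r=1/6$, then $$\frac{S_n^{(\alpha,\beta,n^{-1/6})}-\frac{\rho m_2}{2(\alpha+1)}\,n^{2/3}}{n^{1/3}}$$ tends in distribution to $N\Bigl(-\frac{\rho(\alpha+3\beta+2)m_4}{12(\alpha+1)(\alpha+2)},\frac{m_2}{2(\alpha+1)}\Bigr)$. (3) If $r\in]0,1/6[$, then $$\frac{S_n^{(\alpha,\beta,n^{-r})}-\frac{\rho m_2}{2(\alpha+1)}\,n^{1-2r}}{n^{1-4r}}\longrightarrow-\frac{\rho(\alpha+3\beta+2)m_4}{12(\alpha+1)(\alpha+2)}$$ in probability.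
   Context: For $\alpha\ge\beta\ge-1/2$ with $\alpha>-1/2$ let $m_{\alpha,\beta}$ be the probability measure on $[0,1]\times[0,\pi]$ given by $$dm_{\alpha,\beta}(r,\phi)=\frac{2\Gamma(\alpha+1)}{\Gamma(1/2)\Gamma(\alpha-\beta)\Gamma(\beta+1/2)}(1-r^2)^{\alpha-\beta-1}(r\sin\phi)^{2\beta}\,r\,dr\,d\phi\quad(\alpha>\beta>-1/2),$$ $$dm_{\alpha,-1/2}(r,\phi)=\frac{2\Gamma(\alpha+1)}{\Gamma(1/2)\Gamma(\alpha+1/2)}(1-r^2)^{\alpha-1/2}\,dr\cdot\tfrac12\,d(\delta_0+\delta_\pi)(\phi)\quad(\alpha>\beta=-1/2),$$ $$dm_{\alpha,\alpha}(r,\phi)=\frac{\Gamma(\alpha+1)}{\Gamma(1/2)\Gamma(\alpha+1/2)}\sin^{2\alpha}\phi\,d\phi\cdot d\delta_1(r)\quad(\alpha=\beta>-1/2).$$ The Jacobi convolution $*_{(\alpha,\beta)}$ of point measures on $[0,\infty[$ is $$(\delta_s*_{(\alpha,\beta)}\delta_t)(f)=\int_0^1\int_0^\pi f\bigl(\operatorname{arcosh}|\cosh s\cosh t+re^{i\phi}\sinh s\sinh t|\bigr)\,dm_{\alpha,\beta}(r,\phi),\quad f\in C_b([0,\infty[),$$ extended bilinearly and weakly continuously to bounded measures on $[0,\infty[$. The Jacobi random walk of index $(\alpha,\beta)$ with law $\kappa$ (a probability measure on $[0,\infty[$) is the time-homogeneous Markov chain $(S_n)_{n\ge0}$ on $[0,\infty[$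 started at $0$ with $P(S_{n+1}\in A\mid S_n=x)=(\delta_x*_{(\alpha,\beta)}\kappa)(A)$ for $x\ge0$ and Borel sets $A\subset[0,\infty[$. For $c\in]0,1]$ let $\nu_c$ be the image of $\nu$ under $x\mapsto cx$, and let $(S_n^{(\alpha,\beta,c)})_{n\ge0}$ be the Jacobi random walk of index $(\alpha,\beta)$ with law $\nu_c$. Thus $S_n^{(\alpha,\beta,n^{-r})}$ is the $n$-th step of the walk with law $\nu_{n^{-r}}$. $N(\mu,\sigma^2)$ is the normal distribution with mean $\mu$ and variance $\sigma^2$. *)

theory Defs
  imports "HOL-Probability.Probability"
begin

text \<open>Measures on \<open>[0,\<infinity>[\<close> are represented as Borel measures on the real line that
  vanish on the negative half-line.\<close>

text \<open>The probability measure \<open>m\<^bsub>\<alpha>,\<beta>\<^esub>\<close>, as a Borel measure on the plane concentrated on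
  \<open>[0,1] \<times> [0,\<pi>]\<close>.  The case distinction is exhaustive for \<open>\<alpha> \<ge> \<beta> \<ge> -1/2\<close> with
  \<open>\<alpha> > -1/2\<close>.  The uniform distribution on the two points \<open>0\<close> and \<open>\<pi>\<close> is
  \<open>(\<delta>\<^sub>0 + \<delta>\<^sub>\<pi>) / 2\<close>.\<close>

definition jacobi_m :: "real \<Rightarrow> real \<Rightarrow> (real \<times> real) measure" where
  "jacobi_m \<alpha> \<beta> =
    (if \<alpha> = \<beta> then
       return borel 1 \<Otimes>\<^sub>M
       density lborel (\<lambda>\<phi>. ennreal (indicator {0..pi} \<phi> *
         (Gamma (\<alpha> + 1) / (Gamma (1/2) * Gamma (\<alpha> + 1/2)) * sin \<phi> powr (2 * \<alpha>))))
     else if \<beta> = - 1/2 then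
       density lborel (\<lambda>r. ennreal (indicator {0..1} r *
         (2 * Gamma (\<alpha> + 1) / (Gamma (1/2) * Gamma (\<alpha> + 1/2)) * (1 - r\<^sup>2) powr (\<alpha> - 1/2)))) \<Otimes>\<^sub>M
       distr (measure_pmf (pmf_of_set {0, pi})) borel (\<lambda>\<phi>. \<phi>)
     else
       density lborel (\<lambda>(r, \<phi>). ennreal (indicator ({0..1} \<times> {0..pi}) (r, \<phi>) *
         (2 * Gamma (\<alpha> + 1) / (Gamma (1/2) * Gamma (\<alpha> - \<beta>) * Gamma (\<beta> + 1/2)) *
          (1 - r\<^sup>2) powr (\<alpha> - \<beta> - 1) * (r * sin \<phi>) powr (2 * \<beta>) * r))))"

definition jacobi_arg :: "real \<Rightarrow> real \<Rightarrow> real \<times> real \<Rightarrow> real" where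
  "jacobi_arg s t = (\<lambda>(r, \<phi>). arcosh (cmod
     (of_real (cosh s * cosh t) + of_real r * cis \<phi> * of_real (sinh s * sinh t))))"

text \<open>\<open>\<delta>\<^sub>s * \<delta>\<^sub>t\<close>: the defining formula for the integrals of test functions says that this is
  the image of \<open>m\<^bsub>\<alpha>,\<beta>\<^esub>\<close> under \<^const>\<open>jacobi_arg\<close>; see \<open>integral_jacobi_point_conv\<close> below.\<close>

definition jacobi_point_conv :: "real \<Rightarrow> real \<Rightarrow> real \<Rightarrow> real \<Rightarrow> real measure" where
  "jacobi_point_conv \<alpha> \<beta> s t = distr (jacobi_m \<alpha> \<beta>) borel (jacobi_arg s t)"

text \<open>The bilinear, weakly continuous extension to probability measures:
  \<open>\<mu> * \<kappa> = \<integral>\<integral> \<delta>\<^sub>s * \<delta>\<^sub>t d\<kappa>(t) d\<mu>(s)\<close>.\<close>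

definition jacobi_conv ::
    "real \<Rightarrow> real \<Rightarrow> real measure \<Rightarrow> real measure \<Rightarrow> real measure" where
  "jacobi_conv \<alpha> \<beta> \<mu> \<kappa> = \<mu> \<bind> (\<lambda>s. \<kappa> \<bind> (\<lambda>t. jacobi_point_conv \<alpha> \<beta> s t))"

lemma sets_jacobi_m [measurable_cong]: "sets (jacobi_m \<alpha> \<beta>) = sets borel"
proof -
  have "sets (A \<Otimes>\<^sub>M B) = sets borel"
    if "sets A = sets borel" "sets B = sets borel" for A B :: "real measure"
    using sets_pair_measure_cong[OF that] by (simp only: borel_prod)
  then show ?thesis
    by (simp add: jacobi_m_def)
qed

lemma measurable_jacobi_arg [measurable]: "jacobi_arg s t \<in> borel_measurable borel"
proof -
  have "cis = (\<lambda>\<phi>. exp (\<i> * of_real \<phi>))"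
    by (simp add: cis_conv_exp fun_eq_iff)
  then have [measurable]: "cis \<in> borel_measurable borel"
    by (simp add: borel_measurable_continuous_onI continuous_intros)
  show ?thesis
    unfolding jacobi_arg_def arcosh_def borel_prod[symmetric] by measurable
qed

lemma integral_jacobi_point_conv:
  fixes f :: "real \<Rightarrow> real"
  assumes "continuous_on UNIV f"
  shows "(\<integral>x. f x \<partial>jacobi_point_conv \<alpha> \<beta> s t) =
    (\<integral>(r, \<phi>). f (arcosh (cmod (of_real (cosh s * cosh t) +
        of_real r * exp (\<i> * of_real \<phi>) * of_real (sinh s * sinh t)))) \<partial>jacobi_m \<alpha> \<beta>)"
proof -
  have [measurable]: "f \<in> borel_measurable borel"
    by (rule borel_measurable_continuous_onI[OF assms])
  have "(\<integral>x. f x \<partial>jacobi_point_conv \<alpha> \<beta> s t) = (\<integral>p. f (jacobi_arg s t p) \<partial>jacobi_m \<alpha> \<beta>)"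
    unfolding jacobi_point_conv_def by (rule integral_distr) measurable
  then show ?thesis
    by (simp add: jacobi_arg_def case_prod_unfold cis_conv_exp)
qed

definition history_algebra :: "'a measure \<Rightarrow> (nat \<Rightarrow> 'a \<Rightarrow> real) \<Rightarrow> nat \<Rightarrow> 'a measure" where
  "history_algebra M S n =
     sigma (space M) {S k -` A \<inter> space M | k A. k \<le> n \<and> A \<in> sets borel}"

text \<open>\<open>S\<close> is a Markov chain on \<open>[0,\<infinity>[\<close> started at \<open>0\<close> with transition kernel
  \<open>(x, A) \<mapsto> (\<delta>\<^sub>x * \<kappa>)(A)\<close>, with respect to its natural filtration.\<close>

definition jacobi_random_walk ::
    "real \<Rightarrow> real \<Rightarrow> real measure \<Rightarrow> 'a measure \<Rightarrow> (nat \<Rightarrow> 'a \<Rightarrow> real) \<Rightarrow> bool" where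
  "jacobi_random_walk \<alpha> \<beta> \<kappa> M S \<longleftrightarrow>
     prob_space M \<and>
     (\<forall>n. S n \<in> borel_measurable M) \<and>
     (\<forall>n. \<forall>\<omega>\<in>space M. 0 \<le> S n \<omega>) \<and>
     (AE \<omega> in M. S 0 \<omega> = 0) \<and>
     (\<forall>n. \<forall>A\<in>sets borel. AE \<omega> in M.
        real_cond_exp M (history_algebra M S n) (\<lambda>\<omega>. indicator A (S (Suc n) \<omega>)) \<omega> =
        measure (jacobi_conv \<alpha> \<beta> (return borel (S n \<omega>)) \<kappa>) A)"

definition measure_support :: "'a::topological_space measure \<Rightarrow> 'a set" where
  "measure_support \<nu> = {x. \<forall>U. open U \<longrightarrow> x \<in> U \<longrightarrow> emeasure \<nu> U > 0}"

definition moment :: "real measure \<Rightarrow> nat \<Rightarrow> real" where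
  "moment \<nu> k = (\<integral>x. x ^ k \<partial>\<nu>)"

definition scaled_law :: "real measure \<Rightarrow> real \<Rightarrow> real measure" where
  "scaled_law \<nu> c = distr \<nu> borel (\<lambda>x. c * x)"

text \<open>\<^const>\<open>normal_density\<close> is parametrised by the standard deviation.\<close>

definition normal_law :: "real \<Rightarrow> real \<Rightarrow> real measure" where
  "normal_law \<mu> v = density lborel (\<lambda>x. ennreal (normal_density \<mu> (sqrt v) x))"

text \<open>The variables \<open>X n\<close> may live on different probability spaces \<open>M n\<close>.\<close>

definition tends_in_distribution ::
    "(nat \<Rightarrow> 'a measure) \<Rightarrow> (nat \<Rightarrow> 'a \<Rightarrow> real) \<Rightarrow> real measure \<Rightarrow> bool" where
  "tends_in_distribution M X \<mu> \<longleftrightarrow> weak_conv_m (\<lambda>n. distr (M n) borel (X n)) \<mu>"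

definition tends_in_probability ::
    "(nat \<Rightarrow> 'a measure) \<Rightarrow> (nat \<Rightarrow> 'a \<Rightarrow> real) \<Rightarrow> real \<Rightarrow> bool" where
  "tends_in_probability M X a \<longleftrightarrow>
     (\<forall>\<epsilon>>0. (\<lambda>n. measure (M n) {\<omega> \<in> space (M n). \<bar>X n \<omega> - a\<bar> > \<epsilon>}) \<longlonglongrightarrow> 0)"

end

theory Submission
  imports Defs
begin

text \<open>The function \<open>ln \<circ> cosh\<close> turns the walk into an almost additive process.  If
\<open>cosh s' = \<bar>cosh s cosh t + z sinh s sinh t\<bar>\<close> with \<open>z\<close> in the unit disk, then
\<open>ln (cosh s') = ln (cosh s) + ln \<bar>cosh t + u z sinh t\<bar>\<close> where \<open>u = tanh s\<close>
(\<open>ln_cosh_jacobi_arg\<close>).  So for \<open>L\<^sub>n = ln (cosh S\<^sub>n)\<close> the next increment depends on the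
past only through \<open>u\<^sub>n = tanh S\<^sub>n\<close>, and \<open>\<bar>S\<^sub>n - L\<^sub>n\<bar> \<le> ln 2\<close> is negligible because every
normalisation in the theorem tends to infinity.  At \<open>u = 1\<close> the increments would be
independent and identically distributed; the proof measures the distance from that case.

\<^bold>\<open>One step.\<close>  A Taylor expansion in \<open>t\<close> with remainder of order \<open>t\<^sup>5\<close>
(\<open>log_step_taylor\<close>) reduces the mean of an increment of the walk with law \<open>\<nu>\<^sub>c\<close> to the moments
of \<open>\<nu>\<close> and to the averages of \<open>Re z\<^sup>k\<close>, \<open>k \<le> 4\<close>, under \<open>m\<^bsub>\<alpha>,\<beta>\<^esub>\<close>.  The odd averages vanish by the
reflection \<open>\<phi> \<mapsto> \<pi> - \<phi>\<close>, the even ones come from ratios of Beta functions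
(\<open>disk_moment_1\<close> to \<open>disk_moment_4\<close>).  The coefficient of \<open>c\<^sup>2\<close> gives the centering
\<open>\<rho> m\<^sub>2 / (2 (\<alpha> + 1))\<close>, the coefficient of \<open>c\<^sup>4\<close> gives the constant
\<open>- \<rho> (\<alpha> + 3 \<beta> + 2) m\<^sub>4 / (12 (\<alpha> + 1) (\<alpha> + 2))\<close>, and the second moment has leading term
\<open>c\<^sup>2 m\<^sub>2 / (2 (\<alpha> + 1))\<close>.  The price for replacing \<open>u\<close> by \<open>1\<close> is \<open>O(c\<^sup>2 (1 - u\<^sup>2))\<close>.

\<^bold>\<open>Escape.\<close>  Since \<open>\<alpha> + \<beta> + 1 > 0\<close>, the drift is at least \<open>\<delta> c\<^sup>2\<close> for all \<open>u\<close> in \<open>[0,1]\<close>, and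
therefore \<open>exp (- \<epsilon> L\<^sub>n)\<close> shrinks in mean by a factor \<open>1 - \<gamma> c\<^sup>2\<close> at every step, for small \<open>\<epsilon>\<close>.
As \<open>1 - u\<^sub>n\<^sup>2 = exp (- 2 L\<^sub>n) \<le> exp (- \<epsilon> L\<^sub>n)\<close>, the total price
\<open>c\<^sup>2 \<Sum>\<^sub>n E (1 - u\<^sub>n\<^sup>2)\<close> is at most \<open>1 / \<gamma>\<close>, whatever the number of steps and however small \<open>c\<close>
(\<open>walk_potential_bound\<close>).

\<^bold>\<open>Limit.\<close>  Chaining the one-step estimates of characteristic functions yields
\<open>walk_char_estimate\<close>: \<open>E exp (i \<theta> S\<^sub>n)\<close> differs from \<open>exp (n (i \<theta> \<mu> - \<theta>\<^sup>2 \<sigma>\<^sup>2 / 2))\<close>, with \<open>\<mu>\<close> and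
\<open>\<sigma>\<^sup>2\<close> the approximate mean and variance of a step, by at most a constant times
\<open>n (\<bar>\<theta>\<bar> c\<^sup>5 + \<theta>\<^sup>2 c\<^sup>3 + \<bar>\<theta>\<bar>\<^sup>3 c\<^sup>3) + \<bar>\<theta>\<bar>\<close>.  Put \<open>c = n\<^bsup>-r\<^esup>\<close> and \<open>\<theta> = t / a\<^sub>n\<close>.  If
\<open>n\<^bsup>1-4r\<^esup> / a\<^sub>n \<rightarrow> p\<close>, \<open>n\<^bsup>1-2r\<^esup> / a\<^sub>n\<^sup>2 \<rightarrow> q\<close> and \<open>a\<^sub>n \<rightarrow> \<infinity>\<close>, then the error vanishes and the
limit is the characteristic function of a normal law with mean \<open>p \<kappa>\<close> and variance
\<open>q m\<^sub>2 / (2 (\<alpha> + 1))\<close>, where \<open>\<kappa>\<close> is the constant above.  The three regimes are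
\<open>(p, q) = (0, 1)\<close>, \<open>(1, 1)\<close> and \<open>(1, 0)\<close>; in the last one the limit is a point mass, which is
convergence in probability.\<close>

section \<open>The exact decomposition of one step\<close>

text \<open>The increment of \<open>ln \<circ> cosh\<close> over a step of size \<open>t\<close>, with \<open>w = u z\<close>.\<close>
definition log_step :: "real \<Rightarrow> complex \<Rightarrow> real" where
  "log_step t w = ln (cmod (of_real (cosh t) + of_real (sinh t) * w))"

text \<open>All three bounds come from \<open>cosh t \<plusminus> sinh t = exp (\<plusminus> t)\<close>.  The lower bound on the real part also
keeps \<open>cosh t + w sinh t\<close> away from the branch cut of the logarithm.\<close>
lemma cmod_cosh_sinh_bounds:
  assumes "0 \<le> t" and "cmod w \<le> 1"
  shows "exp (- t) \<le> Re (of_real (cosh t) + of_real (sinh t) * w)"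
    and "cmod (of_real (cosh t) + of_real (sinh t) * w) \<le> exp t"
    and "cmod (of_real (sinh t) + of_real (cosh t) * w) \<le> exp t"
proof -
  have s: "0 \<le> sinh t" using assms by simp
  have "- sinh t \<le> sinh t * Re w"
    using mult_left_mono[OF _ s, of "-1" "Re w"] abs_Re_le_cmod[of w] assms by auto
  then show "exp (- t) \<le> Re (of_real (cosh t) + of_real (sinh t) * w)"
    using cosh_minus_sinh[of t] by simp
  have "cmod (of_real (cosh t) + of_real (sinh t) * w) \<le> cosh t + sinh t * cmod w"
    by (rule order_trans[OF norm_triangle_ineq]) (simp add: norm_mult abs_of_nonneg[OF s])
  also have "\<dots> \<le> cosh t + sinh t * 1" using s assms by (intro add_left_mono mult_left_mono) auto
  finally show "cmod (of_real (cosh t) + of_real (sinh t) * w) \<le> exp t"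
    by (simp add: cosh_plus_sinh)
  have "cmod (of_real (sinh t) + of_real (cosh t) * w) \<le> sinh t + cosh t * cmod w"
    by (rule order_trans[OF norm_triangle_ineq]) (simp add: norm_mult abs_of_nonneg[OF s])
  also have "\<dots> \<le> sinh t + cosh t * 1" using assms by (intro add_left_mono mult_left_mono) auto
  finally show "cmod (of_real (sinh t) + of_real (cosh t) * w) \<le> exp t"
    by (simp add: sinh_plus_cosh)
qed

lemma abs_log_step_le:
  assumes "0 \<le> t" and "cmod w \<le> 1"
  shows "\<bar>log_step t w\<bar> \<le> t"
proof -
  let ?x = "cmod (of_real (cosh t) + of_real (sinh t) * w)"
  have "exp (- t) \<le> ?x"
    using cmod_cosh_sinh_bounds(1)[OF assms] complex_Re_le_cmod order_trans by blast
  moreover have "?x \<le> exp t" using cmod_cosh_sinh_bounds(2)[OF assms] .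
  moreover have "0 < exp (-t)" by simp
  ultimately show ?thesis unfolding log_step_def
    by (smt (verit, best) exp_gt_zero ln_exp ln_le_cancel_iff)
qed

text \<open>The quotient \<open>y = (sinh t + w cosh t) / (cosh t + w sinh t)\<close> is the logarithmic derivative of
\<open>g = cosh t + w sinh t\<close> and satisfies the Riccati equation \<open>y' = 1 - y\<^sup>2\<close>, because \<open>g'' = g\<close>.
Hence all higher derivatives are polynomials in \<open>y\<close>, the value \<open>y = w\<close> at \<open>t = 0\<close> gives the Taylor
coefficients, and \<open>\<bar>y\<bar> \<le> exp 2 \<le> 9\<close> on \<open>[0,1]\<close> bounds the fifth derivative.\<close>
lemma log_step_taylor:
  assumes "0 \<le> t" and "t \<le> 1" and w: "cmod w \<le> 1"
  shows "\<bar>log_step t w - Re (w * t + (1 - w\<^sup>2) / 2 * t^2 - w * (1 - w\<^sup>2) / 3 * t^3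
            - (1 - w\<^sup>2) * (1 - 3 * w\<^sup>2) / 12 * t^4)\<bar> \<le> 20000 * t ^ 5"
proof (cases "t = 0")
  case True
  then show ?thesis by (simp add: log_step_def)
next
  case False
  with assms have t: "0 < t" by simp
  define g where "g = (\<lambda>x. complex_of_real (cosh x) + of_real (sinh x) * w)"
  define h where "h = (\<lambda>x. complex_of_real (sinh x) + of_real (cosh x) * w)"
  define y where "y = (\<lambda>x. h x / g x)"
  have g0: "0 < Re (g x)" if "0 \<le> x" for x
    using cmod_cosh_sinh_bounds(1)[OF that w] exp_gt_zero[of "-x"]
    unfolding g_def by linarith
  have gn: "g x \<noteq> 0" if "0 \<le> x" for x using g0[OF that] by auto
  have dg: "(g has_vector_derivative h x) (at x)" for x
    unfolding g_def h_def by (auto intro!: derivative_eq_intros)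
  have dh: "(h has_vector_derivative g x) (at x)" for x
    unfolding g_def h_def by (auto intro!: derivative_eq_intros)
  have dy: "(y has_vector_derivative 1 - (y x)\<^sup>2) (at x)" if "0 \<le> x" for x
  proof -
    have "(inverse has_field_derivative - (inverse (g x) * inverse (g x))) (at (g x))"
      using DERIV_inverse'[OF DERIV_ident gn[OF that]] by simp
    from field_vector_diff_chain_at[OF dg this]
    have "((\<lambda>x. inverse (g x)) has_vector_derivative h x * - (inverse (g x) * inverse (g x))) (at x)"
      by (simp add: o_def)
    from has_vector_derivative_mult[OF dh this] show ?thesis
      unfolding y_def divide_inverse
      by (rule has_vector_derivative_eq_rhs) (use gn[OF that] in \<open>simp add: field_simps power2_eq_square\<close>)
  qed
  have dpoly: "((\<lambda>x. Re (p (y x))) has_real_derivative Re ((1 - (y x)\<^sup>2) * p')) (at x)"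
    if "0 \<le> x" "(p has_field_derivative p') (at (y x))" for x p p'
  proof -
    have "((p \<circ> y) has_vector_derivative (1 - (y x)\<^sup>2) * p') (at x)"
      by (rule field_vector_diff_chain_at[OF dy[OF that(1)] that(2)])
    from bounded_linear.has_vector_derivative[OF bounded_linear_Re this]
    show ?thesis by (simp add: has_real_derivative_iff_has_vector_derivative o_def)
  qed
  have dln: "((\<lambda>x. log_step x w) has_real_derivative Re (y x)) (at x)" if "0 \<le> x" for x
  proof -
    have "g x \<notin> \<real>\<^sub>\<le>\<^sub>0" using g0[OF that] by (auto simp: complex_nonpos_Reals_iff)
    then have "(Ln has_field_derivative inverse (g x)) (at (g x))"
      by (rule has_field_derivative_Ln)
    from field_vector_diff_chain_at[OF dg this]
    have "((Ln \<circ> g) has_vector_derivative y x) (at x)" by (simp add: y_def field_simps)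
    from bounded_linear.has_vector_derivative[OF bounded_linear_Re this]
    have *: "((\<lambda>x. Re (Ln (g x))) has_real_derivative Re (y x)) (at x)"
      by (simp add: has_real_derivative_iff_has_vector_derivative o_def)
    have "isCont (\<lambda>x. Re (g x)) x"
      using has_vector_derivative_continuous[OF dg] by (auto intro!: tendsto_Re simp: isCont_def)
    then have "((\<lambda>x. Re (g x)) \<longlongrightarrow> Re (g x)) (nhds x)"
      by (simp add: tendsto_nhds_iff isCont_def)
    from order_tendstoD(1)[OF this g0[OF that]]
    have "eventually (\<lambda>x. 0 < Re (g x)) (nhds x)" .
    then have "eventually (\<lambda>x. Re (Ln (g x)) = log_step x w) (nhds x)"
    proof eventually_elim
      case (elim x)
      then have "g x \<noteq> 0" by auto
      then have "Re (Ln (g x)) = ln (cmod (g x))" by (rule Re_Ln)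
      then show ?case by (simp only: log_step_def g_def)
    qed
    with * show ?thesis by (simp add: DERIV_cong_ev)
  qed
  \<comment> \<open>Real parts of the successive derivatives, as polynomials in \<open>y\<close>.\<close>
  define D where "D = (\<lambda>m::nat. if m = 0 then (\<lambda>x. log_step x w)
     else if m = 1 then (\<lambda>x. Re (y x))
     else if m = 2 then (\<lambda>x. Re (1 - (y x)\<^sup>2))
     else if m = 3 then (\<lambda>x. Re (- 2 * y x * (1 - (y x)\<^sup>2)))
     else if m = 4 then (\<lambda>x. Re (- 2 * (1 - 3 * (y x)\<^sup>2) * (1 - (y x)\<^sup>2)))
     else (\<lambda>x. Re ((16 * y x - 24 * y x ^ 3) * (1 - (y x)\<^sup>2))))"
  have DER: "\<forall>m x. m < 5 \<and> 0 \<le> x \<and> x \<le> t \<longrightarrow> DERIV (D m) x :> D (Suc m) x"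
  proof (intro allI impI, elim conjE)
    fix m :: nat and x assume m: "m < 5" and x: "0 \<le> x" "x \<le> t"
    consider "m = 0" | "m = 1" | "m = 2" | "m = 3" | "m = 4" using m by linarith
    then show "DERIV (D m) x :> D (Suc m) x"
    proof cases
      case 1 then show ?thesis using dln[OF x(1)] by (simp add: D_def)
    next
      case 2 then show ?thesis using dpoly[OF x(1) DERIV_ident] by (simp add: D_def)
    next
      case 3
      have "((\<lambda>z. 1 - z\<^sup>2) has_field_derivative (- 2 * y x)) (at (y x))"
        by (auto intro!: derivative_eq_intros)
      from dpoly[OF x(1) this] show ?thesis using 3 by (simp add: D_def mult.commute)
    next
      case 4
      have "((\<lambda>z. - 2 * z * (1 - z\<^sup>2)) has_field_derivative (- 2 * (1 - 3 * (y x)\<^sup>2))) (at (y x))"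
        by (auto intro!: derivative_eq_intros simp: algebra_simps power2_eq_square)
      from dpoly[OF x(1) this] show ?thesis using 4 by (simp add: D_def mult.commute)
    next
      case 5
      have "((\<lambda>z. - 2 * (1 - 3 * z\<^sup>2) * (1 - z\<^sup>2)) has_field_derivative (16 * y x - 24 * y x ^ 3)) (at (y x))"
        by (auto intro!: derivative_eq_intros simp: algebra_simps power2_eq_square power3_eq_cube)
      from dpoly[OF x(1) this] show ?thesis using 5 by (simp add: D_def mult.commute)
    qed
  qed
  obtain x where x: "0 < x" "x \<le> t"
    and eq: "log_step t w = (\<Sum>m<5. D m 0 / fact m * t ^ m) + D 5 x / fact 5 * t ^ 5"
    using Maclaurin2[OF t _ DER, of "\<lambda>x. log_step x w"] by (auto simp: D_def)
  have y0: "y 0 = w" by (simp add: y_def g_def h_def)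
  have D0: "D 0 0 = 0" by (simp add: D_def log_step_def)
  have "log_step t w - Re (w * t + (1 - w\<^sup>2) / 2 * t^2 - w * (1 - w\<^sup>2) / 3 * t^3
            - (1 - w\<^sup>2) * (1 - 3 * w\<^sup>2) / 12 * t^4) = D 5 x / 120 * t ^ 5"
  proof -
    have "Re (w * t + (1 - w\<^sup>2) / 2 * t^2 - w * (1 - w\<^sup>2) / 3 * t^3
            - (1 - w\<^sup>2) * (1 - 3 * w\<^sup>2) / 12 * t^4)
      = Re w * t + Re (1 - w\<^sup>2) / 2 * t^2 - Re (w * (1 - w\<^sup>2)) / 3 * t^3
            - Re ((1 - w\<^sup>2) * (1 - 3 * w\<^sup>2)) / 12 * t^4"
      by (simp flip: of_real_power)
    moreover have "(\<Sum>m<5. D m 0 / fact m * t ^ m)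
      = D 0 0 + D 1 0 * t + D 2 0 / 2 * t^2 + D 3 0 / 6 * t^3 + D 4 0 / 24 * t^4"
      by (simp add: eval_nat_numeral)
    moreover have "D 1 0 = Re w" "D 2 0 = Re (1 - w\<^sup>2)"
      by (simp_all add: D_def y0)
    moreover have "D 3 0 = - 2 * Re (w * (1 - w\<^sup>2))"
    proof -
      have "- 2 * w * (1 - w\<^sup>2) = of_real (- 2) * (w * (1 - w\<^sup>2))" by simp
      then show ?thesis by (simp add: D_def y0)
    qed
    moreover have "D 4 0 = - 2 * Re ((1 - w\<^sup>2) * (1 - 3 * w\<^sup>2))"
    proof -
      have "- 2 * (1 - 3 * w\<^sup>2) * (1 - w\<^sup>2) = of_real (- 2) * ((1 - w\<^sup>2) * (1 - 3 * w\<^sup>2))" by (simp add: algebra_simps)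
      then show ?thesis by (simp add: D_def y0) (simp add: algebra_simps)
    qed
    moreover have "(fact 5 :: real) = 120" by (simp add: fact_numeral)
    ultimately show ?thesis unfolding eq D0 by (simp only:)
  qed
  moreover have "\<bar>D 5 x\<bar> \<le> 2400000"
  proof -
    have x0: "0 \<le> x" and x1: "x \<le> 1" using x assms by auto
    have e: "exp (2::real) \<le> 9"
      using power_mono[OF exp_le, of 2] by (simp flip: exp_of_nat_mult add: exp_double)
    have "cmod (h x) \<le> exp x" using cmod_cosh_sinh_bounds(3)[OF x0 w] by (simp add: h_def)
    moreover have "exp (- x) \<le> cmod (g x)"
      using cmod_cosh_sinh_bounds(1)[OF x0 w] complex_Re_le_cmod[of "g x"] by (simp add: g_def)
    ultimately have "cmod (y x) \<le> exp x / exp (- x)"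
      unfolding y_def norm_divide by (intro frac_le) auto
    also have "\<dots> = exp (2 * x)" by (simp flip: exp_diff)
    also have "\<dots> \<le> exp 2" using x1 by simp
    finally have y9: "cmod (y x) \<le> 9" using e by simp
    have sq: "cmod (y x ^ 2) \<le> 9^2" unfolding norm_power by (rule power_mono[OF y9]) simp
    have cu: "cmod (y x ^ 3) \<le> 9^3" unfolding norm_power by (rule power_mono[OF y9]) simp
    have a: "cmod (16 * y x - 24 * y x ^ 3) \<le> 16 * 9 + 24 * 9^3"
      by (rule order_trans[OF norm_triangle_ineq4]) (use y9 cu in \<open>simp add: norm_mult\<close>)
    have b: "cmod (1 - y x ^ 2) \<le> 1 + 9^2"
      by (rule order_trans[OF norm_triangle_ineq4]) (use sq in simp)
    have "\<bar>D 5 x\<bar> \<le> cmod ((16 * y x - 24 * y x ^ 3) * (1 - y x ^ 2))"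
      by (simp add: D_def abs_Re_le_cmod del: minus_complex.simps times_complex.simps)
    also have "\<dots> \<le> (16 * 9 + 24 * 9^3) * (1 + 9^2)"
      unfolding norm_mult by (intro mult_mono a b) auto
    finally show ?thesis by simp
  qed
  then have "\<bar>D 5 x / 120 * t ^ 5\<bar> \<le> 20000 * t ^ 5"
    using t by (simp add: abs_mult)
  ultimately show ?thesis by (simp only:)
qed

text \<open>Factor \<open>cosh s\<close> out of \<open>cosh s cosh t + z sinh s sinh t\<close>.  The argument of \<open>arcosh\<close> is at least
\<open>cosh (s - t) \<ge> 1\<close>, so that \<open>cosh\<close> undoes it.\<close>
lemma ln_cosh_jacobi_arg:
  assumes "0 \<le> s" and "0 \<le> t" and "0 \<le> r" and "r \<le> 1"
  shows "ln (cosh (jacobi_arg s t (r, \<phi>))) = ln (cosh s) + log_step t (of_real (tanh s) * (of_real r * cis \<phi>))"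
proof -
  define w where "w = of_real r * cis \<phi>"
  have w: "cmod w \<le> 1" using assms by (simp add: w_def norm_mult)
  define x where "x = cmod (of_real (cosh s * cosh t) + w * of_real (sinh s * sinh t))"
  have "1 \<le> cosh (s - t)" by (rule cosh_real_ge_1)
  also have "\<dots> = cosh s * cosh t - sinh s * sinh t" by (simp add: cosh_diff)
  also have "\<dots> \<le> Re (of_real (cosh s * cosh t) + w * of_real (sinh s * sinh t))"
  proof -
    have "0 \<le> sinh s * sinh t" using assms by simp
    then have "- (sinh s * sinh t) \<le> Re w * (sinh s * sinh t)"
      using mult_right_mono[of "-1" "Re w" "sinh s * sinh t"] abs_Re_le_cmod[of w] w by auto
    then show ?thesis by simp
  qed
  also have "\<dots> \<le> x" unfolding x_def by (rule complex_Re_le_cmod)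
  finally have x1: "1 \<le> x" .
  have "cosh (jacobi_arg s t (r, \<phi>)) = x"
    using x1 by (simp add: jacobi_arg_def x_def w_def)
  moreover have "x = cosh s * cmod (of_real (cosh t) + of_real (sinh t) * (of_real (tanh s) * w))"
  proof -
    have "of_real (cosh s * cosh t) + w * of_real (sinh s * sinh t)
        = of_real (cosh s) * (of_real (cosh t) + of_real (sinh t) * (of_real (tanh s) * w))"
      by (simp add: tanh_def algebra_simps)
    then show ?thesis unfolding x_def by (simp only: norm_mult) (simp add: abs_of_nonneg)
  qed
  moreover have "cmod (of_real (cosh t) + of_real (sinh t) * (of_real (tanh s) * w)) > 0"
    using x1 calculation(2) cosh_real_pos[of s] by (smt (verit) mult_nonneg_nonpos norm_ge_zero mult_eq_0_iff)
  ultimately show ?thesis by (simp add: log_step_def w_def ln_mult)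
qed

text \<open>From \<open>exp s / 2 \<le> cosh s \<le> exp s\<close>.  This is why \<open>S\<^sub>n\<close> may be exchanged for \<open>ln (cosh S\<^sub>n)\<close>.\<close>
lemma abs_diff_ln_cosh_le:
  fixes s :: real
  assumes "0 \<le> s"
  shows "\<bar>s - ln (cosh s)\<bar> \<le> ln 2"
proof -
  have "cosh s \<le> exp s" using cosh_plus_sinh[of s] assms by (simp flip: cosh_plus_sinh)
  then have "ln (cosh s) \<le> s" by (metis cosh_real_pos exp_gt_zero ln_exp ln_le_cancel_iff)
  moreover have "exp s / 2 \<le> cosh s" by (simp add: cosh_def field_simps)
  then have "ln (exp s / 2) \<le> ln (cosh s)" by (subst ln_le_cancel_iff) auto
  then have "s - ln 2 \<le> ln (cosh s)" by (simp add: ln_div)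
  ultimately show ?thesis using ln_gt_zero[of 2] by linarith
qed

section \<open>Beta integrals on the unit interval and the half circle\<close>

lemma power2_powr_times:
  fixes x :: real
  assumes "0 < x"
  shows "x\<^sup>2 powr b * x = x powr (2 * b + 1)"
proof -
  have "x\<^sup>2 powr b = x powr (2 * b)"
    using assms by (simp add: powr_powr flip: powr_numeral)
  then show ?thesis using assms by (simp add: powr_add)
qed

lemma nn_integral_Beta:
  fixes a b :: real
  assumes "0 < a" "0 < b"
  shows "(\<integral>\<^sup>+t. ennreal (t powr (a - 1) * (1 - t) powr (b - 1) * indicator {0..1} t) \<partial>lborel) = ennreal (Beta a b)"
proof (rule nn_integral_has_integral_lborel)
  show "(\<lambda>t. t powr (a - 1) * (1 - t) powr (b - 1) * indicator {0..1} t) \<in> borel_measurable borel"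
    by measurable
  show "((\<lambda>t. t powr (a - 1) * (1 - t) powr (b - 1) * indicator {0..1} t) has_integral Beta a b) UNIV"
    using has_integral_Beta_real[OF assms] has_integral_restrict_UNIV[of "{0..1}" "\<lambda>t. t powr (a - 1) * (1 - t) powr (b - 1)" "Beta a b"]
    by (simp add: indicator_def of_bool_def if_distrib[of "(*) _"] cong: if_cong)
qed (auto simp: indicator_def)

text \<open>Both the radial and the angular integral are Beta integrals after a monotone substitution, namely
\<open>g r = r\<^sup>2\<close> and \<open>g \<phi> = sin\<^sup>2 \<phi>\<close>.  The nonnegative integral is used since the integrands are
unbounded at the end points for small exponents.\<close>
lemma nn_integral_Beta_substitution:
  fixes a b :: real and g g' :: "real \<Rightarrow> real"
  assumes ab: "0 < a" "0 < b" and "0 \<le> d" and g01: "g 0 = 0" "g d = 1"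
    and g: "\<And>x. (g has_real_derivative g' x) (at x)" "continuous_on {0..d} g'"
    and pos: "\<And>x. x \<in> {0..d} \<Longrightarrow> 0 \<le> g' x"
  shows "(\<integral>\<^sup>+x. ennreal (g x powr (a - 1) * (1 - g x) powr (b - 1) * g' x * indicator {0..d} x) \<partial>lborel) = ennreal (Beta a b)"
proof -
  let ?f = "\<lambda>t. t powr (a - 1) * (1 - t) powr (b - 1) :: real"
  have "set_borel_measurable borel {g 0..g d} ?f"
    unfolding set_borel_measurable_def by measurable
  note * = nn_integral_substitution[OF this g(1) g(2) pos \<open>0 \<le> d\<close>]
  have "(\<integral>\<^sup>+x. ennreal (?f (g x) * g' x * indicator {0..d} x) \<partial>lborel)
      = (\<integral>\<^sup>+t. ennreal (?f t * indicator {g 0..g d} t) \<partial>lborel)"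
    using * by (auto intro!: nn_integral_cong simp: mult_ac simp flip: ennreal_indicator ennreal_mult'')
  also have "\<dots> = ennreal (Beta a b)" unfolding g01 by (rule nn_integral_Beta[OF ab])
  finally show ?thesis .
qed

lemma nn_integral_radial:
  fixes a b :: real
  assumes ab: "0 < a" "0 < b"
  shows "(\<integral>\<^sup>+r. ennreal (indicator {0..1} r * (1 - r\<^sup>2) powr (b - 1) * r powr (2 * a - 1)) \<partial>lborel) = ennreal (Beta a b / 2)"
proof -
  have "(\<integral>\<^sup>+r. ennreal (r\<^sup>2 powr (a - 1) * (1 - r\<^sup>2) powr (b - 1) * (2 * r) * indicator {0..1} r) \<partial>lborel) = ennreal (Beta a b)"
    by (rule nn_integral_Beta_substitution[OF ab]) (auto intro!: derivative_eq_intros continuous_intros)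
  moreover have "r\<^sup>2 powr (a - 1) * (1 - r\<^sup>2) powr (b - 1) * (2 * r) * indicator {0..1} r
      = 2 * (indicator {0..1} r * (1 - r\<^sup>2) powr (b - 1) * r powr (2 * a - 1))" for r :: real
  proof -
    have "r\<^sup>2 powr (a - 1) * r = r powr (2 * a - 1)" if "0 < r"
      using power2_powr_times[OF that, of "a - 1"] by simp
    then show ?thesis by (cases "r = 0") (auto simp: indicator_def)
  qed
  ultimately have "2 * (\<integral>\<^sup>+r. ennreal (indicator {0..1} r * (1 - r\<^sup>2) powr (b - 1) * r powr (2 * a - 1)) \<partial>lborel)
      = ennreal (Beta a b)"
    by (simp add: ennreal_mult' nn_integral_cmult)
  also have "\<dots> = 2 * ennreal (Beta a b / 2)"
    by (simp flip: ennreal_numeral ennreal_mult')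
  finally show ?thesis by (simp add: ennreal_mult_cancel_left)
qed

text \<open>The substitution \<open>sin\<^sup>2 \<phi>\<close> is monotone only on \<open>[0, \<pi>/2]\<close>; the other half contributes the same
amount by the reflection \<open>\<phi> \<mapsto> \<pi> - \<phi>\<close>, under which the even power of the cosine is invariant.\<close>
lemma nn_integral_angular:
  fixes a :: real
  assumes a: "0 < a"
  shows "(\<integral>\<^sup>+\<phi>. ennreal (indicator {0..pi} \<phi> * sin \<phi> powr (2 * a - 1) * cos \<phi> ^ (2 * k)) \<partial>lborel) = ennreal (Beta a (k + 1/2))"
proof -
  let ?h = "\<lambda>\<phi>::real. sin \<phi> powr (2 * a - 1) * cos \<phi> ^ (2 * k)"
  have "(\<integral>\<^sup>+\<phi>. ennreal ((sin \<phi>)\<^sup>2 powr (a - 1) * (1 - (sin \<phi>)\<^sup>2) powr (k + 1/2 - 1) * (2 * sin \<phi> * cos \<phi>) * indicator {0..pi/2} \<phi>) \<partial>lborel) = ennreal (Beta a (k + 1/2))"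
    by (rule nn_integral_Beta_substitution[OF a])
      (auto intro!: derivative_eq_intros continuous_intros mult_nonneg_nonneg sin_ge_zero cos_ge_zero)
  moreover have "(\<integral>\<^sup>+\<phi>. ennreal ((sin \<phi>)\<^sup>2 powr (a - 1) * (1 - (sin \<phi>)\<^sup>2) powr (k + 1/2 - 1) * (2 * sin \<phi> * cos \<phi>) * indicator {0..pi/2} \<phi>) \<partial>lborel)
     = (\<integral>\<^sup>+\<phi>. ennreal (2 * (indicator {0..pi/2} \<phi> * ?h \<phi>)) \<partial>lborel)"
  proof (rule nn_integral_cong_AE)
    show "AE \<phi> in lborel. ennreal ((sin \<phi>)\<^sup>2 powr (a - 1) * (1 - (sin \<phi>)\<^sup>2) powr (k + 1/2 - 1) * (2 * sin \<phi> * cos \<phi>) * indicator {0..pi/2} \<phi>)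
         = ennreal (2 * (indicator {0..pi/2} \<phi> * ?h \<phi>))"
      using AE_lborel_singleton[of 0] AE_lborel_singleton[of "pi/2"]
    proof eventually_elim
      case (elim \<phi>)
      show ?case
      proof (cases "\<phi> \<in> {0..pi/2}")
        case True
        with elim have s: "0 < sin \<phi>" and c: "0 < cos \<phi>"
          by (auto intro!: sin_gt_zero cos_gt_zero)
        have 1: "(sin \<phi>)\<^sup>2 powr (a - 1) * sin \<phi> = sin \<phi> powr (2 * a - 1)"
          using power2_powr_times[OF s, of "a - 1"] by simp
        have "(1 - (sin \<phi>)\<^sup>2) powr (k + 1/2 - 1) * cos \<phi> = cos \<phi> powr (2 * k)"
          using power2_powr_times[OF c, of "k + 1/2 - 1"] by (simp add: cos_squared_eq)
        also have "\<dots> = cos \<phi> ^ (2 * k)" using c powr_realpow[of "cos \<phi>" "2 * k"] by simp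
        finally have 2: "(1 - (sin \<phi>)\<^sup>2) powr (k + 1/2 - 1) * cos \<phi> = cos \<phi> ^ (2 * k)" .
        have "(sin \<phi>)\<^sup>2 powr (a - 1) * (1 - (sin \<phi>)\<^sup>2) powr (k + 1/2 - 1) * (2 * sin \<phi> * cos \<phi>)
          = 2 * (((sin \<phi>)\<^sup>2 powr (a - 1) * sin \<phi>) * ((1 - (sin \<phi>)\<^sup>2) powr (k + 1/2 - 1) * cos \<phi>))"
          by (simp add: mult_ac)
        also have "\<dots> = 2 * ?h \<phi>" unfolding 1 2 ..
        finally show ?thesis using True by (simp only: indicator_simps(1) mult_1_left mult_1_right)
      qed simp
    qed
  qed
  ultimately have half: "2 * (\<integral>\<^sup>+\<phi>. ennreal (indicator {0..pi/2} \<phi> * ?h \<phi>) \<partial>lborel) = ennreal (Beta a (k + 1/2))"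
    by (simp add: ennreal_mult'[of 2] nn_integral_cmult)
  have reflect: "(\<integral>\<^sup>+\<phi>. ennreal (indicator {0..pi/2} (pi - \<phi>) * ?h \<phi>) \<partial>lborel)
     = (\<integral>\<^sup>+\<phi>. ennreal (indicator {0..pi/2} \<phi> * ?h \<phi>) \<partial>lborel)"
    by (subst (2) nn_integral_real_affine[where c = "-1" and t = pi])
      (auto simp: power_mult)
  have "(\<integral>\<^sup>+\<phi>. ennreal (indicator {0..pi} \<phi> * ?h \<phi>) \<partial>lborel)
      = (\<integral>\<^sup>+\<phi>. ennreal (indicator {0..pi/2} \<phi> * ?h \<phi>) + ennreal (indicator {0..pi/2} (pi - \<phi>) * ?h \<phi>) \<partial>lborel)"
  proof (rule nn_integral_cong_AE)
    show "AE \<phi> in lborel. ennreal (indicator {0..pi} \<phi> * ?h \<phi>)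
      = ennreal (indicator {0..pi/2} \<phi> * ?h \<phi>) + ennreal (indicator {0..pi/2} (pi - \<phi>) * ?h \<phi>)"
      using AE_lborel_singleton[of "pi/2"]
      by eventually_elim (auto simp: indicator_def)
  qed
  also have "\<dots> = (\<integral>\<^sup>+\<phi>. ennreal (indicator {0..pi/2} \<phi> * ?h \<phi>) \<partial>lborel)
      + (\<integral>\<^sup>+\<phi>. ennreal (indicator {0..pi/2} (pi - \<phi>) * ?h \<phi>) \<partial>lborel)"
    by (rule nn_integral_add) measurable
  also have "\<dots> = 2 * (\<integral>\<^sup>+\<phi>. ennreal (indicator {0..pi/2} \<phi> * ?h \<phi>) \<partial>lborel)"
    unfolding reflect by (rule mult_2[symmetric])
  finally show ?thesis using half by (simp add: mult.assoc)
qed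

text \<open>The radial and the angular marginals of \<open>m\<^bsub>\<alpha>,\<beta>\<^esub>\<close>.  In the degenerate cases \<open>\<alpha> = \<beta>\<close> and \<open>\<beta> = - 1/2\<close>
one of the Beta distributions has a vanishing parameter and collapses to the unit mass at \<open>r = 1\<close>,
or to the uniform distribution on \<open>{0, \<pi>}\<close>.\<close>
definition jacobi_radial :: "real \<Rightarrow> real \<Rightarrow> real measure" where
  "jacobi_radial \<alpha> \<beta> = (if \<alpha> = \<beta> then return borel 1 else
     density lborel (\<lambda>r. ennreal (2 / Beta (\<beta> + 1) (\<alpha> - \<beta>) *
       (indicator {0..1} r * (1 - r\<^sup>2) powr (\<alpha> - \<beta> - 1) * r powr (2 * \<beta> + 1)))))"

definition jacobi_angular :: "real \<Rightarrow> real measure" where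
  "jacobi_angular \<beta> = (if \<beta> = -1/2 then distr (measure_pmf (pmf_of_set {0, pi})) borel (\<lambda>\<phi>. \<phi>) else
     density lborel (\<lambda>\<phi>. ennreal (1 / Beta (\<beta> + 1/2) (1/2) * (indicator {0..pi} \<phi> * sin \<phi> powr (2 * \<beta>)))))"

lemma sets_jacobi_radial [measurable_cong]: "sets (jacobi_radial \<alpha> \<beta>) = sets borel"
  and sets_jacobi_angular [measurable_cong]: "sets (jacobi_angular \<beta>) = sets borel"
  by (auto simp: jacobi_radial_def jacobi_angular_def)

lemma Beta_pos_real: "0 < a \<Longrightarrow> 0 < b \<Longrightarrow> 0 < Beta a (b::real)"
  by (simp add: Beta_def)

lemma radial_has_moment:
  assumes "\<beta> \<le> \<alpha>" "- 1/2 \<le> \<beta>"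
  shows "has_bochner_integral (jacobi_radial \<alpha> \<beta>) (\<lambda>r. r ^ (2 * k))
     (if \<alpha> = \<beta> then 1 else Beta (\<beta> + 1 + k) (\<alpha> - \<beta>) / Beta (\<beta> + 1) (\<alpha> - \<beta>))"
proof (cases "\<alpha> = \<beta>")
  case True
  then show ?thesis
    by (simp add: jacobi_radial_def has_bochner_integral_iff integral_return integrable_iff_bounded nn_integral_return)
next
  case False
  with assms have pos: "0 < \<beta> + 1" "0 < \<alpha> - \<beta>" by auto
  let ?B = "Beta (\<beta> + 1) (\<alpha> - \<beta>)"
  have B: "0 < ?B" by (rule Beta_pos_real[OF pos])
  have "(\<integral>\<^sup>+r. ennreal (r ^ (2 * k)) \<partial>jacobi_radial \<alpha> \<beta>)
     = (\<integral>\<^sup>+r. ennreal (2 / ?B) * ennreal (indicator {0..1} r * (1 - r\<^sup>2) powr (\<alpha> - \<beta> - 1) * r powr (2 * (\<beta> + 1 + k) - 1)) \<partial>lborel)"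
  proof -
    have "(\<integral>\<^sup>+r. ennreal (r ^ (2 * k)) \<partial>jacobi_radial \<alpha> \<beta>)
      = (\<integral>\<^sup>+r. ennreal (2 / ?B * (indicator {0..1} r * (1 - r\<^sup>2) powr (\<alpha> - \<beta> - 1) * r powr (2 * \<beta> + 1)))
           * ennreal (r ^ (2 * k)) \<partial>lborel)"
      using False by (simp only: jacobi_radial_def if_False) (rule nn_integral_density; measurable)
    also have "\<dots> = (\<integral>\<^sup>+r. ennreal (2 / ?B) * ennreal (indicator {0..1} r * (1 - r\<^sup>2) powr (\<alpha> - \<beta> - 1) * r powr (2 * (\<beta> + 1 + k) - 1)) \<partial>lborel)"
    proof (rule nn_integral_cong)
      fix r :: real
      have *: "r powr (2 * \<beta> + 1) * r ^ (2 * k) = r powr (2 * (\<beta> + 1 + k) - 1)" if "0 \<le> r"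
      proof (cases "r = 0")
        case False
        with that have "r ^ (2 * k) = r powr (2 * k)" using powr_realpow[of r "2 * k"] by simp
        then show ?thesis by (simp add: algebra_simps flip: powr_add)
      qed simp
      have "2 / ?B * (indicator {0..1} r * (1 - r\<^sup>2) powr (\<alpha> - \<beta> - 1) * r powr (2 * \<beta> + 1)) * r ^ (2 * k)
        = 2 / ?B * (indicator {0..1} r * (1 - r\<^sup>2) powr (\<alpha> - \<beta> - 1) * r powr (2 * (\<beta> + 1 + k) - 1))"
        using * by (cases "0 \<le> r") (simp_all add: mult.assoc)
      moreover have "0 \<le> r ^ (2 * k)" by (simp add: power_mult)
      moreover have "0 \<le> 2 / ?B" using B by simp
      ultimately show "ennreal (2 / ?B * (indicator {0..1} r * (1 - r\<^sup>2) powr (\<alpha> - \<beta> - 1) * r powr (2 * \<beta> + 1))) * ennreal (r ^ (2 * k))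
        = ennreal (2 / ?B) * ennreal (indicator {0..1} r * (1 - r\<^sup>2) powr (\<alpha> - \<beta> - 1) * r powr (2 * (\<beta> + 1 + k) - 1))"
        by (metis ennreal_mult' ennreal_mult'')
    qed
    finally show ?thesis .
  qed
  also have "\<dots> = ennreal (2 / ?B) * ennreal (Beta (\<beta> + 1 + k) (\<alpha> - \<beta>) / 2)"
    using pos by (subst nn_integral_cmult, measurable) (simp only: nn_integral_radial)
  also have "\<dots> = ennreal (Beta (\<beta> + 1 + k) (\<alpha> - \<beta>) / ?B)"
    using B by (simp flip: ennreal_mult')
  finally show ?thesis
    using False B Beta_pos_real[of "\<beta> + 1 + k" "\<alpha> - \<beta>"] pos
    by (auto intro!: has_bochner_integral_nn_integral)
qed

lemma angular_has_even_moment: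
  assumes "- 1/2 \<le> \<beta>"
  shows "has_bochner_integral (jacobi_angular \<beta>) (\<lambda>\<phi>. cos \<phi> ^ (2 * k))
     (if \<beta> = - 1/2 then 1 else Beta (\<beta> + 1/2) (k + 1/2) / Beta (\<beta> + 1/2) (1/2))"
proof (cases "\<beta> = - 1/2")
  case True
  then show ?thesis
    by (simp add: jacobi_angular_def has_bochner_integral_iff integral_distr integrable_distr_eq
        integrable_measure_pmf_finite integral_pmf_of_set power_mult)
next
  case False
  with assms have pos: "0 < \<beta> + 1/2" by auto
  let ?B = "Beta (\<beta> + 1/2) (1/2)"
  have B: "0 < ?B" by (rule Beta_pos_real[OF pos]) simp
  have "(\<integral>\<^sup>+\<phi>. ennreal (cos \<phi> ^ (2 * k)) \<partial>jacobi_angular \<beta>)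
     = (\<integral>\<^sup>+\<phi>. ennreal (1 / ?B) * ennreal (indicator {0..pi} \<phi> * sin \<phi> powr (2 * (\<beta> + 1/2) - 1) * cos \<phi> ^ (2 * k)) \<partial>lborel)"
  proof -
    have "(\<integral>\<^sup>+\<phi>. ennreal (cos \<phi> ^ (2 * k)) \<partial>jacobi_angular \<beta>)
      = (\<integral>\<^sup>+\<phi>. ennreal (1 / ?B * (indicator {0..pi} \<phi> * sin \<phi> powr (2 * \<beta>))) * ennreal (cos \<phi> ^ (2 * k)) \<partial>lborel)"
      using False by (simp only: jacobi_angular_def if_False) (rule nn_integral_density; measurable)
    also have "\<dots> = (\<integral>\<^sup>+\<phi>. ennreal (1 / ?B) * ennreal (indicator {0..pi} \<phi> * sin \<phi> powr (2 * (\<beta> + 1/2) - 1) * cos \<phi> ^ (2 * k)) \<partial>lborel)"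
    proof (rule nn_integral_cong)
      fix \<phi> :: real
      have "2 * (\<beta> + 1/2) - 1 = 2 * \<beta>" by simp
      moreover have "0 \<le> cos \<phi> ^ (2 * k)" by (simp add: power_mult)
      moreover have "0 \<le> 1 / ?B" using B by simp
      ultimately show "ennreal (1 / ?B * (indicator {0..pi} \<phi> * sin \<phi> powr (2 * \<beta>))) * ennreal (cos \<phi> ^ (2 * k))
        = ennreal (1 / ?B) * ennreal (indicator {0..pi} \<phi> * sin \<phi> powr (2 * (\<beta> + 1/2) - 1) * cos \<phi> ^ (2 * k))"
        by (metis ennreal_mult' ennreal_mult'' mult.assoc)
    qed
    finally show ?thesis .
  qed
  also have "\<dots> = ennreal (1 / ?B) * ennreal (Beta (\<beta> + 1/2) (k + 1/2))"
    using nn_integral_angular[OF pos, of k] by (subst nn_integral_cmult) auto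
  also have "\<dots> = ennreal (Beta (\<beta> + 1/2) (k + 1/2) / ?B)"
    using B by (simp flip: ennreal_mult')
  finally show ?thesis
    using False B Beta_pos_real[of "\<beta> + 1/2" "k + 1/2"] pos
    by (auto intro!: has_bochner_integral_nn_integral simp: power_mult)
qed

section \<open>Moments of the random point in the unit disk\<close>

lemma prob_space_if_has_bochner_integral_1:
  assumes "has_bochner_integral M (\<lambda>_. 1::real) 1"
  shows "prob_space M"
proof (rule prob_spaceI)
  have "measure M (space M) = 1"
    using assms by (simp add: has_bochner_integral_iff)
  then show "emeasure M (space M) = 1"
    by (simp add: measure_def enn2real_eq_posreal_iff)
qed

lemma prob_space_jacobi_radial:
  assumes "\<beta> \<le> \<alpha>" "- 1/2 \<le> \<beta>"
  shows "prob_space (jacobi_radial \<alpha> \<beta>)"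
proof (rule prob_space_if_has_bochner_integral_1)
  have "Beta (\<beta> + 1) (\<alpha> - \<beta>) \<noteq> 0" if "\<alpha> \<noteq> \<beta>"
    using Beta_pos_real[of "\<beta> + 1" "\<alpha> - \<beta>"] assms that by auto
  then show "has_bochner_integral (jacobi_radial \<alpha> \<beta>) (\<lambda>_. 1::real) 1"
    using radial_has_moment[OF assms, of 0] by (simp split: if_splits)
qed

lemma prob_space_jacobi_angular:
  assumes "- 1/2 \<le> \<beta>"
  shows "prob_space (jacobi_angular \<beta>)"
proof (rule prob_space_if_has_bochner_integral_1)
  have "Beta (\<beta> + 1/2) (1/2) \<noteq> 0" if "\<beta> \<noteq> - 1/2"
    using Beta_pos_real[of "\<beta> + 1/2" "1/2"] assms that by auto
  then show "has_bochner_integral (jacobi_angular \<beta>) (\<lambda>_. 1::real) 1"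
    using angular_has_even_moment[OF assms, of 0] by (simp split: if_splits)
qed

lemma AE_jacobi_radial: "AE r in jacobi_radial \<alpha> \<beta>. 0 \<le> r \<and> r \<le> 1"
  unfolding jacobi_radial_def
  by (auto simp: AE_return AE_density intro!: AE_I2 split: split_indicator)

text \<open>This puts the three defining cases on the same footing: from here on only the moments of the two
factors matter.  The normalising constants match because
\<open>Beta (\<beta> + 1) (\<alpha> - \<beta>) Beta (\<beta> + 1/2) (1/2)\<close> has the factor \<open>Gamma (\<beta> + 1)\<close> in the numerator and in
the denominator.\<close>
lemma jacobi_m_eq_pair_measure:
  assumes ab: "\<beta> \<le> \<alpha>" "- 1/2 \<le> \<beta>" "- 1/2 < \<alpha>"
  shows "jacobi_m \<alpha> \<beta> = jacobi_radial \<alpha> \<beta> \<Otimes>\<^sub>M jacobi_angular \<beta>"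
proof -
  consider "\<alpha> = \<beta>" | "\<alpha> \<noteq> \<beta>" "\<beta> = - 1/2" | "\<alpha> \<noteq> \<beta>" "\<beta> \<noteq> - 1/2" by blast
  then show ?thesis
  proof cases
    case 1
    then have "\<beta> \<noteq> - 1/2" using ab by simp
    then show ?thesis using 1
      by (simp add: jacobi_m_def jacobi_radial_def jacobi_angular_def Beta_def mult_ac add_ac)
  next
    case 2
    have "density lborel (\<lambda>r. ennreal (indicator {0..1} r *
         (2 * Gamma (\<alpha> + 1) / (Gamma (1/2) * Gamma (\<alpha> + 1/2)) * (1 - r\<^sup>2) powr (\<alpha> - 1/2))))
       = density lborel (\<lambda>r. ennreal (2 / Beta (1/2) (\<alpha> + 1/2) *
       (indicator {0..1} r * (1 - r\<^sup>2) powr (\<alpha> - 1/2) * r powr 0)))"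
    proof (rule density_cong)
      show "AE r in lborel. ennreal (indicator {0..1} r *
         (2 * Gamma (\<alpha> + 1) / (Gamma (1/2) * Gamma (\<alpha> + 1/2)) * (1 - r\<^sup>2) powr (\<alpha> - 1/2)))
       = ennreal (2 / Beta (1/2) (\<alpha> + 1/2) *
       (indicator {0..1} r * (1 - r\<^sup>2) powr (\<alpha> - 1/2) * r powr 0))"
        using AE_lborel_singleton[of 0]
        by eventually_elim (auto simp: Beta_def mult_ac add_ac)
    qed measurable
    then show ?thesis using 2
      by (simp add: jacobi_m_def jacobi_radial_def jacobi_angular_def)
  next
    case 3
    then have pos: "0 < \<beta> + 1" "0 < \<alpha> - \<beta>" "0 < \<beta> + 1/2" "0 < \<alpha> + 1" using ab by auto
    define F where "F = (\<lambda>r. ennreal (2 / Beta (\<beta> + 1) (\<alpha> - \<beta>) *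
       (indicator {0..1} r * (1 - r\<^sup>2) powr (\<alpha> - \<beta> - 1) * r powr (2 * \<beta> + 1))))"
    define G where "G = (\<lambda>\<phi>. ennreal (1 / Beta (\<beta> + 1/2) (1/2) * (indicator {0..pi} \<phi> * sin \<phi> powr (2 * \<beta>))))"
    have [measurable]: "F \<in> borel_measurable borel" "G \<in> borel_measurable borel"
      unfolding F_def G_def by measurable
    have "density lborel F \<Otimes>\<^sub>M density lborel G = density (lborel \<Otimes>\<^sub>M lborel) (\<lambda>(x, y). F x * G y)"
    proof (rule pair_measure_density)
      have "prob_space (density lborel G)"
        using prob_space_jacobi_angular[OF ab(2)] 3 by (simp add: jacobi_angular_def G_def)
      then show "sigma_finite_measure (density lborel G)"
        by (simp add: prob_space_imp_sigma_finite)
      show "sigma_finite_measure lborel" by (rule lborel.sigma_finite_measure_axioms)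
    qed (simp_all add: measurable_lborel2)
    also have "\<dots> = density lborel (\<lambda>(x, y). F x * G y)" by (simp add: lborel_prod)
    also have "\<dots> = density lborel (\<lambda>(r, \<phi>). ennreal (indicator ({0..1} \<times> {0..pi}) (r, \<phi>) *
         (2 * Gamma (\<alpha> + 1) / (Gamma (1/2) * Gamma (\<alpha> - \<beta>) * Gamma (\<beta> + 1/2)) *
          (1 - r\<^sup>2) powr (\<alpha> - \<beta> - 1) * (r * sin \<phi>) powr (2 * \<beta>) * r)))"
    proof (intro arg_cong[where f = "density lborel"] ext)
      fix p :: "real \<times> real"
      obtain r \<phi> where p: "p = (r, \<phi>)" by (cases p)
      have G: "0 < Gamma (\<beta> + 1)" using pos by simp
      have const: "2 / Beta (\<beta> + 1) (\<alpha> - \<beta>) * (1 / Beta (\<beta> + 1/2) (1/2))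
         = 2 * Gamma (\<alpha> + 1) / (Gamma (1/2) * Gamma (\<alpha> - \<beta>) * Gamma (\<beta> + 1/2))"
      proof -
        have "Beta (\<beta> + 1) (\<alpha> - \<beta>) = Gamma (\<beta> + 1) * Gamma (\<alpha> - \<beta>) / Gamma (\<alpha> + 1)"
          by (simp add: Beta_def add.commute)
        moreover have "Beta (\<beta> + 1/2) (1/2) = Gamma (\<beta> + 1/2) * Gamma (1/2) / Gamma (\<beta> + 1)"
          by (simp only: Beta_def add.assoc field_sum_of_halves)
        ultimately show ?thesis using G by simp
      qed
      have nn: "0 \<le> 2 / Beta (\<beta> + 1) (\<alpha> - \<beta>)" "0 \<le> 1 / Beta (\<beta> + 1/2) (1/2)"
        using Beta_pos_real[OF pos(1,2)] Beta_pos_real[OF pos(3), of "1/2"] by auto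
      have "r powr (2 * \<beta> + 1) * sin \<phi> powr (2 * \<beta>) = (r * sin \<phi>) powr (2 * \<beta>) * r"
        if "0 \<le> r" "0 \<le> \<phi>" "\<phi> \<le> pi"
        using that sin_ge_zero[of \<phi>] by (cases "r = 0") (auto simp: powr_mult powr_add)
      then have "(2 / Beta (\<beta> + 1) (\<alpha> - \<beta>) *
       (indicator {0..1} r * (1 - r\<^sup>2) powr (\<alpha> - \<beta> - 1) * r powr (2 * \<beta> + 1))) * (1 / Beta (\<beta> + 1/2) (1/2) * (indicator {0..pi} \<phi> * sin \<phi> powr (2 * \<beta>)))
        = indicator ({0..1} \<times> {0..pi}) (r, \<phi>) * ((2 / Beta (\<beta> + 1) (\<alpha> - \<beta>) * (1 / Beta (\<beta> + 1/2) (1/2))) * (1 - r\<^sup>2) powr (\<alpha> - \<beta> - 1) * ((r * sin \<phi>) powr (2 * \<beta>) * r))"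
        by (auto simp: indicator_def)
      then have "F r * G \<phi> = ennreal (indicator ({0..1} \<times> {0..pi}) (r, \<phi>) *
         (2 * Gamma (\<alpha> + 1) / (Gamma (1/2) * Gamma (\<alpha> - \<beta>) * Gamma (\<beta> + 1/2)) *
          (1 - r\<^sup>2) powr (\<alpha> - \<beta> - 1) * (r * sin \<phi>) powr (2 * \<beta>) * r))"
        unfolding F_def G_def const using nn
        by (subst ennreal_mult[symmetric]) (auto intro!: mult_nonneg_nonneg simp: mult.assoc)
      then show "(case p of (x, y) \<Rightarrow> F x * G y) = (case p of (r, \<phi>) \<Rightarrow> ennreal (indicator ({0..1} \<times> {0..pi}) (r, \<phi>) *
         (2 * Gamma (\<alpha> + 1) / (Gamma (1/2) * Gamma (\<alpha> - \<beta>) * Gamma (\<beta> + 1/2)) *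
          (1 - r\<^sup>2) powr (\<alpha> - \<beta> - 1) * (r * sin \<phi>) powr (2 * \<beta>) * r)))"
        unfolding p by simp
    qed
    also have "\<dots> = jacobi_m \<alpha> \<beta>" using 3 by (simp add: jacobi_m_def)
    finally show ?thesis using 3 by (simp add: jacobi_radial_def jacobi_angular_def F_def G_def)
  qed
qed

text \<open>The angular law is invariant under \<open>\<phi> \<mapsto> \<pi> - \<phi>\<close>, the reflection at the imaginary axis.\<close>
lemma integral_angular_odd:
  fixes f :: "real \<Rightarrow> real"
  assumes [measurable]: "f \<in> borel_measurable borel" and odd: "\<And>\<phi>. f (pi - \<phi>) = - f \<phi>"
    and \<beta>: "- 1/2 \<le> \<beta>"
  shows "(\<integral>\<phi>. f \<phi> \<partial>jacobi_angular \<beta>) = 0"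
proof (cases "\<beta> = - 1/2")
  case True
  then show ?thesis using odd[of 0]
    by (simp add: jacobi_angular_def integral_distr integral_pmf_of_set)
next
  case False
  let ?g = "\<lambda>\<phi>. 1 / Beta (\<beta> + 1/2) (1/2) * (indicator {0..pi} \<phi> * sin \<phi> powr (2 * \<beta>)) :: real"
  have "0 \<le> 1 / Beta (\<beta> + 1/2) (1/2)"
    using Beta_pos_real[of "\<beta> + 1/2" "1/2"] False \<beta> by auto
  then have nn: "0 \<le> ?g \<phi>" for \<phi> by (intro mult_nonneg_nonneg) auto
  have "(\<integral>\<phi>. f \<phi> \<partial>jacobi_angular \<beta>) = (\<integral>\<phi>. ?g \<phi> * f \<phi> \<partial>lborel)"
    using False nn by (simp add: jacobi_angular_def integral_density)
  also have "\<dots> = (\<integral>\<phi>. ?g (pi - \<phi>) * f (pi - \<phi>) \<partial>lborel)"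
    by (subst lborel_integral_real_affine[where c = "-1" and t = pi]) auto
  also have "\<dots> = (\<integral>\<phi>. - (?g \<phi> * f \<phi>) \<partial>lborel)"
    by (intro Bochner_Integration.integral_cong) (auto simp: odd indicator_def)
  also have "\<dots> = - (\<integral>\<phi>. ?g \<phi> * f \<phi> \<partial>lborel)" by (rule Bochner_Integration.integral_minus)
  also have "(\<integral>\<phi>. ?g \<phi> * f \<phi> \<partial>lborel) = (\<integral>\<phi>. f \<phi> \<partial>jacobi_angular \<beta>)"
    using False nn by (simp add: jacobi_angular_def integral_density)
  finally show ?thesis by simp
qed

lemma has_bochner_integral_pair_mult:
  fixes f :: "'a \<Rightarrow> real" and g :: "'b \<Rightarrow> real"
  assumes "prob_space M1" "prob_space M2"
    and f: "has_bochner_integral M1 f a" and g: "has_bochner_integral M2 g b"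
  shows "has_bochner_integral (M1 \<Otimes>\<^sub>M M2) (\<lambda>p. f (fst p) * g (snd p)) (a * b)"
proof -
  interpret M1: prob_space M1 by fact
  interpret M2: prob_space M2 by fact
  interpret pair_prob_space M1 M2 ..
  have f': "integrable M1 f" "integral\<^sup>L M1 f = a" and g': "integrable M2 g" "integral\<^sup>L M2 g = b"
    using f g by (auto simp: has_bochner_integral_iff)
  have [measurable]: "f \<in> borel_measurable M1" "g \<in> borel_measurable M2"
    using f' g' by auto
  have int: "integrable (M1 \<Otimes>\<^sub>M M2) (\<lambda>p. f (fst p) * g (snd p))"
    by (rule Fubini_integrable) (auto simp: f' g' abs_mult)
  have "(\<integral>p. f (fst p) * g (snd p) \<partial>(M1 \<Otimes>\<^sub>M M2)) = a * b"
    by (subst integral_fst'[OF int, symmetric]) (simp add: f' g')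
  with int show ?thesis by (simp add: has_bochner_integral_iff)
qed

text \<open>The random point \<open>z = r exp (i \<phi>)\<close> of the unit disk.\<close>
definition disk_point :: "real \<times> real \<Rightarrow> complex" where
  "disk_point p = of_real (fst p) * cis (snd p)"

context
  fixes \<alpha> \<beta> :: real
  assumes ab: "\<beta> \<le> \<alpha>" "- 1/2 \<le> \<beta>" "- 1/2 < \<alpha>"
begin

lemma prob_space_jacobi_m: "prob_space (jacobi_m \<alpha> \<beta>)"
  unfolding jacobi_m_eq_pair_measure[OF ab]
  by (intro prob_space_pair prob_space_jacobi_radial prob_space_jacobi_angular ab)

lemma AE_jacobi_m: "AE p in jacobi_m \<alpha> \<beta>. 0 \<le> fst p \<and> fst p \<le> 1"
proof -
  have "AE p in distr (jacobi_m \<alpha> \<beta>) (jacobi_radial \<alpha> \<beta>) fst. 0 \<le> p \<and> p \<le> 1"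
    unfolding jacobi_m_eq_pair_measure[OF ab] 
      prob_space.distr_pair_fst[OF prob_space_jacobi_angular[OF ab(2)]]
    by (rule AE_jacobi_radial)
  then show ?thesis
    unfolding jacobi_m_eq_pair_measure[OF ab] by (rule AE_distrD[rotated]) measurable
qed

text \<open>The case \<open>\<alpha> = \<beta>\<close>, where \<open>r = 1\<close>, agrees with the formulas for Beta moments.\<close>
lemma radial_moments:
  "has_bochner_integral (jacobi_radial \<alpha> \<beta>) (\<lambda>r. r ^ 2) ((\<beta> + 1) / (\<alpha> + 1))"
  "has_bochner_integral (jacobi_radial \<alpha> \<beta>) (\<lambda>r. r ^ 4) ((\<beta> + 1) * (\<beta> + 2) / ((\<alpha> + 1) * (\<alpha> + 2)))"
proof -
  have pos: "0 < \<beta> + 1" "0 < \<alpha> + 1" using ab by auto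
  have B: "0 < Beta (\<beta> + 1) (\<alpha> - \<beta>)" "(\<alpha> + 1) * Beta (\<beta> + 2) (\<alpha> - \<beta>) = (\<beta> + 1) * Beta (\<beta> + 1) (\<alpha> - \<beta>)"
    "(\<alpha> + 2) * Beta (\<beta> + 3) (\<alpha> - \<beta>) = (\<beta> + 2) * Beta (\<beta> + 2) (\<alpha> - \<beta>)" if "\<alpha> \<noteq> \<beta>"
  proof -
    show "0 < Beta (\<beta> + 1) (\<alpha> - \<beta>)" using that ab by (intro Beta_pos_real) auto
    have "\<beta> + 1 \<notin> \<int>\<^sub>\<le>\<^sub>0" "\<beta> + 2 \<notin> \<int>\<^sub>\<le>\<^sub>0" using pos by (auto elim!: nonpos_Ints_cases)
    from Beta_plus1_left[OF this(1), of "\<alpha> - \<beta>"] Beta_plus1_left[OF this(2), of "\<alpha> - \<beta>"]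
    show "(\<alpha> + 1) * Beta (\<beta> + 2) (\<alpha> - \<beta>) = (\<beta> + 1) * Beta (\<beta> + 1) (\<alpha> - \<beta>)"
      "(\<alpha> + 2) * Beta (\<beta> + 3) (\<alpha> - \<beta>) = (\<beta> + 2) * Beta (\<beta> + 2) (\<alpha> - \<beta>)"
      by (simp_all add: add.commute)
  qed
  have "(if \<alpha> = \<beta> then 1 else Beta (\<beta> + 1 + 1) (\<alpha> - \<beta>) / Beta (\<beta> + 1) (\<alpha> - \<beta>)) = (\<beta> + 1) / (\<alpha> + 1)"
    using B(1,2) pos by (auto simp: field_simps)
  then show "has_bochner_integral (jacobi_radial \<alpha> \<beta>) (\<lambda>r. r ^ 2) ((\<beta> + 1) / (\<alpha> + 1))"
    using radial_has_moment[OF ab(1,2), of 1] by (simp only: of_nat_1 of_nat_numeral mult_1_right numeral_times_numeral semiring_norm)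
  have "(if \<alpha> = \<beta> then 1 else Beta (\<beta> + 1 + 2) (\<alpha> - \<beta>) / Beta (\<beta> + 1) (\<alpha> - \<beta>))
      = (\<beta> + 1) * (\<beta> + 2) / ((\<alpha> + 1) * (\<alpha> + 2))"
  proof (cases "\<alpha> = \<beta>")
    case False
    have "((\<alpha> + 1) * (\<alpha> + 2)) * Beta (\<beta> + 3) (\<alpha> - \<beta>) = (\<beta> + 1) * (\<beta> + 2) * Beta (\<beta> + 1) (\<alpha> - \<beta>)"
      using B(2,3)[OF False] by algebra
    then show ?thesis using False B(1)[OF False] pos by (simp add: divide_simps add.commute mult.commute)
  qed (use pos in auto)
  then show "has_bochner_integral (jacobi_radial \<alpha> \<beta>) (\<lambda>r. r ^ 4) ((\<beta> + 1) * (\<beta> + 2) / ((\<alpha> + 1) * (\<alpha> + 2)))"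
    using radial_has_moment[OF ab(1,2), of 2] by (simp only: of_nat_1 of_nat_numeral mult_1_right numeral_times_numeral semiring_norm)
qed

text \<open>The case \<open>\<beta> = - 1/2\<close>, where \<open>cos\<^sup>2 \<phi> = 1\<close>, agrees with the formulas for Beta moments.\<close>
lemma angular_moments:
  "has_bochner_integral (jacobi_angular \<beta>) (\<lambda>\<phi>. cos \<phi> ^ 2) (1 / (2 * (\<beta> + 1)))"
  "has_bochner_integral (jacobi_angular \<beta>) (\<lambda>\<phi>. cos \<phi> ^ 4) (3 / (4 * (\<beta> + 1) * (\<beta> + 2)))"
proof -
  have pos: "0 < \<beta> + 1" using ab by auto
  let ?a = "\<beta> + 1/2"
  have B: "0 < Beta ?a (1/2)" "(\<beta> + 1) * Beta ?a (3/2) = (1/2) * Beta ?a (1/2)"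
    "(\<beta> + 2) * Beta ?a (5/2) = (3/2) * Beta ?a (3/2)" if "\<beta> \<noteq> - 1/2"
  proof -
    show "0 < Beta ?a (1/2)" using that ab by (intro Beta_pos_real) auto
    have "(1/2 :: real) \<notin> \<int>\<^sub>\<le>\<^sub>0" "(3/2 :: real) \<notin> \<int>\<^sub>\<le>\<^sub>0" by (auto elim!: nonpos_Ints_cases)
    from Beta_plus1_right[OF this(1), of ?a] Beta_plus1_right[OF this(2), of ?a]
    show "(\<beta> + 1) * Beta ?a (3/2) = (1/2) * Beta ?a (1/2)"
      "(\<beta> + 2) * Beta ?a (5/2) = (3/2) * Beta ?a (3/2)"
      by (simp_all add: add.commute)
  qed
  have "(if \<beta> = - 1/2 then 1 else Beta ?a (1 + 1/2) / Beta ?a (1/2)) = 1 / (2 * (\<beta> + 1))"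
    using B(1,2) pos by (auto simp: field_simps)
  then show "has_bochner_integral (jacobi_angular \<beta>) (\<lambda>\<phi>. cos \<phi> ^ 2) (1 / (2 * (\<beta> + 1)))"
    using angular_has_even_moment[OF ab(2), of 1] by (simp only: of_nat_1 of_nat_numeral mult_1_right numeral_times_numeral semiring_norm)
  have "(if \<beta> = - 1/2 then 1 else Beta ?a (2 + 1/2) / Beta ?a (1/2)) = 3 / (4 * (\<beta> + 1) * (\<beta> + 2))"
  proof (cases "\<beta> = - 1/2")
    case False
    have "4 * (\<beta> + 1) * (\<beta> + 2) * Beta ?a (5/2) = 3 * Beta ?a (1/2)"
      using B(2,3)[OF False] by algebra
    then show ?thesis using False B(1)[OF False] pos by (simp add: divide_simps add.commute mult.commute)
  qed simp
  then show "has_bochner_integral (jacobi_angular \<beta>) (\<lambda>\<phi>. cos \<phi> ^ 4) (3 / (4 * (\<beta> + 1) * (\<beta> + 2)))"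
    using angular_has_even_moment[OF ab(2), of 2] by (simp only: of_nat_1 of_nat_numeral mult_1_right numeral_times_numeral semiring_norm)
qed

lemma radial_integrable_power: "integrable (jacobi_radial \<alpha> \<beta>) (\<lambda>r. r ^ k)"
proof -
  interpret prob_space "jacobi_radial \<alpha> \<beta>" by (rule prob_space_jacobi_radial[OF ab(1,2)])
  show ?thesis
  proof (rule integrable_const_bound[where B = 1])
    show "AE r in jacobi_radial \<alpha> \<beta>. norm (r ^ k) \<le> 1"
      using AE_jacobi_radial by eventually_elim (simp add: power_le_one)
  qed measurable
qed

lemma angular_integrable_cos_power: "integrable (jacobi_angular \<beta>) (\<lambda>\<phi>. cos \<phi> ^ k)"
proof -
  interpret prob_space "jacobi_angular \<beta>" by (rule prob_space_jacobi_angular[OF ab(2)])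
  show ?thesis
    by (intro integrable_const_bound[where B = 1]) (auto simp: power_abs intro!: AE_I2 power_le_one)
qed

lemma has_bochner_integral_jacobi_m:
  assumes "has_bochner_integral (jacobi_radial \<alpha> \<beta>) f a" "has_bochner_integral (jacobi_angular \<beta>) g b"
  shows "has_bochner_integral (jacobi_m \<alpha> \<beta>) (\<lambda>p. f (fst p) * g (snd p)) (a * b :: real)"
  unfolding jacobi_m_eq_pair_measure[OF ab]
  by (intro has_bochner_integral_pair_mult assms prob_space_jacobi_radial prob_space_jacobi_angular ab)

lemma has_bochner_integral_jacobi_m_odd:
  assumes "g \<in> borel_measurable borel" "integrable (jacobi_angular \<beta>) g" "\<And>\<phi>. g (pi - \<phi>) = - g \<phi>"
  shows "has_bochner_integral (jacobi_m \<alpha> \<beta>) (\<lambda>p. fst p ^ k * g (snd p)) 0"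
proof -
  have "has_bochner_integral (jacobi_angular \<beta>) g 0"
    using assms integral_angular_odd[OF assms(1,3) ab(2)] by (simp add: has_bochner_integral_iff)
  from has_bochner_integral_jacobi_m[OF has_bochner_integral_integrable[OF radial_integrable_power] this]
  show ?thesis by simp
qed

lemma Re_disk_point_power: "Re (disk_point p ^ k) = fst p ^ k * cos (k * snd p)"
  unfolding disk_point_def power_mult_distrib Complex.DeMoivre of_real_power[symmetric] by simp

text \<open>By de Moivre, \<open>Re z\<^sup>k = r\<^sup>k cos (k \<phi>)\<close>, a polynomial in \<open>cos \<phi>\<close> of the parity of \<open>k\<close>.\<close>
lemma disk_moment_1: "has_bochner_integral (jacobi_m \<alpha> \<beta>) (\<lambda>p. Re (disk_point p)) 0"
  using has_bochner_integral_jacobi_m_odd[of cos 1] angular_integrable_cos_power[of 1]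
  by (simp add: disk_point_def)

lemma disk_moment_2: "has_bochner_integral (jacobi_m \<alpha> \<beta>) (\<lambda>p. Re (disk_point p ^ 2)) (- \<beta> / (\<alpha> + 1))"
proof -
  have "has_bochner_integral (jacobi_angular \<beta>) (\<lambda>\<phi>. 2 * cos \<phi> ^ 2 - 1 * cos \<phi> ^ (2 * 0))
      (2 * (1 / (2 * (\<beta> + 1))) - 1 * 1)"
    using prob_space.prob_space[OF prob_space_jacobi_angular[OF ab(2)]] angular_integrable_cos_power[of 0]
    by (intro has_bochner_integral_diff has_bochner_integral_mult_right angular_moments)
      (simp add: has_bochner_integral_iff)
  from has_bochner_integral_jacobi_m[OF radial_moments(1) this]
  have "has_bochner_integral (jacobi_m \<alpha> \<beta>) (\<lambda>p. fst p ^ 2 * (2 * cos (snd p) ^ 2 - 1)) ((\<beta> + 1) / (\<alpha> + 1) * (2 * (1 / (2 * (\<beta> + 1))) - 1))"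
    by simp
  moreover have "(\<beta> + 1) / (\<alpha> + 1) * (2 * (1 / (2 * (\<beta> + 1))) - 1) = - \<beta> / (\<alpha> + 1)"
    using ab by (simp add: divide_simps)
  moreover have "Re (disk_point p ^ 2) = fst p ^ 2 * (2 * cos (snd p) ^ 2 - 1)" for p
    by (simp add: Re_disk_point_power cos_double_cos)
  ultimately show ?thesis by simp
qed

lemma disk_moment_3: "has_bochner_integral (jacobi_m \<alpha> \<beta>) (\<lambda>p. Re (disk_point p ^ 3)) 0"
proof -
  have "has_bochner_integral (jacobi_m \<alpha> \<beta>) (\<lambda>p. fst p ^ 3 * (4 * cos (snd p) ^ 3 - 3 * cos (snd p))) 0"
    using angular_integrable_cos_power[of 1] angular_integrable_cos_power[of 3]
    by (intro has_bochner_integral_jacobi_m_odd) auto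
  moreover have "Re (disk_point p ^ 3) = fst p ^ 3 * (4 * cos (snd p) ^ 3 - 3 * cos (snd p))" for p
    by (simp add: Re_disk_point_power cos_treble_cos)
  ultimately show ?thesis by simp
qed

lemma disk_moment_4:
  "has_bochner_integral (jacobi_m \<alpha> \<beta>) (\<lambda>p. Re (disk_point p ^ 4)) (\<beta> * (\<beta> - 1) / ((\<alpha> + 1) * (\<alpha> + 2)))"
proof -
  have "has_bochner_integral (jacobi_angular \<beta>) (\<lambda>\<phi>. (8 * cos \<phi> ^ 4 - 8 * cos \<phi> ^ 2) + 1 * cos \<phi> ^ (2 * 0))
      ((8 * (3 / (4 * (\<beta> + 1) * (\<beta> + 2))) - 8 * (1 / (2 * (\<beta> + 1)))) + 1 * 1)"
    using prob_space.prob_space[OF prob_space_jacobi_angular[OF ab(2)]] angular_integrable_cos_power[of 0]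
    by (intro has_bochner_integral_add has_bochner_integral_diff has_bochner_integral_mult_right angular_moments)
      (simp add: has_bochner_integral_iff)
  from has_bochner_integral_jacobi_m[OF radial_moments(2) this]
  have "has_bochner_integral (jacobi_m \<alpha> \<beta>) (\<lambda>p. fst p ^ 4 * (8 * cos (snd p) ^ 4 - 8 * cos (snd p) ^ 2 + 1))
     (((\<beta> + 1) * (\<beta> + 2) / ((\<alpha> + 1) * (\<alpha> + 2))) * (8 * (3 / (4 * (\<beta> + 1) * (\<beta> + 2))) - 8 * (1 / (2 * (\<beta> + 1))) + 1))"
    by simp
  moreover have "((\<beta> + 1) * (\<beta> + 2) / ((\<alpha> + 1) * (\<alpha> + 2))) * (8 * (3 / (4 * (\<beta> + 1) * (\<beta> + 2))) - 8 * (1 / (2 * (\<beta> + 1))) + 1)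
      = \<beta> * (\<beta> - 1) / ((\<alpha> + 1) * (\<alpha> + 2))"
  proof -
    have "(\<beta> + 1) * (\<beta> + 2) * (8 * (3 / (4 * (\<beta> + 1) * (\<beta> + 2))) - 8 * (1 / (2 * (\<beta> + 1))) + 1) = \<beta> * (\<beta> - 1)"
      using ab by (simp add: divide_simps) (simp add: algebra_simps)
    then show ?thesis by (simp add: times_divide_eq_left)
  qed
  moreover have "Re (disk_point p ^ 4) = fst p ^ 4 * (8 * cos (snd p) ^ 4 - 8 * cos (snd p) ^ 2 + 1)" for p
  proof -
    have "cos (4 * snd p) = 2 * (cos (2 * snd p))\<^sup>2 - 1" using cos_double_cos[of "2 * snd p"] by simp
    also have "\<dots> = 8 * cos (snd p) ^ 4 - 8 * cos (snd p) ^ 2 + 1"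
      unfolding cos_double_cos by (simp add: algebra_simps power2_eq_square power4_eq_xxxx)
    finally show ?thesis
      by (simp add: Re_disk_point_power)
  qed
  ultimately show ?thesis by (simp only:)
qed

lemma disk_moment_Re_square:
  "has_bochner_integral (jacobi_m \<alpha> \<beta>) (\<lambda>p. (Re (disk_point p))\<^sup>2) (1 / (2 * (\<alpha> + 1)))"
proof -
  have "(\<beta> + 1) / (\<alpha> + 1) * (1 / (2 * (\<beta> + 1))) = 1 / (2 * (\<alpha> + 1))"
    using ab mult_divide_mult_cancel_left[of "\<beta> + 1" 1 "2 * (\<alpha> + 1)"] by (simp only: times_divide_times_eq mult_ac)
  then show ?thesis
    using has_bochner_integral_jacobi_m[OF radial_moments(1) angular_moments(1)]
    by (simp add: disk_point_def power_mult_distrib)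
qed

end

section \<open>Mean and second moment of one increment\<close>

lemma (in prob_space) abs_integral_diff_le:
  fixes f g :: "'a \<Rightarrow> real"
  assumes "integrable M f" "integrable M g" "AE x in M. \<bar>f x - g x\<bar> \<le> B"
  shows "\<bar>(\<integral>x. f x \<partial>M) - (\<integral>x. g x \<partial>M)\<bar> \<le> B"
proof -
  have "\<bar>\<integral>x. f x - g x \<partial>M\<bar> \<le> (\<integral>x. \<bar>f x - g x\<bar> \<partial>M)" by (rule integral_abs_bound)
  also have "\<dots> \<le> (\<integral>x. B \<partial>M)" using assms by (intro integral_mono_AE) auto
  also have "\<dots> = B" by (simp add: prob_space)
  finally show ?thesis using assms by simp
qed

lemma measurable_disk_point [measurable]: "disk_point \<in> borel_measurable borel"
proof -
  have eq: "disk_point = (\<lambda>p. of_real (fst p) * exp (\<i> * of_real (snd p)))"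
    by (simp add: disk_point_def fun_eq_iff cis_conv_exp)
  show ?thesis unfolding eq by (intro borel_measurable_continuous_onI continuous_intros)
qed

lemma measurable_log_step [measurable (raw)]:
  assumes "f \<in> borel_measurable M" "g \<in> borel_measurable M"
  shows "(\<lambda>x. log_step (f x) (g x)) \<in> borel_measurable M"
proof -
  have [measurable]: "(cosh :: real \<Rightarrow> real) \<in> borel_measurable borel" "(sinh :: real \<Rightarrow> real) \<in> borel_measurable borel"
    by (auto intro!: borel_measurable_continuous_onI continuous_intros)
  note [measurable] = assms
  show ?thesis unfolding log_step_def by measurable
qed

text \<open>The data of one step, with a law that is supported in \<open>[0, K]\<close>.  The normalisation \<open>1 \<le> K\<close> makes
\<open>c K \<le> 1\<close> imply \<open>c \<le> 1\<close>, and the smallness condition on \<open>c\<close> is always stated as \<open>c K \<le> 1\<close>: it puts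
the step size \<open>c x\<close> into the interval \<open>[0, 1]\<close> of the Taylor expansion.\<close>
locale jacobi_step =
  fixes \<alpha> \<beta> :: real and \<nu> :: "real measure" and K :: real
  assumes ab: "\<beta> \<le> \<alpha>" "- 1/2 \<le> \<beta>" "- 1/2 < \<alpha>"
    and prob_space_law: "prob_space \<nu>" and sets_law [measurable_cong]: "sets \<nu> = sets borel"
    and AE_law: "AE x in \<nu>. 0 \<le> x \<and> x \<le> K" and K_ge_1: "1 \<le> K"
    and second_moment_pos: "0 < moment \<nu> 2"
begin

abbreviation (input) "m2 \<equiv> moment \<nu> 2"
abbreviation (input) "m4 \<equiv> moment \<nu> 4"
text \<open>The averages of \<open>Re z\<^sup>2\<close> and \<open>Re z\<^sup>4\<close>.\<close>
definition "mean_z2 = - \<beta> / (\<alpha> + 1)"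
definition "mean_z4 = \<beta> * (\<beta> - 1) / ((\<alpha> + 1) * (\<alpha> + 2))"

definition step_measure :: "(real \<times> real \<times> real) measure" where
  "step_measure = \<nu> \<Otimes>\<^sub>M jacobi_m \<alpha> \<beta>"

text \<open>The increment of \<open>ln (cosh S)\<close> from a position with \<open>tanh S = u\<close>; the argument \<open>q = (x, r, \<phi>)\<close>
consists of the unscaled step \<open>x\<close> with law \<open>\<nu>\<close> and of polar coordinates of \<open>z\<close>.\<close>
definition increment :: "real \<Rightarrow> real \<Rightarrow> real \<times> real \<times> real \<Rightarrow> real" where
  "increment c u q = log_step (c * fst q) (of_real u * disk_point (snd q))"

lemma sets_step_measure [measurable_cong]: "sets step_measure = sets borel"
  using sets_pair_measure_cong[OF sets_law sets_jacobi_m[of \<alpha> \<beta>]]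
  by (simp only: step_measure_def borel_prod)

lemma prob_space_step: "prob_space step_measure"
  unfolding step_measure_def by (intro prob_space_pair prob_space_law prob_space_jacobi_m ab)

sublocale step: prob_space step_measure by (rule prob_space_step)

lemma AE_step: "AE q in step_measure. 0 \<le> fst q \<and> fst q \<le> K \<and> 0 \<le> fst (snd q) \<and> fst (snd q) \<le> 1"
proof -
  interpret law: prob_space \<nu> by (rule prob_space_law)
  interpret m: prob_space "jacobi_m \<alpha> \<beta>" by (rule prob_space_jacobi_m[OF ab])
  interpret pair_prob_space \<nu> "jacobi_m \<alpha> \<beta>" ..
  show ?thesis unfolding step_measure_def
  proof (rule AE_pair_measure)
    have sets: "sets (\<nu> \<Otimes>\<^sub>M jacobi_m \<alpha> \<beta>) = sets (borel :: (real \<times> real \<times> real) measure)"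
      using sets_step_measure by (simp only: step_measure_def)
    have "{q :: real \<times> real \<times> real. 0 \<le> fst q \<and> fst q \<le> K \<and> 0 \<le> fst (snd q) \<and> fst (snd q) \<le> 1} \<in> sets borel"
      by (intro borel_closed closed_Collect_conj closed_Collect_le continuous_intros)
    then show "{q \<in> space (\<nu> \<Otimes>\<^sub>M jacobi_m \<alpha> \<beta>). 0 \<le> fst q \<and> fst q \<le> K \<and> 0 \<le> fst (snd q) \<and> fst (snd q) \<le> 1}
        \<in> sets (\<nu> \<Otimes>\<^sub>M jacobi_m \<alpha> \<beta>)"
      unfolding sets sets_eq_imp_space_eq[OF sets] by simp
    show "AE x in \<nu>. AE y in jacobi_m \<alpha> \<beta>. 0 \<le> fst (x, y) \<and> fst (x, y) \<le> K \<and> 0 \<le> fst (snd (x, y)) \<and> fst (snd (x, y)) \<le> 1"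
      using AE_law
    proof eventually_elim
      case (elim x)
      then show ?case using AE_jacobi_m[OF ab] by simp
    qed
  qed
qed

lemma integrable_power_law: "integrable \<nu> (\<lambda>x. x ^ k)"
proof -
  interpret law: prob_space \<nu> by (rule prob_space_law)
  show ?thesis
  proof (rule law.integrable_const_bound[where B = "K ^ k"])
    show "AE x in \<nu>. norm (x ^ k) \<le> K ^ k"
      using AE_law by eventually_elim (auto simp: power_abs intro: power_mono)
  qed measurable
qed

lemma step_moment:
  assumes "has_bochner_integral (jacobi_m \<alpha> \<beta>) (\<lambda>p. Re (disk_point p ^ k)) b"
  shows "has_bochner_integral step_measure (\<lambda>q. fst q ^ j * Re (disk_point (snd q) ^ k)) (moment \<nu> j * b)"
  unfolding step_measure_def
  by (intro has_bochner_integral_pair_mult prob_space_law prob_space_jacobi_m ab assms)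
    (simp add: has_bochner_integral_iff integrable_power_law moment_def)

lemma measurable_increment [measurable]: "increment c u \<in> borel_measurable borel"
proof -
  have [measurable]: "(fst :: real \<times> real \<times> real \<Rightarrow> real) \<in> borel_measurable borel"
    "(snd :: real \<times> real \<times> real \<Rightarrow> real \<times> real) \<in> borel_measurable borel"
    by (auto intro!: borel_measurable_continuous_onI continuous_intros)
  show ?thesis unfolding increment_def[abs_def] by measurable
qed

context
  fixes c u :: real
  assumes c: "0 < c" "c * K \<le> 1" and u: "0 \<le> u" "u \<le> 1"
begin

text \<open>The Taylor polynomial of the increment is written as a combination of products
\<open>x\<^sup>j Re z\<^sup>k\<close>, whose integrals factor.\<close>
lemma AE_increment:
  "AE q in step_measure. \<bar>increment c u q\<bar> \<le> c * K \<and>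
     \<bar>increment c u q -
       (u * c * (fst q ^ 1 * Re (disk_point (snd q) ^ 1))
         + c^2 / 2 * (fst q ^ 2 * Re (disk_point (snd q) ^ 0))
         - u^2 * c^2 / 2 * (fst q ^ 2 * Re (disk_point (snd q) ^ 2))
         - u * c^3 / 3 * (fst q ^ 3 * Re (disk_point (snd q) ^ 1))
         + u^3 * c^3 / 3 * (fst q ^ 3 * Re (disk_point (snd q) ^ 3))
         - c^4 / 12 * (fst q ^ 4 * Re (disk_point (snd q) ^ 0))
         + u^2 * c^4 / 3 * (fst q ^ 4 * Re (disk_point (snd q) ^ 2))
         - u^4 * c^4 / 4 * (fst q ^ 4 * Re (disk_point (snd q) ^ 4)))\<bar> \<le> 20000 * (c * K)^5 \<and>
     \<bar>(increment c u q)\<^sup>2 - u^2 * c^2 * (fst q ^ 2 * (Re (disk_point (snd q)))\<^sup>2)\<bar> \<le> 100000 * (c * K)^3"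
  using AE_step
proof eventually_elim
  case (elim q)
  define t where "t = c * fst q"
  define z where "z = disk_point (snd q)"
  define w where "w = of_real u * z"
  have t: "0 \<le> t" "t \<le> c * K" "t \<le> 1" using elim c
    by (auto simp: t_def intro: order_trans[OF mult_left_mono])
  have z: "cmod z \<le> 1" using elim by (simp add: z_def disk_point_def norm_mult)
  have w: "cmod w \<le> 1" using z u mult_mono[of u 1 "cmod z" 1] by (simp add: w_def norm_mult)
  have inc: "increment c u q = log_step t w" by (simp add: increment_def t_def w_def z_def)
  have D: "\<bar>log_step t w\<bar> \<le> t" by (rule abs_log_step_le[OF t(1) w])
  have Rez: "\<bar>Re z\<bar> \<le> 1" using z abs_Re_le_cmod order_trans by blast
  have Rew: "\<bar>Re w\<bar> \<le> 1" using w abs_Re_le_cmod order_trans by blast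
  let ?P = "Re (w * t + (1 - w\<^sup>2) / 2 * t^2 - w * (1 - w\<^sup>2) / 3 * t^3 - (1 - w\<^sup>2) * (1 - 3 * w\<^sup>2) / 12 * t^4)"
  have T: "\<bar>log_step t w - ?P\<bar> \<le> 20000 * t ^ 5" by (rule log_step_taylor[OF t(1,3) w])
  have Peq: "?P = u * c * (fst q ^ 1 * Re (z ^ 1))
         + c^2 / 2 * (fst q ^ 2 * Re (z ^ 0))
         - u^2 * c^2 / 2 * (fst q ^ 2 * Re (z ^ 2))
         - u * c^3 / 3 * (fst q ^ 3 * Re (z ^ 1))
         + u^3 * c^3 / 3 * (fst q ^ 3 * Re (z ^ 3))
         - c^4 / 12 * (fst q ^ 4 * Re (z ^ 0))
         + u^2 * c^4 / 3 * (fst q ^ 4 * Re (z ^ 2))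
         - u^4 * c^4 / 4 * (fst q ^ 4 * Re (z ^ 4))"
  proof -
    have "w * t + (1 - w\<^sup>2) / 2 * t^2 - w * (1 - w\<^sup>2) / 3 * t^3 - (1 - w\<^sup>2) * (1 - 3 * w\<^sup>2) / 12 * t^4
      = of_real (u * t) * z + of_real (t^2 / 2) - of_real (u^2 * t^2 / 2) * z^2
        - of_real (u * t^3 / 3) * z + of_real (u^3 * t^3 / 3) * z^3 - of_real (t^4 / 12)
        + of_real (u^2 * t^4 / 3) * z^2 - of_real (u^4 * t^4 / 4) * z^4"
      unfolding w_def by (simp add: field_simps power_mult_distrib) (simp add: algebra_simps eval_nat_numeral)
    then have "?P = Re (of_real (u * t) * z + of_real (t^2 / 2) - of_real (u^2 * t^2 / 2) * z^2
        - of_real (u * t^3 / 3) * z + of_real (u^3 * t^3 / 3) * z^3 - of_real (t^4 / 12)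
        + of_real (u^2 * t^4 / 3) * z^2 - of_real (u^4 * t^4 / 4) * z^4)" by (simp only:)
    also have "\<dots> = u * t * Re z + t^2 / 2 - u^2 * t^2 / 2 * Re (z^2)
        - u * t^3 / 3 * Re z + u^3 * t^3 / 3 * Re (z^3) - t^4 / 12
        + u^2 * t^4 / 3 * Re (z^2) - u^4 * t^4 / 4 * Re (z^4)"
      by (simp only: plus_complex.sel minus_complex.sel Re_complex_of_real times_complex.sel Im_complex_of_real mult_zero_left diff_zero)
    finally show ?thesis by (simp add: t_def power_mult_distrib mult_ac)
  qed
  have T5: "20000 * t ^ 5 \<le> 20000 * (c * K) ^ 5" using t by (intro mult_left_mono power_mono) auto
  have SQ: "\<bar>(log_step t w)\<^sup>2 - u^2 * c^2 * (fst q ^ 2 * (Re z)\<^sup>2)\<bar> \<le> 100000 * (c * K)^3"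
  proof -
    \<comment> \<open>For the second moment the first-order expansion is enough.\<close>
    have "\<bar>log_step t w - t * Re w\<bar> \<le> 30000 * t ^ 2"
    proof -
      have w2: "cmod (w\<^sup>2) \<le> 1" using w by (simp add: norm_power power_le_one)
      have a: "cmod (1 - w\<^sup>2) \<le> 2" using norm_triangle_ineq4[of 1 "w\<^sup>2"] w2 by simp
      have b: "cmod (1 - 3 * w\<^sup>2) \<le> 4" using norm_triangle_ineq4[of 1 "3 * w\<^sup>2"] w2 by (simp add: norm_mult)
      have c: "cmod (w * (1 - w\<^sup>2)) \<le> 1 * 2" unfolding norm_mult by (intro mult_mono a w) auto
      have d: "cmod ((1 - w\<^sup>2) * (1 - 3 * w\<^sup>2)) \<le> 2 * 4" unfolding norm_mult by (intro mult_mono a b) auto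
      have t32: "t ^ 3 \<le> t ^ 2" "t ^ 4 \<le> t ^ 2" "t ^ 5 \<le> t ^ 2" using t by (auto intro!: power_decreasing)
      have X: "cmod ((1 - w\<^sup>2) / 2 * t^2 - w * (1 - w\<^sup>2) / 3 * t^3 - (1 - w\<^sup>2) * (1 - 3 * w\<^sup>2) / 12 * t^4)
        \<le> cmod ((1 - w\<^sup>2) / 2 * t^2) + cmod (w * (1 - w\<^sup>2) / 3 * t^3) + cmod ((1 - w\<^sup>2) * (1 - 3 * w\<^sup>2) / 12 * t^4)"
        by (intro order_trans[OF norm_triangle_ineq4] add_mono order_refl)
      have X2: "cmod ((1 - w\<^sup>2) / 2 * t^2) \<le> 1 * t^2" "cmod (w * (1 - w\<^sup>2) / 3 * t^3) \<le> 1 * t^3"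
         "cmod ((1 - w\<^sup>2) * (1 - 3 * w\<^sup>2) / 12 * t^4) \<le> 1 * t^4"
      proof -
        have "cmod ((1 - w\<^sup>2) / 2 * t^2) = cmod (1 - w\<^sup>2) / 2 * t^2"
          "cmod (w * (1 - w\<^sup>2) / 3 * t^3) = cmod (w * (1 - w\<^sup>2)) / 3 * t^3"
          "cmod ((1 - w\<^sup>2) * (1 - 3 * w\<^sup>2) / 12 * t^4) = cmod ((1 - w\<^sup>2) * (1 - 3 * w\<^sup>2)) / 12 * t^4"
          using t(1) by (simp_all add: norm_mult norm_divide norm_power)
        then show "cmod ((1 - w\<^sup>2) / 2 * t^2) \<le> 1 * t^2" "cmod (w * (1 - w\<^sup>2) / 3 * t^3) \<le> 1 * t^3"
         "cmod ((1 - w\<^sup>2) * (1 - 3 * w\<^sup>2) / 12 * t^4) \<le> 1 * t^4"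
          using a c d t(1) by (auto simp only: intro!: mult_right_mono zero_le_power)
      qed
      have "?P - t * Re w = Re ((1 - w\<^sup>2) / 2 * t^2 - w * (1 - w\<^sup>2) / 3 * t^3 - (1 - w\<^sup>2) * (1 - 3 * w\<^sup>2) / 12 * t^4)"
        by (simp only: plus_complex.sel minus_complex.sel) simp
      then have "\<bar>?P - t * Re w\<bar> \<le> 3 * t^2"
        using X X2 t32 abs_Re_le_cmod[of "(1 - w\<^sup>2) / 2 * t^2 - w * (1 - w\<^sup>2) / 3 * t^3 - (1 - w\<^sup>2) * (1 - 3 * w\<^sup>2) / 12 * t^4"]
        by linarith
      then show ?thesis using T t32 by linarith
    qed
    moreover have "\<bar>log_step t w + t * Re w\<bar> \<le> 2 * t"
    proof -
      have "\<bar>t * Re w\<bar> \<le> t" using mult_left_mono[OF Rew t(1)] t(1) by (simp add: abs_mult)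
      then show ?thesis using D by linarith
    qed
    ultimately have "\<bar>(log_step t w - t * Re w) * (log_step t w + t * Re w)\<bar> \<le> (30000 * t^2) * (2 * t)"
      unfolding abs_mult by (rule mult_mono) (use t in auto)
    also have "\<dots> = 60000 * t ^ 3" by (simp add: eval_nat_numeral)
    also have "\<dots> \<le> 100000 * (c * K)^3" using t by (intro mult_mono power_mono) auto
    also have "(log_step t w - t * Re w) * (log_step t w + t * Re w) = (log_step t w)\<^sup>2 - u^2 * c^2 * (fst q ^ 2 * (Re z)\<^sup>2)"
      by (simp add: w_def t_def algebra_simps power2_eq_square)
    finally show ?thesis .
  qed
  show ?case
    unfolding inc z_def[symmetric] Peq[symmetric]
    by (intro conjI order_trans[OF D t(2)] order_trans[OF T T5] SQ)
qed

lemma integrable_increment: "integrable step_measure (increment c u)"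
  "integrable step_measure (\<lambda>q. (increment c u q)\<^sup>2)"
proof -
  show "integrable step_measure (increment c u)"
  proof (rule step.integrable_const_bound)
    show "AE q in step_measure. norm (increment c u q) \<le> c * K"
      using AE_increment by eventually_elim simp
  qed measurable
  show "integrable step_measure (\<lambda>q. (increment c u q)\<^sup>2)"
  proof (rule step.integrable_const_bound)
    show "AE q in step_measure. norm ((increment c u q)\<^sup>2) \<le> (c * K)\<^sup>2"
      using AE_increment proof eventually_elim
        case (elim q)
        then show ?case using power_mono[of "\<bar>increment c u q\<bar>" "c * K" 2] by simp
      qed
  qed measurable
qed

text \<open>Of the Taylor polynomial only the terms with \<open>k \<in> {0, 2, 4}\<close> survive integration.\<close>
lemma step_mean:
  "\<bar>(\<integral>q. increment c u q \<partial>step_measure) -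
     (c^2 * m2 * (1 - u^2 * mean_z2) / 2 - c^4 * m4 * (1 - 4 * u^2 * mean_z2 + 3 * u^4 * mean_z4) / 12)\<bar> \<le> 20000 * (c * K)^5"
proof -
  interpret m: prob_space "jacobi_m \<alpha> \<beta>" by (rule prob_space_jacobi_m[OF ab])
  have m0: "has_bochner_integral (jacobi_m \<alpha> \<beta>) (\<lambda>p. Re (disk_point p ^ 0)) 1"
    by (simp add: has_bochner_integral_iff m.prob_space)
  have m1: "has_bochner_integral (jacobi_m \<alpha> \<beta>) (\<lambda>p. Re (disk_point p ^ 1)) 0"
    using disk_moment_1[OF ab] by simp
  note T = step_moment[OF m0] step_moment[OF m1] step_moment[OF disk_moment_2[OF ab], folded mean_z2_def]
     step_moment[OF disk_moment_3[OF ab]] step_moment[OF disk_moment_4[OF ab], folded mean_z4_def]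
  have "has_bochner_integral step_measure (\<lambda>q. u * c * (fst q ^ 1 * Re (disk_point (snd q) ^ 1))
         + c^2 / 2 * (fst q ^ 2 * Re (disk_point (snd q) ^ 0))
         - u^2 * c^2 / 2 * (fst q ^ 2 * Re (disk_point (snd q) ^ 2))
         - u * c^3 / 3 * (fst q ^ 3 * Re (disk_point (snd q) ^ 1))
         + u^3 * c^3 / 3 * (fst q ^ 3 * Re (disk_point (snd q) ^ 3))
         - c^4 / 12 * (fst q ^ 4 * Re (disk_point (snd q) ^ 0))
         + u^2 * c^4 / 3 * (fst q ^ 4 * Re (disk_point (snd q) ^ 2))
         - u^4 * c^4 / 4 * (fst q ^ 4 * Re (disk_point (snd q) ^ 4)))
     (u * c * (moment \<nu> 1 * 0) + c^2 / 2 * (m2 * 1) - u^2 * c^2 / 2 * (m2 * mean_z2) - u * c^3 / 3 * (moment \<nu> 3 * 0)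
        + u^3 * c^3 / 3 * (moment \<nu> 3 * 0) - c^4 / 12 * (m4 * 1) + u^2 * c^4 / 3 * (m4 * mean_z2) - u^4 * c^4 / 4 * (m4 * mean_z4))"
    (is "has_bochner_integral _ ?P ?I")
    by (intro has_bochner_integral_add has_bochner_integral_diff has_bochner_integral_mult_right T)
  then have P: "integrable step_measure ?P" "(\<integral>q. ?P q \<partial>step_measure) = ?I"
    by (simp_all only: has_bochner_integral_iff)
  have I: "?I = c^2 * m2 * (1 - u^2 * mean_z2) / 2 - c^4 * m4 * (1 - 4 * u^2 * mean_z2 + 3 * u^4 * mean_z4) / 12"
    by (simp add: field_simps)
  have "AE q in step_measure. \<bar>increment c u q - ?P q\<bar> \<le> 20000 * (c * K)^5"
    using AE_increment by eventually_elim (simp only:)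
  from step.abs_integral_diff_le[OF integrable_increment(1) P(1) this]
  show ?thesis unfolding P(2) I .
qed

lemma step_second_moment:
  "\<bar>(\<integral>q. (increment c u q)\<^sup>2 \<partial>step_measure) - u^2 * c^2 * m2 / (2 * (\<alpha> + 1))\<bar> \<le> 100000 * (c * K)^3"
proof -
  have "has_bochner_integral step_measure (\<lambda>q. u^2 * c^2 * (fst q ^ 2 * (Re (disk_point (snd q)))\<^sup>2))
      (u^2 * c^2 * (m2 * (1 / (2 * (\<alpha> + 1)))))" (is "has_bochner_integral _ ?P ?I")
    unfolding step_measure_def
    by (intro has_bochner_integral_mult_right has_bochner_integral_pair_mult prob_space_law prob_space_jacobi_m ab
          disk_moment_Re_square) (simp add: has_bochner_integral_iff integrable_power_law moment_def)
  then have P: "integrable step_measure ?P" "(\<integral>q. ?P q \<partial>step_measure) = ?I"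
    by (simp_all only: has_bochner_integral_iff)
  have "AE q in step_measure. \<bar>(increment c u q)\<^sup>2 - ?P q\<bar> \<le> 100000 * (c * K)^3"
    using AE_increment by eventually_elim (simp only:)
  from step.abs_integral_diff_le[OF integrable_increment(2) P(1) this]
  show ?thesis unfolding P(2) by (simp add: mult.assoc)
qed

end
end

section \<open>Drift, contraction and characteristic function of one increment\<close>

lemma exp_le_quadratic:
  fixes x :: real
  assumes "\<bar>x\<bar> \<le> 1"
  shows "exp x \<le> 1 + x + x\<^sup>2"
proof (cases "0 \<le> x")
  case True
  then show ?thesis using exp_bound[of x] assms by simp
next
  case False
  have pos: "0 \<le> 1 + x + x\<^sup>2" using assms by (smt (verit) zero_le_power2)
  have "0 \<le> (- x) ^ 3" using False by (intro zero_le_power) auto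
  then have "0 \<le> x\<^sup>2 / 2 + (- x) ^ 3 / 2 + x ^ 4 / 2" by (intro add_nonneg_nonneg) auto
  then have "1 \<le> (1 + x + x\<^sup>2) * (1 + (- x) + (- x)\<^sup>2 / 2)"
    by (simp add: field_simps eval_nat_numeral)
  also have "\<dots> \<le> (1 + x + x\<^sup>2) * exp (- x)"
    using exp_lower_Taylor_quadratic[of "- x"] False pos by (intro mult_left_mono) auto
  finally have "1 * exp x \<le> (1 + x + x\<^sup>2) * exp (- x) * exp x" by (intro mult_right_mono) auto
  then show ?thesis by (simp add: mult.assoc flip: exp_add)
qed

context jacobi_step
begin

lemma one_minus_mean_z2_pos: "0 < 1 - mean_z2"
  unfolding mean_z2_def using ab by (simp add: field_simps)

text \<open>The values at \<open>u = 1\<close> of the approximate mean and second moment of an increment.  The square of the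
mean is \<open>O(c\<^sup>4)\<close>, so at the order \<open>c\<^sup>2\<close> the second moment is also the variance.\<close>
definition "mean_increment c = c^2 * m2 * (1 - mean_z2) / 2 - c^4 * m4 * (1 - 4 * mean_z2 + 3 * mean_z4) / 12"
definition "var_increment c = c^2 * m2 / (2 * (\<alpha> + 1))"

text \<open>The leading coefficient \<open>(1 - u\<^sup>2 mean_z2) m\<^sub>2 / 2\<close> of the mean is a convex combination of its values
at \<open>u = 0\<close> and \<open>u = 1\<close>; both are positive, the second one because
\<open>1 - mean_z2 = (\<alpha> + \<beta> + 1) / (\<alpha> + 1)\<close>.  So it stays bounded away from \<open>0\<close>, also near the origin
where the walk does not yet have its asymptotic drift, and dominates the terms of order \<open>c\<^sup>3\<close>.\<close>
lemma drift_lower_bound: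
  obtains \<delta> c0 where "0 < \<delta>" "0 < c0" "c0 * K \<le> 1"
    "\<And>c u. 0 < c \<Longrightarrow> c \<le> c0 \<Longrightarrow> 0 \<le> u \<Longrightarrow> u \<le> 1 \<Longrightarrow> \<delta> * c\<^sup>2 \<le> (\<integral>q. increment c u q \<partial>step_measure)"
proof -
  define \<kappa> where "\<kappa> = min 1 (1 - mean_z2)"
  define C where "C = \<bar>m4\<bar> * (1 + 4 * \<bar>mean_z2\<bar> + 3 * \<bar>mean_z4\<bar>) / 12 + 20000 * K^5"
  have \<kappa>: "0 < \<kappa>" using one_minus_mean_z2_pos by (simp add: \<kappa>_def)
  have C: "0 < C" unfolding C_def using K_ge_1 by (intro add_nonneg_pos) auto
  define \<delta> where "\<delta> = m2 * \<kappa> / 4"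
  have \<delta>: "0 < \<delta>" using \<kappa> second_moment_pos by (simp add: \<delta>_def)
  \<comment> \<open>Below \<open>c0\<close> the error \<open>C c\<^sup>3\<close> is at most half of the leading term \<open>2 \<delta> c\<^sup>2\<close>.\<close>
  define c0 where "c0 = min (1 / K) (\<delta> / C)"
  have c0: "0 < c0" "c0 * K \<le> 1" using K_ge_1 \<delta> C by (auto simp: c0_def min_def field_simps)
  show ?thesis
  proof (rule that[OF \<delta> c0])
    fix c u :: real assume c: "0 < c" "c \<le> c0" and u: "0 \<le> u" "u \<le> 1"
    have "c * K \<le> c0 * K" using c K_ge_1 by (intro mult_right_mono) auto
    then have cK: "c * K \<le> 1" using c0 by simp
    have c1: "c \<le> 1" using cK c mult_left_mono[OF K_ge_1, of c] by linarith
    have u2: "u\<^sup>2 \<le> 1" "0 \<le> u\<^sup>2" "u^4 \<le> 1" "0 \<le> u^4" using u by (auto intro: power_le_one)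
    have "\<kappa> \<le> 1 - u\<^sup>2 * mean_z2"
    proof (cases "mean_z2 \<le> 0")
      case True
      then show ?thesis using mult_nonneg_nonpos[OF u2(2) True] by (simp add: \<kappa>_def)
    next
      case False
      then show ?thesis using mult_right_mono[OF u2(1), of mean_z2] by (simp add: \<kappa>_def)
    qed
    then have main: "c^2 * m2 * \<kappa> / 2 \<le> c^2 * m2 * (1 - u^2 * mean_z2) / 2"
      using second_moment_pos by (intro divide_right_mono mult_left_mono) auto
    have "\<bar>1 - 4 * u^2 * mean_z2 + 3 * u^4 * mean_z4\<bar> \<le> 1 + 4 * \<bar>mean_z2\<bar> + 3 * \<bar>mean_z4\<bar>"
    proof -
      have "\<bar>u^2 * mean_z2\<bar> \<le> \<bar>mean_z2\<bar>" "\<bar>u^4 * mean_z4\<bar> \<le> \<bar>mean_z4\<bar>"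
        using u2 by (auto simp: abs_mult intro!: mult_left_le_one_le)
      then show ?thesis by linarith
    qed
    then have "\<bar>m4 * (1 - 4 * u^2 * mean_z2 + 3 * u^4 * mean_z4)\<bar> \<le> \<bar>m4\<bar> * (1 + 4 * \<bar>mean_z2\<bar> + 3 * \<bar>mean_z4\<bar>)"
      unfolding abs_mult by (intro mult_left_mono) auto
    then have "c^4 * \<bar>m4 * (1 - 4 * u^2 * mean_z2 + 3 * u^4 * mean_z4)\<bar> \<le> c^3 * (\<bar>m4\<bar> * (1 + 4 * \<bar>mean_z2\<bar> + 3 * \<bar>mean_z4\<bar>))"
      using c c1 by (intro mult_mono power_decreasing) auto
    then have q: "c^4 * m4 * (1 - 4 * u^2 * mean_z2 + 3 * u^4 * mean_z4) \<le> c^3 * (\<bar>m4\<bar> * (1 + 4 * \<bar>mean_z2\<bar> + 3 * \<bar>mean_z4\<bar>))"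
      using c by (smt (verit) abs_ge_self mult_left_mono zero_le_power mult.assoc)
    have "20000 * (c * K)^5 \<le> c^3 * (20000 * K^5)"
      using c c1 K_ge_1 power_decreasing[of 3 5 c] by (simp add: power_mult_distrib mult_right_mono)
    then have "c^2 * m2 * \<kappa> / 2 - c^3 * C \<le> (\<integral>q. increment c u q \<partial>step_measure)"
    proof -
      have "c^3 * C = c^3 * (\<bar>m4\<bar> * (1 + 4 * \<bar>mean_z2\<bar> + 3 * \<bar>mean_z4\<bar>)) / 12 + c^3 * (20000 * K^5)"
        by (simp add: C_def distrib_left)
      then show ?thesis
        using step_mean[OF c(1) cK u] main q \<open>20000 * (c * K)^5 \<le> c^3 * (20000 * K^5)\<close> by linarith
    qed
    moreover have "c^3 * C \<le> c^2 * \<delta>"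
    proof -
      have "c * C \<le> \<delta>" using c C by (simp add: c0_def field_simps)
      then have "c^2 * (c * C) \<le> c^2 * \<delta>" by (intro mult_left_mono) auto
      then show ?thesis by (simp add: eval_nat_numeral mult.assoc)
    qed
    ultimately show "\<delta> * c\<^sup>2 \<le> (\<integral>q. increment c u q \<partial>step_measure)"
      by (simp add: \<delta>_def algebra_simps)
  qed
qed

text \<open>To second order, \<open>E exp (- \<epsilon> D) \<le> 1 - \<epsilon> E D + \<epsilon>\<^sup>2 (c K)\<^sup>2\<close>; the drift wins over the quadratic term as
soon as \<open>\<epsilon> K\<^sup>2 \<le> \<delta> / 2\<close>.\<close>
lemma exp_increment_contraction:
  obtains \<epsilon> \<gamma> c0 where "0 < \<epsilon>" "\<epsilon> \<le> 2" "0 < \<gamma>" "0 < c0" "c0 * K \<le> 1"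
    "\<And>c u. 0 < c \<Longrightarrow> c \<le> c0 \<Longrightarrow> 0 \<le> u \<Longrightarrow> u \<le> 1 \<Longrightarrow>
        (\<integral>q. exp (- \<epsilon> * increment c u q) \<partial>step_measure) \<le> 1 - \<gamma> * c\<^sup>2"
proof -
  obtain \<delta> c0 where \<delta>: "0 < \<delta>" and c0: "0 < c0" "c0 * K \<le> 1"
    and drift: "\<And>c u. 0 < c \<Longrightarrow> c \<le> c0 \<Longrightarrow> 0 \<le> u \<Longrightarrow> u \<le> 1 \<Longrightarrow> \<delta> * c\<^sup>2 \<le> (\<integral>q. increment c u q \<partial>step_measure)"
    by (rule drift_lower_bound) blast
  define \<epsilon> where "\<epsilon> = min 1 (\<delta> / (2 * K\<^sup>2))"
  have K2: "0 < K\<^sup>2" using K_ge_1 by simp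
  have \<epsilon>: "0 < \<epsilon>" "\<epsilon> \<le> 1" using \<delta> K2 by (auto simp: \<epsilon>_def)
  have \<epsilon>K: "\<epsilon> * K\<^sup>2 \<le> \<delta> / 2"
  proof -
    have "\<epsilon> \<le> \<delta> / (2 * K\<^sup>2)" by (simp add: \<epsilon>_def)
    then have "\<epsilon> * K\<^sup>2 \<le> \<delta> / (2 * K\<^sup>2) * K\<^sup>2" using K2 by (intro mult_right_mono) auto
    then show ?thesis using K2 by simp
  qed
  show ?thesis
  proof (rule that[of \<epsilon> "\<epsilon> * \<delta> / 2" c0])
    fix c u :: real assume c: "0 < c" "c \<le> c0" and u: "0 \<le> u" "u \<le> 1"
    have "c * K \<le> c0 * K" using c K_ge_1 by (intro mult_right_mono) auto
    then have cK: "c * K \<le> 1" using c0 by simp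
    note int = integrable_increment[OF c(1) cK u]
    have "(\<integral>q. exp (- \<epsilon> * increment c u q) \<partial>step_measure)
        \<le> (\<integral>q. 1 - \<epsilon> * increment c u q + (\<epsilon> * c * K)\<^sup>2 \<partial>step_measure)"
    proof (rule integral_mono_AE)
      have *: "AE q in step_measure. exp (- \<epsilon> * increment c u q) \<le> exp 1 \<and>
         exp (- \<epsilon> * increment c u q) \<le> 1 - \<epsilon> * increment c u q + (\<epsilon> * c * K)\<^sup>2"
        using AE_increment[OF c(1) cK u]
      proof eventually_elim
        case (elim q)
        then have "\<epsilon> * \<bar>increment c u q\<bar> \<le> \<epsilon> * (c * K)" using \<epsilon> by (intro mult_left_mono) auto
        then have *: "\<bar>- \<epsilon> * increment c u q\<bar> \<le> \<epsilon> * c * K" using \<epsilon> by (simp add: abs_mult)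
        moreover have "\<epsilon> * c * K \<le> 1" using mult_mono[of \<epsilon> 1 "c * K" 1] \<epsilon> cK c K_ge_1 by (simp add: mult.assoc)
        ultimately have 1: "\<bar>- \<epsilon> * increment c u q\<bar> \<le> 1" by linarith
        have "(- \<epsilon> * increment c u q)\<^sup>2 \<le> (\<epsilon> * c * K)\<^sup>2"
          using power_mono[OF *, of 2] by (simp only: power2_abs abs_ge_zero)
        with exp_le_quadratic[OF 1] 1 show ?case by simp
      qed
      show "AE q in step_measure. exp (- \<epsilon> * increment c u q) \<le> 1 - \<epsilon> * increment c u q + (\<epsilon> * c * K)\<^sup>2"
        using * by eventually_elim simp
      show "integrable step_measure (\<lambda>q. exp (- \<epsilon> * increment c u q))"
      proof (rule step.integrable_const_bound)
        show "AE q in step_measure. norm (exp (- \<epsilon> * increment c u q)) \<le> exp 1"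
          using * by eventually_elim simp
      qed measurable
      show "integrable step_measure (\<lambda>q. 1 - \<epsilon> * increment c u q + (\<epsilon> * c * K)\<^sup>2)" using int by simp
    qed
    also have "\<dots> = 1 - \<epsilon> * (\<integral>q. increment c u q \<partial>step_measure) + (\<epsilon> * c * K)\<^sup>2"
      using int by (simp add: step.prob_space)
    also have "\<dots> \<le> 1 - \<epsilon> * (\<delta> * c\<^sup>2) + \<epsilon> * c\<^sup>2 * (\<epsilon> * K\<^sup>2)"
      using mult_left_mono[OF drift[OF c u], of \<epsilon>] \<epsilon> by (simp add: power_mult_distrib power2_eq_square mult_ac)
    also have "\<dots> \<le> 1 - \<epsilon> * (\<delta> * c\<^sup>2) + \<epsilon> * c\<^sup>2 * (\<delta> / 2)"
      using \<epsilon>K \<epsilon> by (intro add_left_mono mult_left_mono) auto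
    also have "\<dots> = 1 - \<epsilon> * \<delta> / 2 * c\<^sup>2" by (simp add: field_simps)
    finally show "(\<integral>q. exp (- \<epsilon> * increment c u q) \<partial>step_measure) \<le> 1 - \<epsilon> * \<delta> / 2 * c\<^sup>2" .
  qed (use \<epsilon> \<delta> c0 in auto)
qed

lemma char_increment_second_order:
  assumes c: "0 < c" "c * K \<le> 1" and u: "0 \<le> u" "u \<le> 1"
  shows "cmod ((\<integral>q. iexp (\<theta> * increment c u q) \<partial>step_measure) -
     (1 + \<i> * \<theta> * (\<integral>q. increment c u q \<partial>step_measure) - \<theta>\<^sup>2 / 2 * (\<integral>q. (increment c u q)\<^sup>2 \<partial>step_measure)))
     \<le> \<bar>\<theta>\<bar>^3 * (c * K)^3 / 6"
proof -
  note int = integrable_increment[OF c u]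
  let ?T = "\<lambda>q. 1 + \<i> * of_real (\<theta> * increment c u q) - of_real (\<theta>\<^sup>2 / 2 * (increment c u q)\<^sup>2)"
  have i1: "integrable step_measure (\<lambda>q. iexp (\<theta> * increment c u q))"
    by (rule step.integrable_const_bound[where B = 1]) auto
  have i2: "integrable step_measure ?T" using int
    by (intro Bochner_Integration.integrable_diff Bochner_Integration.integrable_add integrable_mult_right
        integrable_of_real step.integrable_const)
  have d: "integrable step_measure (\<lambda>q. \<i> * complex_of_real (\<theta> * increment c u q))"
    "integrable step_measure (\<lambda>q. complex_of_real (\<theta>\<^sup>2 / 2 * (increment c u q)\<^sup>2))"
    by (rule integrable_mult_right, rule integrable_of_real, rule integrable_mult_right, rule int)
      (rule integrable_of_real, rule integrable_mult_right, rule int)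
  have "(\<integral>q. ?T q \<partial>step_measure) = 1 + \<i> * of_real (\<integral>q. \<theta> * increment c u q \<partial>step_measure)
     - of_real (\<integral>q. \<theta>\<^sup>2 / 2 * (increment c u q)\<^sup>2 \<partial>step_measure)"
  proof -
    have "(\<integral>q. ?T q \<partial>step_measure) = (\<integral>q. 1 + \<i> * complex_of_real (\<theta> * increment c u q) \<partial>step_measure)
       - (\<integral>q. complex_of_real (\<theta>\<^sup>2 / 2 * (increment c u q)\<^sup>2) \<partial>step_measure)"
      using d by (intro Bochner_Integration.integral_diff Bochner_Integration.integrable_add step.integrable_const)
    also have "(\<integral>q. 1 + \<i> * complex_of_real (\<theta> * increment c u q) \<partial>step_measure)
       = (\<integral>q. 1 \<partial>step_measure) + (\<integral>q. \<i> * complex_of_real (\<theta> * increment c u q) \<partial>step_measure)"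
      using d by (intro Bochner_Integration.integral_add step.integrable_const)
    also have "(\<integral>q. (1::complex) \<partial>step_measure) = 1" by (simp add: step.prob_space)
    also have "(\<integral>q. \<i> * complex_of_real (\<theta> * increment c u q) \<partial>step_measure)
       = \<i> * of_real (\<integral>q. \<theta> * increment c u q \<partial>step_measure)"
      by (simp only: integral_mult_right_zero integral_complex_of_real)
    also have "(\<integral>q. complex_of_real (\<theta>\<^sup>2 / 2 * (increment c u q)\<^sup>2) \<partial>step_measure)
       = of_real (\<integral>q. \<theta>\<^sup>2 / 2 * (increment c u q)\<^sup>2 \<partial>step_measure)"
      by (simp only: integral_complex_of_real)
    finally show ?thesis .
  qed
  then have "(\<integral>q. ?T q \<partial>step_measure) = 1 + \<i> * \<theta> * (\<integral>q. increment c u q \<partial>step_measure) - \<theta>\<^sup>2 / 2 * (\<integral>q. (increment c u q)\<^sup>2 \<partial>step_measure)"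
    by simp
  moreover have "cmod ((\<integral>q. iexp (\<theta> * increment c u q) \<partial>step_measure) - (\<integral>q. ?T q \<partial>step_measure)) \<le> \<bar>\<theta>\<bar>^3 * (c * K)^3 / 6"
  proof -
    have "cmod (\<integral>q. iexp (\<theta> * increment c u q) - ?T q \<partial>step_measure)
       \<le> (\<integral>q. cmod (iexp (\<theta> * increment c u q) - ?T q) \<partial>step_measure)" by (rule integral_norm_bound)
    also have "\<dots> \<le> (\<integral>q. \<bar>\<theta>\<bar>^3 * (c * K)^3 / 6 \<partial>step_measure)"
    proof (rule integral_mono_AE)
      show "integrable step_measure (\<lambda>q. cmod (iexp (\<theta> * increment c u q) - ?T q))" using i1 i2 by auto
      show "AE q in step_measure. cmod (iexp (\<theta> * increment c u q) - ?T q) \<le> \<bar>\<theta>\<bar>^3 * (c * K)^3 / 6"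
        using AE_increment[OF c u]
      proof eventually_elim
        case (elim q)
        let ?x = "\<theta> * increment c u q"
        have "(\<Sum>k\<le>2. (\<i> * of_real ?x) ^ k / fact k) = ?T q"
          by (simp add: numeral_2_eq_2) (simp add: power2_eq_square field_simps)
        then have "cmod (iexp ?x - ?T q) \<le> \<bar>?x\<bar> ^ Suc 2 / fact (Suc 2)"
          using iexp_approx1[of ?x 2] by simp
        also have "\<dots> = \<bar>\<theta>\<bar>^3 * \<bar>increment c u q\<bar>^3 / 6" 
        proof -
          have "Suc 2 = 3" "fact 3 = (6::real)" by (simp_all add: fact_numeral)
          then show ?thesis by (simp only: abs_mult power_mult_distrib)
        qed
        also have "\<dots> \<le> \<bar>\<theta>\<bar>^3 * (c * K)^3 / 6"
          using elim by (intro divide_right_mono mult_left_mono power_mono) auto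
        finally show ?case .
      qed
    qed simp
    also have "\<dots> = \<bar>\<theta>\<bar>^3 * (c * K)^3 / 6" by (simp add: step.prob_space)
    finally show ?thesis using i1 i2 by (simp only: Bochner_Integration.integral_diff)
  qed
  ultimately show ?thesis by simp
qed

text \<open>The characteristic function of an increment and the exponential on the right are both expanded to
second order in \<open>\<theta>\<close>.  Their coefficients differ by \<open>O(c\<^sup>5 + c\<^sup>2 (1 - u\<^sup>2))\<close> for the mean and by
\<open>O(c\<^sup>3 + c\<^sup>2 (1 - u\<^sup>2))\<close> for the second moment, and the remainders are \<open>O(\<bar>\<theta>\<bar>\<^sup>3 c\<^sup>3)\<close> and
\<open>O(\<theta>\<^sup>2 c\<^sup>4)\<close>.  The comparison is with an exponential, rather than with its expansion, because its
absolute value is at most one: this keeps errors from growing when steps are chained.\<close>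
lemma char_increment_bound:
  obtains C where "0 \<le> C"
    "\<And>c u \<theta>. 0 < c \<Longrightarrow> c * K \<le> 1 \<Longrightarrow> 0 \<le> u \<Longrightarrow> u \<le> 1 \<Longrightarrow> \<bar>\<theta>\<bar> \<le> 1 \<Longrightarrow>
      cmod ((\<integral>q. iexp (\<theta> * increment c u q) \<partial>step_measure) - exp (\<i> * \<theta> * mean_increment c - \<theta>\<^sup>2 * var_increment c / 2))
      \<le> C * (\<bar>\<theta>\<bar> * c^5 + \<theta>\<^sup>2 * c^3 + \<bar>\<theta>\<bar>^3 * c^3 + \<bar>\<theta>\<bar> * c\<^sup>2 * (1 - u\<^sup>2))"
proof -
  define A where "A = m2 * \<bar>mean_z2\<bar> / 2 + \<bar>m4\<bar> * (4 * \<bar>mean_z2\<bar> + 6 * \<bar>mean_z4\<bar>) / 12"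
  define C1 where "C1 = 20000 * K^5 + A"
  define V where "V = m2 / (2 * (\<alpha> + 1))"
  define C2 where "C2 = 100000 * K^3 + V"
  define M where "M = m2 * (1 + \<bar>mean_z2\<bar>) / 2 + \<bar>m4\<bar> * (1 + 4 * \<bar>mean_z2\<bar> + 3 * \<bar>mean_z4\<bar>) / 12 + V"
  define C where "C = C1 + C2 + K^3 + exp V * M\<^sup>2"
  have pos: "0 \<le> A" "0 \<le> C1" "0 \<le> V" "0 \<le> C2" "0 \<le> M" "0 \<le> K^3" "0 \<le> exp V * M\<^sup>2"
    using ab K_ge_1 second_moment_pos by (auto simp: A_def C1_def V_def C2_def M_def)
  then have C: "0 \<le> C" by (simp add: C_def)
  show ?thesis
  proof (rule that[OF C])
    fix c u \<theta> :: real
    assume c: "0 < c" and cK: "c * K \<le> 1" and u: "0 \<le> u" "u \<le> 1" and \<theta>: "\<bar>\<theta>\<bar> \<le> 1"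
    have c1: "c \<le> 1" using cK c mult_left_mono[OF K_ge_1, of c] by linarith
    define W where "W = 1 - u\<^sup>2"
    have W: "0 \<le> W" using u by (simp add: W_def power_le_one)
    define E1 where "E1 = (\<integral>q. increment c u q \<partial>step_measure)"
    define E2 where "E2 = (\<integral>q. (increment c u q)\<^sup>2 \<partial>step_measure)"
    define \<mu> where "\<mu> = mean_increment c"
    define \<sigma>2 where "\<sigma>2 = var_increment c"
    define \<zeta> where "\<zeta> = \<i> * \<theta> * \<mu> - \<theta>\<^sup>2 * \<sigma>2 / 2"
    have \<theta>2: "\<theta>\<^sup>2 \<le> \<bar>\<theta>\<bar>" "0 \<le> \<theta>\<^sup>2"
      using mult_left_mono[OF \<theta>, of "\<bar>\<theta>\<bar>"] by (simp_all add: power2_eq_square)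
    have c42: "c^4 \<le> c^2" "c^4 \<le> c^3" "c^5 \<le> c^3" using c c1 by (auto intro!: power_decreasing)
    have E1: "\<bar>E1 - \<mu>\<bar> \<le> C1 * (c^5 + c^2 * W)"
    proof -
      have u4: "0 \<le> 1 - u^4" "1 - u^4 \<le> 2 * W"
      proof -
        have "1 - u^4 = (1 + u\<^sup>2) * W" by (simp add: W_def algebra_simps eval_nat_numeral)
        moreover have "(1 + u\<^sup>2) * W \<le> 2 * W" using u W by (intro mult_right_mono) (auto simp: power_le_one)
        ultimately show "0 \<le> 1 - u^4" "1 - u^4 \<le> 2 * W" using W by simp_all
      qed
      let ?m = "c^2 * m2 * (1 - u^2 * mean_z2) / 2 - c^4 * m4 * (1 - 4 * u^2 * mean_z2 + 3 * u^4 * mean_z4) / 12"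
      have e: "\<bar>E1 - ?m\<bar> \<le> 20000 * (c * K)^5" unfolding E1_def by (rule step_mean[OF c cK u])
      have d: "?m - \<mu> = c^2 * (m2 * mean_z2 * W / 2) - c^4 * (m4 * (4 * (mean_z2 * W) - 3 * (mean_z4 * (1 - u^4))) / 12)"
        by (simp add: \<mu>_def mean_increment_def W_def field_simps)
      have "\<bar>c^2 * (m2 * mean_z2 * W / 2)\<bar> = c^2 * (m2 * \<bar>mean_z2\<bar> * W / 2)"
        using W second_moment_pos by (simp add: abs_mult)
      moreover have "\<bar>c^4 * (m4 * (4 * (mean_z2 * W) - 3 * (mean_z4 * (1 - u^4))) / 12)\<bar> \<le> c^2 * (\<bar>m4\<bar> * ((4 * \<bar>mean_z2\<bar> + 6 * \<bar>mean_z4\<bar>) * W) / 12)"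
      proof -
        have "\<bar>mean_z4 * (1 - u^4)\<bar> \<le> \<bar>mean_z4\<bar> * (2 * W)"
          unfolding abs_mult using u4 by (intro mult_left_mono) auto
        moreover have "\<bar>mean_z2 * W\<bar> = \<bar>mean_z2\<bar> * W" using W by (simp add: abs_mult)
        ultimately have "\<bar>4 * (mean_z2 * W) - 3 * (mean_z4 * (1 - u^4))\<bar> \<le> (4 * \<bar>mean_z2\<bar> + 6 * \<bar>mean_z4\<bar>) * W"
          by (simp add: distrib_right)
        then have "\<bar>m4 * (4 * (mean_z2 * W) - 3 * (mean_z4 * (1 - u^4))) / 12\<bar> \<le> \<bar>m4\<bar> * ((4 * \<bar>mean_z2\<bar> + 6 * \<bar>mean_z4\<bar>) * W) / 12"
          by (auto simp: abs_mult intro!: divide_right_mono mult_left_mono)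
        then show ?thesis unfolding abs_mult[of "c^4"]
          using c42 by (intro mult_mono) auto
      qed
      ultimately have "\<bar>?m - \<mu>\<bar> \<le> c^2 * (m2 * \<bar>mean_z2\<bar> * W / 2) + c^2 * (\<bar>m4\<bar> * ((4 * \<bar>mean_z2\<bar> + 6 * \<bar>mean_z4\<bar>) * W) / 12)"
        unfolding d by linarith
      also have "\<dots> = A * (c^2 * W)" by (simp add: A_def field_simps)
      finally have m: "\<bar>?m - \<mu>\<bar> \<le> A * (c^2 * W)" .
      have "0 \<le> A * c^5" "0 \<le> (20000 * K^5) * (c^2 * W)" using pos c W K_ge_1 by auto
      moreover have "C1 * (c^5 + c^2 * W) = 20000 * (c * K)^5 + A * (c^2 * W) + A * c^5 + (20000 * K^5) * (c^2 * W)"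
        by (simp add: C1_def algebra_simps power_mult_distrib)
      ultimately show ?thesis using e m by linarith
    qed
    have E2: "\<bar>E2 - \<sigma>2\<bar> \<le> C2 * (c^3 + c^2 * W)"
    proof -
      have "\<bar>E2 - u^2 * c^2 * m2 / (2 * (\<alpha> + 1))\<bar> \<le> 100000 * (c * K)^3"
        unfolding E2_def by (rule step_second_moment[OF c cK u])
      moreover have "u^2 * c^2 * m2 / (2 * (\<alpha> + 1)) - \<sigma>2 = - (V * (c^2 * W))"
        by (simp add: \<sigma>2_def var_increment_def V_def W_def algebra_simps diff_divide_distrib)
      moreover have "0 \<le> V * (c^2 * W)" "0 \<le> V * c^3" "0 \<le> 100000 * K^3 * (c^2 * W)" using pos W c by auto
      moreover have "C2 * (c^3 + c^2 * W) = 100000 * (c * K)^3 + V * (c^2 * W) + V * c^3 + 100000 * K^3 * (c^2 * W)"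
        by (simp add: C2_def algebra_simps power_mult_distrib)
      ultimately show ?thesis by linarith
    qed
    have \<sigma>: "0 \<le> \<sigma>2" "\<sigma>2 = V * c^2" "\<sigma>2 \<le> V"
    proof -
      show eq: "\<sigma>2 = V * c^2" by (simp add: \<sigma>2_def var_increment_def V_def)
      have "c^2 \<le> 1" using c c1 by (simp add: power_le_one)
      then show "0 \<le> \<sigma>2" "\<sigma>2 \<le> V"
        unfolding eq using pos mult_left_mono[of "c^2" 1 V] by simp_all
    qed
    \<comment> \<open>The quadratic remainder of \<open>exp \<zeta>\<close>, where \<open>\<bar>\<zeta>\<bar> \<le> \<bar>\<theta>\<bar> M c\<^sup>2\<close> and \<open>\<bar>Re \<zeta>\<bar> \<le> V\<close>.\<close>
    have Z: "cmod (exp \<zeta> - (1 + \<zeta>)) \<le> exp V * M\<^sup>2 * (\<theta>\<^sup>2 * c^3)"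
    proof -
      have "cmod (exp \<zeta> - (1 + \<zeta>)) \<le> exp \<bar>Re \<zeta>\<bar> * (cmod \<zeta>)\<^sup>2"
        using Taylor_exp[of \<zeta> 1] by (simp add: numeral_2_eq_2)
      also have "\<dots> \<le> exp V * (\<theta>\<^sup>2 * (M\<^sup>2 * c^4))"
      proof (rule mult_mono)
        have "\<theta>\<^sup>2 * \<sigma>2 / 2 \<le> 1 * V / 2" using \<theta>2 \<theta> \<sigma> by (intro divide_right_mono mult_mono) auto
        then have "\<bar>Re \<zeta>\<bar> \<le> V" using pos \<sigma> by (simp add: \<zeta>_def)
        then show "exp \<bar>Re \<zeta>\<bar> \<le> exp V" by simp
        have "\<bar>\<mu>\<bar> \<le> c^2 * (M - V)"
        proof -
          have "\<bar>c^2 * m2 * (1 - mean_z2) / 2\<bar> \<le> c^2 * (m2 * (1 + \<bar>mean_z2\<bar>) / 2)"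
            using second_moment_pos by (auto simp: abs_mult mult.assoc intro!: mult_left_mono divide_right_mono)
          moreover have "\<bar>c^4 * m4 * (1 - 4 * mean_z2 + 3 * mean_z4) / 12\<bar> \<le> c^2 * (\<bar>m4\<bar> * (1 + 4 * \<bar>mean_z2\<bar> + 3 * \<bar>mean_z4\<bar>) / 12)"
          proof -
            have "\<bar>m4 * (1 - 4 * mean_z2 + 3 * mean_z4) / 12\<bar> \<le> \<bar>m4\<bar> * (1 + 4 * \<bar>mean_z2\<bar> + 3 * \<bar>mean_z4\<bar>) / 12"
              by (auto simp: abs_mult intro!: mult_left_mono divide_right_mono)
            then have "c^4 * \<bar>m4 * (1 - 4 * mean_z2 + 3 * mean_z4) / 12\<bar> \<le> c^2 * (\<bar>m4\<bar> * (1 + 4 * \<bar>mean_z2\<bar> + 3 * \<bar>mean_z4\<bar>) / 12)"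
              using c42 by (intro mult_mono) auto
            then show ?thesis by (simp add: abs_mult mult.assoc)
          qed
          ultimately have "\<bar>\<mu>\<bar> \<le> c^2 * (m2 * (1 + \<bar>mean_z2\<bar>) / 2) + c^2 * (\<bar>m4\<bar> * (1 + 4 * \<bar>mean_z2\<bar> + 3 * \<bar>mean_z4\<bar>) / 12)"
            unfolding \<mu>_def mean_increment_def by linarith
          then show ?thesis by (simp add: M_def distrib_left)
        qed
        then have m: "\<bar>\<theta>\<bar> * \<bar>\<mu>\<bar> \<le> \<bar>\<theta>\<bar> * (c^2 * (M - V))" by (intro mult_left_mono) auto
        have "\<theta>\<^sup>2 * \<sigma>2 / 2 \<le> \<bar>\<theta>\<bar> * (c^2 * V)"
        proof -
          have "\<theta>\<^sup>2 * \<sigma>2 \<le> \<bar>\<theta>\<bar> * (c^2 * V)" unfolding \<sigma>(2) using \<theta>2 pos by (auto simp: mult.commute intro!: mult_mono)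
          moreover have "0 \<le> \<theta>\<^sup>2 * \<sigma>2" using \<sigma> by simp
          ultimately show ?thesis by linarith
        qed
        moreover have "cmod \<zeta> \<le> \<bar>\<theta>\<bar> * \<bar>\<mu>\<bar> + \<theta>\<^sup>2 * \<sigma>2 / 2"
        proof -
          have "cmod \<zeta> \<le> cmod (\<i> * \<theta> * \<mu>) + cmod (of_real (\<theta>\<^sup>2 * \<sigma>2 / 2))"
            unfolding \<zeta>_def by (rule norm_triangle_ineq4)
          also have "cmod (\<i> * \<theta> * \<mu>) = \<bar>\<theta>\<bar> * \<bar>\<mu>\<bar>" by (simp add: norm_mult)
          also have "cmod (of_real (\<theta>\<^sup>2 * \<sigma>2 / 2)) = \<theta>\<^sup>2 * \<sigma>2 / 2"
            unfolding norm_of_real using \<sigma>(1) by simp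
          finally show ?thesis .
        qed
        ultimately have "cmod \<zeta> \<le> \<bar>\<theta>\<bar> * (c^2 * (M - V)) + \<bar>\<theta>\<bar> * (c^2 * V)" using m by linarith
        also have "\<dots> = \<bar>\<theta>\<bar> * (M * c^2)" by (simp add: algebra_simps)
        finally have "(cmod \<zeta>)\<^sup>2 \<le> (\<bar>\<theta>\<bar> * (M * c^2))\<^sup>2" by (intro power_mono) auto
        then show "(cmod \<zeta>)\<^sup>2 \<le> \<theta>\<^sup>2 * (M\<^sup>2 * c^4)"
          by (simp add: power_mult_distrib flip: power_mult)
      qed auto
      also have "\<dots> = (exp V * M\<^sup>2 * \<theta>\<^sup>2) * c^4" by simp
      also have "\<dots> \<le> (exp V * M\<^sup>2 * \<theta>\<^sup>2) * c^3" using c42 by (intro mult_left_mono) auto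
      finally show ?thesis by (simp only: mult.assoc)
    qed
    let ?\<Phi> = "\<integral>q. iexp (\<theta> * increment c u q) \<partial>step_measure"
    let ?T = "1 + \<i> * \<theta> * E1 - \<theta>\<^sup>2 / 2 * E2"
    have a: "cmod (?\<Phi> - ?T) \<le> K^3 * (\<bar>\<theta>\<bar>^3 * c^3)"
    proof -
      have "cmod (?\<Phi> - ?T) \<le> \<bar>\<theta>\<bar>^3 * (c * K)^3 / 6"
        using char_increment_second_order[OF c cK u, of \<theta>] by (simp only: E1_def E2_def)
      moreover have "\<bar>\<theta>\<bar>^3 * (c * K)^3 = K^3 * (\<bar>\<theta>\<bar>^3 * c^3)" by (simp add: power_mult_distrib)
      moreover have "0 \<le> K^3 * (\<bar>\<theta>\<bar>^3 * c^3)" using c pos by simp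
      ultimately show ?thesis by linarith
    qed
    have b: "cmod (?T - (1 + \<zeta>)) \<le> \<bar>\<theta>\<bar> * (C1 * (c^5 + c^2 * W)) + \<theta>\<^sup>2 * (C2 * (c^3 + c^2 * W))"
    proof -
      have "?T - (1 + \<zeta>) = \<i> * of_real (\<theta> * (E1 - \<mu>)) - of_real (\<theta>\<^sup>2 / 2 * (E2 - \<sigma>2))"
        by (simp add: \<zeta>_def algebra_simps diff_divide_distrib)
      then have "cmod (?T - (1 + \<zeta>)) \<le> \<bar>\<theta> * (E1 - \<mu>)\<bar> + \<bar>\<theta>\<^sup>2 / 2 * (E2 - \<sigma>2)\<bar>"
        using norm_triangle_ineq4[of "\<i> * of_real (\<theta> * (E1 - \<mu>))" "of_real (\<theta>\<^sup>2 / 2 * (E2 - \<sigma>2))"]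
        by (simp only: norm_mult norm_of_real norm_ii mult_1_left)
      also have "\<dots> \<le> \<bar>\<theta>\<bar> * (C1 * (c^5 + c^2 * W)) + \<theta>\<^sup>2 * (C2 * (c^3 + c^2 * W))"
      proof (rule add_mono)
        show "\<bar>\<theta> * (E1 - \<mu>)\<bar> \<le> \<bar>\<theta>\<bar> * (C1 * (c^5 + c^2 * W))" unfolding abs_mult using E1 by (intro mult_left_mono) auto
        have "\<bar>\<theta>\<^sup>2 / 2\<bar> \<le> \<theta>\<^sup>2" by simp
        then show "\<bar>\<theta>\<^sup>2 / 2 * (E2 - \<sigma>2)\<bar> \<le> \<theta>\<^sup>2 * (C2 * (c^3 + c^2 * W))"
          unfolding abs_mult using E2 by (intro mult_mono) auto
      qed
      finally show ?thesis .
    qed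
    have t: "\<theta>\<^sup>2 * (C2 * (c^3 + c^2 * W)) \<le> C2 * (\<theta>\<^sup>2 * c^3) + C2 * (\<bar>\<theta>\<bar> * c^2 * W)"
    proof -
      have "\<theta>\<^sup>2 * (C2 * c^2 * W) \<le> \<bar>\<theta>\<bar> * (C2 * c^2 * W)" using \<theta>2 pos W by (intro mult_right_mono) auto
      then show ?thesis by (simp add: algebra_simps)
    qed
    define x1 where "x1 = \<bar>\<theta>\<bar> * c^5"
    define x2 where "x2 = \<theta>\<^sup>2 * c^3"
    define x3 where "x3 = \<bar>\<theta>\<bar>^3 * c^3"
    define x4 where "x4 = \<bar>\<theta>\<bar> * c^2 * W"
    have x: "0 \<le> x1" "0 \<le> x2" "0 \<le> x3" "0 \<le> x4" using c W by (auto simp: x1_def x2_def x3_def x4_def)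
    have "cmod (?\<Phi> - exp \<zeta>) \<le> cmod (?\<Phi> - ?T) + cmod (?T - (1 + \<zeta>)) + cmod (exp \<zeta> - (1 + \<zeta>))"
    proof -
      have "?\<Phi> - exp \<zeta> = ((?\<Phi> - ?T) + (?T - (1 + \<zeta>))) - (exp \<zeta> - (1 + \<zeta>))"
        by (simp only: algebra_simps)
      then show ?thesis
        by (simp only:) (intro order_trans[OF norm_triangle_ineq4] add_mono norm_triangle_ineq order_refl)
    qed
    also have "\<dots> \<le> K^3 * x3 + (C1 * x1 + C1 * x4 + C2 * x2 + C2 * x4) + exp V * M\<^sup>2 * x2"
      using a b t Z by (simp add: x1_def x2_def x3_def x4_def algebra_simps)
    also have "\<dots> \<le> C * (x1 + x2 + x3 + x4)"
    proof -
      have "0 \<le> K^3 * (x1 + x2 + x4)" "0 \<le> C1 * (x2 + x3)" "0 \<le> C2 * (x1 + x3)" "0 \<le> exp V * M\<^sup>2 * (x1 + x3 + x4)"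
        using pos x by (auto intro!: mult_nonneg_nonneg add_nonneg_nonneg)
      then show ?thesis unfolding C_def by (simp add: distrib_left distrib_right)
    qed
    finally show "cmod (?\<Phi> - exp (\<i> * \<theta> * mean_increment c - \<theta>\<^sup>2 * var_increment c / 2))
      \<le> C * (\<bar>\<theta>\<bar> * c^5 + \<theta>\<^sup>2 * c^3 + \<bar>\<theta>\<bar>^3 * c^3 + \<bar>\<theta>\<bar> * c\<^sup>2 * (1 - u\<^sup>2))"
      by (simp only: x1_def x2_def x3_def x4_def \<zeta>_def \<mu>_def \<sigma>2_def W_def)
  qed
qed

end

section \<open>The law of the chain after one step\<close>

text \<open>The deficit \<open>1 - u\<^sup>2\<close> of \<open>u = tanh s\<close> is a power of \<open>exp (- ln (cosh s))\<close>, the quantity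
that \<open>exp_increment_contraction\<close> controls.\<close>
lemma one_minus_tanh_square: "1 - (tanh s)\<^sup>2 = exp (- 2 * ln (cosh (s::real)))"
proof -
  have c: "0 < cosh s" by simp
  have "1 - (tanh s)\<^sup>2 = 1 / (cosh s)\<^sup>2"
  proof -
    have "(sinh s)\<^sup>2 = (cosh s)\<^sup>2 - 1" using hyperbolic_pythagoras[of s] by linarith
    then show ?thesis using c by (simp add: tanh_def power_divide diff_divide_distrib)
  qed
  also have "\<dots> = exp (- 2 * ln (cosh s))"
  proof -
    have "exp (- 2 * ln (cosh s)) = inverse (exp (2 * ln (cosh s)))"
      by (simp add: exp_minus)
    also have "exp (2 * ln (cosh s)) = (exp (ln (cosh s)))\<^sup>2" by (rule exp_double)
    finally show ?thesis using c by (simp add: divide_inverse)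
  qed
  finally show ?thesis .
qed

lemma ln_cosh_nonneg: "0 \<le> ln (cosh (s::real))"
  by (simp add: cosh_real_ge_1)

lemma measurable_jacobi_arg_joint [measurable (raw)]:
  assumes f: "f \<in> borel_measurable M" and g: "g \<in> borel_measurable M" and h: "h \<in> borel_measurable M"
  shows "(\<lambda>x. jacobi_arg (f x) (g x) (h x)) \<in> borel_measurable M"
proof -
  have [measurable]: "(cosh :: real \<Rightarrow> real) \<in> borel_measurable borel" "(sinh :: real \<Rightarrow> real) \<in> borel_measurable borel"
    by (auto intro!: borel_measurable_continuous_onI continuous_intros)
  note [measurable] = f g measurable_compose[OF h measurable_disk_point]
  have "(\<lambda>x. jacobi_arg (f x) (g x) (h x)) = (\<lambda>x. arcosh (cmod (of_real (cosh (f x) * cosh (g x)) +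
        disk_point (h x) * of_real (sinh (f x) * sinh (g x)))))"
    by (simp add: jacobi_arg_def disk_point_def case_prod_unfold)
  then show ?thesis unfolding arcosh_def by simp
qed

lemma measurable_fst_borel [measurable]: "fst \<in> borel_measurable (borel :: ('a::second_countable_topology \<times> 'b::second_countable_topology) measure)"
  and measurable_snd_borel [measurable]: "snd \<in> borel_measurable (borel :: ('a::second_countable_topology \<times> 'b::second_countable_topology) measure)"
  by (auto intro!: borel_measurable_continuous_onI continuous_intros)

context jacobi_step
begin

lemma measurable_jacobi_kernel:
  "(\<lambda>p. jacobi_point_conv \<alpha> \<beta> (fst p) (snd p)) \<in> borel \<Otimes>\<^sub>M borel \<rightarrow>\<^sub>M subprob_algebra borel"
  unfolding jacobi_point_conv_def
proof (rule measurable_distr2)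
  show "(\<lambda>(p, x). jacobi_arg (fst p) (snd p) x) \<in> borel_measurable ((borel \<Otimes>\<^sub>M borel) \<Otimes>\<^sub>M borel)"
    by (simp add: case_prod_unfold)
  have "jacobi_m \<alpha> \<beta> \<in> space (subprob_algebra borel)"
    by (simp add: space_subprob_algebra sets_jacobi_m prob_space_imp_subprob_space prob_space_jacobi_m[OF ab])
  then show "(\<lambda>p. jacobi_m \<alpha> \<beta>) \<in> borel \<Otimes>\<^sub>M borel \<rightarrow>\<^sub>M subprob_algebra borel" by simp
qed

lemma measurable_step_map [measurable]:
  "(\<lambda>q. jacobi_arg x (c * fst q) (snd q)) \<in> borel_measurable borel"
  by measurable

text \<open>The transition kernel as the image of a single measure that does not depend on the current
position.  This turns a step of the chain into an integral over a product space.\<close>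
lemma jacobi_conv_return_eq:
  "jacobi_conv \<alpha> \<beta> (return borel x) (scaled_law \<nu> c) = distr step_measure borel (\<lambda>q. jacobi_arg x (c * fst q) (snd q))"
proof -
  interpret law: prob_space \<nu> by (rule prob_space_law)
  interpret m: prob_space "jacobi_m \<alpha> \<beta>" by (rule prob_space_jacobi_m[OF ab])
  have sc: "scaled_law \<nu> c \<in> space (subprob_algebra borel)"
    by (auto simp: space_subprob_algebra scaled_law_def intro!: prob_space_imp_subprob_space law.prob_space_distr)
  have k: "(\<lambda>t. jacobi_point_conv \<alpha> \<beta> s t) \<in> borel \<rightarrow>\<^sub>M subprob_algebra borel" for s
    using measurable_compose[OF _ measurable_jacobi_kernel, of "\<lambda>t. (s, t)" borel] by simp
  have "(\<lambda>s. scaled_law \<nu> c \<bind> (\<lambda>t. jacobi_point_conv \<alpha> \<beta> s t)) \<in> borel \<rightarrow>\<^sub>M subprob_algebra borel"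
    by (rule measurable_bind[where N = borel]) (use sc measurable_jacobi_kernel in \<open>simp_all add: case_prod_unfold\<close>)
  then have "jacobi_conv \<alpha> \<beta> (return borel x) (scaled_law \<nu> c) = scaled_law \<nu> c \<bind> (\<lambda>t. jacobi_point_conv \<alpha> \<beta> x t)"
    unfolding jacobi_conv_def by (rule bind_return) simp
  also have "\<dots> = distr step_measure borel (\<lambda>q. jacobi_arg x (c * fst q) (snd q))" (is "?L = ?R")
  proof (rule measure_eqI)
    have ne: "space (scaled_law \<nu> c) \<noteq> {}" by (simp add: scaled_law_def)
    have k': "(\<lambda>t. jacobi_point_conv \<alpha> \<beta> x t) \<in> scaled_law \<nu> c \<rightarrow>\<^sub>M subprob_algebra borel"
      using k by (simp add: scaled_law_def)
    show sets: "sets ?L = sets ?R" using sets_bind[OF sets_kernel[OF k'] ne] by simp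
    fix A assume "A \<in> sets ?L"
    then have A: "A \<in> sets borel" by (simp add: sets)
    have "emeasure ?L A = (\<integral>\<^sup>+t. emeasure (jacobi_point_conv \<alpha> \<beta> x t) A \<partial>scaled_law \<nu> c)"
      by (rule emeasure_bind[OF ne k' A])
    also have "\<dots> = (\<integral>\<^sup>+y. emeasure (jacobi_point_conv \<alpha> \<beta> x (c * y)) A \<partial>\<nu>)"
      unfolding scaled_law_def
      by (rule nn_integral_distr) (use measurable_compose[OF k measurable_emeasure_subprob_algebra[OF A]] in simp_all)
    also have "\<dots> = (\<integral>\<^sup>+y. emeasure (jacobi_m \<alpha> \<beta>) (Pair y -` ((\<lambda>q. jacobi_arg x (c * fst q) (snd q)) -` A)) \<partial>\<nu>)"
      by (intro nn_integral_cong, simp add: jacobi_point_conv_def)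
        (subst emeasure_distr, use A in \<open>auto simp: vimage_def sets_eq_imp_space_eq[OF sets_jacobi_m]\<close>)
    also have "\<dots> = emeasure step_measure ((\<lambda>q. jacobi_arg x (c * fst q) (snd q)) -` A)"
      unfolding step_measure_def
    proof (rule m.emeasure_pair_measure_alt[symmetric])
      show "(\<lambda>q. jacobi_arg x (c * fst q) (snd q)) -` A \<in> sets (\<nu> \<Otimes>\<^sub>M jacobi_m \<alpha> \<beta>)"
        using measurable_sets[OF measurable_step_map A, of x c] sets_step_measure by (simp add: step_measure_def)
    qed
    also have "\<dots> = emeasure ?R A"
      by (subst emeasure_distr) (use A in \<open>auto simp: sets_eq_imp_space_eq[OF sets_step_measure]\<close>)
    finally show "emeasure ?L A = emeasure ?R A" .
  qed
  finally show ?thesis .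
qed

context
  fixes c :: real and M :: "'w measure" and S :: "nat \<Rightarrow> 'w \<Rightarrow> real"
  assumes walk: "jacobi_random_walk \<alpha> \<beta> (scaled_law \<nu> c) M S"
begin

lemma walk_prob_space: "prob_space M"
  using walk by (simp add: jacobi_random_walk_def)

lemma walk_measurable: "S n \<in> borel_measurable M"
  using walk by (simp add: jacobi_random_walk_def)

lemma walk_nonneg: "\<omega> \<in> space M \<Longrightarrow> 0 \<le> S n \<omega>"
  using walk by (simp add: jacobi_random_walk_def)

lemma walk_start: "AE \<omega> in M. S 0 \<omega> = 0"
  using walk by (simp add: jacobi_random_walk_def)

text \<open>Taking expectations in the Markov property removes the conditioning.  The estimates below are about
means of functions of \<open>S (Suc n)\<close> alone, so the law of this variable carries them.\<close>
lemma walk_law_step: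
  "distr M borel (S (Suc n)) = distr (M \<Otimes>\<^sub>M step_measure) borel (\<lambda>p. jacobi_arg (S n (fst p)) (c * fst (snd p)) (snd (snd p)))"
proof (rule measure_eqI)
  interpret M: prob_space M by (rule walk_prob_space)
  interpret pair_prob_space M step_measure ..
  note [measurable] = walk_measurable
  interpret F: finite_measure_subalgebra M "history_algebra M S n"
  proof
    show "subalgebra M (history_algebra M S n)"
    proof -
      let ?G = "{S k -` A \<inter> space M | k A. k \<le> n \<and> A \<in> sets borel}"
      have G: "?G \<subseteq> sets M" by auto
      then have "?G \<subseteq> Pow (space M)" using sets.space_closed by blast
      then have "sets (sigma (space M) ?G) = sigma_sets (space M) ?G" by (rule sets_measure_of)
      then show ?thesis
        unfolding subalgebra_def history_algebra_def using sets.sigma_sets_subset[OF G]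
        by (simp add: space_measure_of_conv)
    qed
  qed
  fix A assume "A \<in> sets (distr M borel (S (Suc n)))"
  then have A: "A \<in> sets borel" by simp
  let ?F = "\<lambda>s q. jacobi_arg s (c * fst q) (snd q)"
  have K: "measure (jacobi_conv \<alpha> \<beta> (return borel s) (scaled_law \<nu> c)) A = measure step_measure (?F s -` A)" for s
    unfolding jacobi_conv_return_eq
    by (subst measure_distr) (use A in \<open>auto simp: sets_eq_imp_space_eq[OF sets_step_measure]\<close>)
  have ind: "integrable M (\<lambda>\<omega>. indicator A (S (Suc n) \<omega>) :: real)"
    using A by (intro M.integrable_const_bound[where B = 1]) (auto split: split_indicator)
  have X: "(\<lambda>p. ?F (S n (fst p)) (snd p)) -` A \<inter> space (M \<Otimes>\<^sub>M step_measure) \<in> sets (M \<Otimes>\<^sub>M step_measure)"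
    by (rule measurable_sets[OF _ A]) measurable
  \<comment> \<open>Sections of the measurable set \<open>X\<close> make the transition probability measurable in \<open>\<omega>\<close>.\<close>
  define X where "X = (\<lambda>p. ?F (S n (fst p)) (snd p)) -` A \<inter> space (M \<Otimes>\<^sub>M step_measure)"
  have X': "X \<in> sets (M \<Otimes>\<^sub>M step_measure)" using X by (simp only: X_def)
  have PX: "Pair \<omega> -` X = ?F (S n \<omega>) -` A" if "\<omega> \<in> space M" for \<omega>
    using that by (auto simp: X_def space_pair_measure sets_eq_imp_space_eq[OF sets_step_measure])
  have mX: "(\<lambda>\<omega>. measure step_measure (Pair \<omega> -` X)) \<in> borel_measurable M"
    unfolding measure_def using step.measurable_emeasure_Pair[OF X'] by measurable
  have iX: "integrable M (\<lambda>\<omega>. measure step_measure (Pair \<omega> -` X))"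
    using mX by (intro M.integrable_const_bound[where B = 1]) auto
  have "emeasure (distr M borel (S (Suc n))) A = ennreal (measure (distr M borel (S (Suc n))) A)"
  proof -
    interpret D: prob_space "distr M borel (S (Suc n))" by (rule M.prob_space_distr) simp
    show ?thesis by (rule D.emeasure_eq_measure)
  qed
  also have "measure (distr M borel (S (Suc n))) A = (\<integral>x. indicator A x \<partial>distr M borel (S (Suc n)))"
    using A by simp
  also have "\<dots> = (\<integral>\<omega>. indicator A (S (Suc n) \<omega>) \<partial>M)"
    using A by (intro integral_distr) auto
  also have "(\<integral>\<omega>. indicator A (S (Suc n) \<omega>) \<partial>M) = (\<integral>\<omega>. real_cond_exp M (history_algebra M S n) (\<lambda>\<omega>. indicator A (S (Suc n) \<omega>)) \<omega> \<partial>M)"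
    using F.real_cond_exp_int(2)[OF ind] by simp
  also have "\<dots> = (\<integral>\<omega>. measure step_measure (Pair \<omega> -` X) \<partial>M)"
  proof (rule integral_cong_AE)
    have "AE \<omega> in M. real_cond_exp M (history_algebra M S n) (\<lambda>\<omega>. indicator A (S (Suc n) \<omega>)) \<omega> = measure step_measure (?F (S n \<omega>) -` A)"
    proof -
      have "AE \<omega> in M. real_cond_exp M (history_algebra M S n) (\<lambda>\<omega>. indicator A (S (Suc n) \<omega>)) \<omega>
          = measure (jacobi_conv \<alpha> \<beta> (return borel (S n \<omega>)) (scaled_law \<nu> c)) A"
        using walk A unfolding jacobi_random_walk_def by blast
      then show ?thesis unfolding K .
    qed
    then show "AE \<omega> in M. real_cond_exp M (history_algebra M S n) (\<lambda>\<omega>. indicator A (S (Suc n) \<omega>)) \<omega> = measure step_measure (Pair \<omega> -` X)"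
      using AE_space by eventually_elim (simp only: PX)
  qed (use mX in \<open>auto intro: borel_measurable_cond_exp2\<close>)
  also have "ennreal \<dots> = (\<integral>\<^sup>+\<omega>. emeasure step_measure (Pair \<omega> -` X) \<partial>M)"
    using nn_integral_eq_integral[OF iX] by (simp add: step.emeasure_eq_measure)
  also have "\<dots> = emeasure (M \<Otimes>\<^sub>M step_measure) X"
    by (rule step.emeasure_pair_measure_alt[OF X', symmetric])
  also have "\<dots> = emeasure (distr (M \<Otimes>\<^sub>M step_measure) borel (\<lambda>p. ?F (S n (fst p)) (snd p))) A"
    unfolding X_def by (rule emeasure_distr[symmetric]) (use A in measurable)
  finally show "emeasure (distr M borel (S (Suc n))) A = emeasure (distr (M \<Otimes>\<^sub>M step_measure) borel (\<lambda>p. ?F (S n (fst p)) (snd p))) A" .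
qed simp

lemma walk_expectation_step:
  fixes g :: "real \<Rightarrow> 'b::{banach, second_countable_topology}"
  assumes g [measurable]: "g \<in> borel_measurable borel" and B: "\<And>x. norm (g x) \<le> B"
  shows "integrable M (\<lambda>\<omega>. \<integral>q. g (jacobi_arg (S n \<omega>) (c * fst q) (snd q)) \<partial>step_measure)"
    and "(\<integral>\<omega>. g (S (Suc n) \<omega>) \<partial>M) = (\<integral>\<omega>. (\<integral>q. g (jacobi_arg (S n \<omega>) (c * fst q) (snd q)) \<partial>step_measure) \<partial>M)"
proof -
  interpret M: prob_space M by (rule walk_prob_space)
  interpret pair_prob_space M step_measure ..
  note [measurable] = walk_measurable
  let ?f = "\<lambda>p. g (jacobi_arg (S n (fst p)) (c * fst (snd p)) (snd (snd p)))"
  have int: "integrable (M \<Otimes>\<^sub>M step_measure) ?f"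
    by (rule P.integrable_const_bound[where B = B]) (auto simp: B)
  show "integrable M (\<lambda>\<omega>. \<integral>q. g (jacobi_arg (S n \<omega>) (c * fst q) (snd q)) \<partial>step_measure)"
    using integrable_fst'[OF int] by simp
  have "(\<integral>\<omega>. g (S (Suc n) \<omega>) \<partial>M) = (\<integral>x. g x \<partial>distr M borel (S (Suc n)))"
    by (rule integral_distr[symmetric]) auto
  also have "\<dots> = (\<integral>p. ?f p \<partial>(M \<Otimes>\<^sub>M step_measure))"
    unfolding walk_law_step by (rule integral_distr) auto
  also have "\<dots> = (\<integral>\<omega>. (\<integral>q. ?f (\<omega>, q) \<partial>step_measure) \<partial>M)"
    by (rule integral_fst'[OF int, symmetric])
  finally show "(\<integral>\<omega>. g (S (Suc n) \<omega>) \<partial>M) = (\<integral>\<omega>. (\<integral>q. g (jacobi_arg (S n \<omega>) (c * fst q) (snd q)) \<partial>step_measure) \<partial>M)"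
    by simp
qed

end

lemma ln_cosh_step:
  assumes "0 < c" "0 \<le> s"
  shows "AE q in step_measure. ln (cosh (jacobi_arg s (c * fst q) (snd q))) = ln (cosh s) + increment c (tanh s) q"
  using AE_step
proof eventually_elim
  case (elim q)
  then show ?case
    using ln_cosh_jacobi_arg[of s "c * fst q" "fst (snd q)" "snd (snd q)"] assms
    by (simp add: increment_def disk_point_def)
qed

lemma tanh_bounds: "0 \<le> s \<Longrightarrow> 0 \<le> tanh s" "tanh (s::real) \<le> 1"
  using tanh_real_bounds[of s] by auto

context
  fixes c :: real and M :: "'w measure" and S :: "nat \<Rightarrow> 'w \<Rightarrow> real"
  assumes walk: "jacobi_random_walk \<alpha> \<beta> (scaled_law \<nu> c) M S"
    and c: "0 < c" "c * K \<le> 1"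
begin

text \<open>Instances of \<open>walk_expectation_step\<close> for exponentials of \<open>ln (cosh S)\<close>: the additive decomposition
of a step lets the old value factor out, and what remains is a function of \<open>u = tanh S\<close>.\<close>
lemma walk_exp_step:
  assumes \<epsilon>: "0 \<le> \<epsilon>"
    and bound: "\<And>u. 0 \<le> u \<Longrightarrow> u \<le> 1 \<Longrightarrow> (\<integral>q. exp (- \<epsilon> * increment c u q) \<partial>step_measure) \<le> b"
  shows "(\<integral>\<omega>. exp (- \<epsilon> * ln (cosh (S (Suc n) \<omega>))) \<partial>M) \<le> b * (\<integral>\<omega>. exp (- \<epsilon> * ln (cosh (S n \<omega>))) \<partial>M)"
proof -
  interpret M: prob_space M by (rule walk_prob_space[OF walk])
  note [measurable] = walk_measurable[OF walk]
  have [measurable]: "(cosh :: real \<Rightarrow> real) \<in> borel_measurable borel"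
    by (auto intro!: borel_measurable_continuous_onI continuous_intros)
  let ?g = "\<lambda>x::real. exp (- \<epsilon> * ln (cosh x))"
  have g: "norm (?g x) \<le> 1" for x using ln_cosh_nonneg[of x] \<epsilon> by (simp add: mult_nonneg_nonneg)
  have [measurable]: "?g \<in> borel_measurable borel" by measurable
  note E = walk_expectation_step[OF walk \<open>?g \<in> borel_measurable borel\<close> g, of n]
  have "(\<integral>\<omega>. ?g (S (Suc n) \<omega>) \<partial>M) = (\<integral>\<omega>. (\<integral>q. ?g (jacobi_arg (S n \<omega>) (c * fst q) (snd q)) \<partial>step_measure) \<partial>M)"
    by (rule E(2))
  also have "\<dots> \<le> (\<integral>\<omega>. b * ?g (S n \<omega>) \<partial>M)"
  proof (rule integral_mono[OF E(1)])
    show "integrable M (\<lambda>\<omega>. b * ?g (S n \<omega>))"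
      by (intro integrable_mult_right M.integrable_const_bound[where B = 1]) (use g in auto)
    fix \<omega> assume "\<omega> \<in> space M"
    then have s: "0 \<le> S n \<omega>" by (rule walk_nonneg[OF walk])
    have "(\<integral>q. ?g (jacobi_arg (S n \<omega>) (c * fst q) (snd q)) \<partial>step_measure)
        = (\<integral>q. ?g (S n \<omega>) * exp (- \<epsilon> * increment c (tanh (S n \<omega>)) q) \<partial>step_measure)"
    proof (rule integral_cong_AE)
      show "AE q in step_measure. ?g (jacobi_arg (S n \<omega>) (c * fst q) (snd q))
          = ?g (S n \<omega>) * exp (- \<epsilon> * increment c (tanh (S n \<omega>)) q)"
        using ln_cosh_step[OF c(1) s]
      proof eventually_elim
        case (elim q)
        show ?case unfolding elim by (simp only: distrib_left exp_add)
      qed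
    qed measurable
    also have "\<dots> = ?g (S n \<omega>) * (\<integral>q. exp (- \<epsilon> * increment c (tanh (S n \<omega>)) q) \<partial>step_measure)"
      by (rule integral_mult_right_zero)
    also have "\<dots> \<le> ?g (S n \<omega>) * b"
      using s by (intro mult_left_mono bound tanh_bounds) auto
    finally show "(\<integral>q. ?g (jacobi_arg (S n \<omega>) (c * fst q) (snd q)) \<partial>step_measure) \<le> b * ?g (S n \<omega>)"
      by (simp only: mult.commute)
  qed
  also have "\<dots> = b * (\<integral>\<omega>. ?g (S n \<omega>) \<partial>M)" by (rule integral_mult_right_zero)
  finally show ?thesis .
qed

lemma walk_char_step:
  assumes bound: "\<And>u. 0 \<le> u \<Longrightarrow> u \<le> 1 \<Longrightarrow>
      cmod ((\<integral>q. iexp (\<theta> * increment c u q) \<partial>step_measure) - w) \<le> D1 + D2 * (1 - u\<^sup>2)"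
  shows "cmod ((\<integral>\<omega>. iexp (\<theta> * ln (cosh (S (Suc n) \<omega>))) \<partial>M) - w * (\<integral>\<omega>. iexp (\<theta> * ln (cosh (S n \<omega>))) \<partial>M))
     \<le> D1 + D2 * (\<integral>\<omega>. 1 - (tanh (S n \<omega>))\<^sup>2 \<partial>M)"
proof -
  interpret M: prob_space M by (rule walk_prob_space[OF walk])
  note [measurable] = walk_measurable[OF walk]
  have [measurable]: "(cosh :: real \<Rightarrow> real) \<in> borel_measurable borel" "(tanh :: real \<Rightarrow> real) \<in> borel_measurable borel"
    by (auto intro!: borel_measurable_continuous_onI continuous_intros)
  let ?g = "\<lambda>x::real. iexp (\<theta> * ln (cosh x))"
  have g: "cmod (?g x) \<le> 1" for x by simp
  have [measurable]: "?g \<in> borel_measurable borel" by measurable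
  note E = walk_expectation_step[OF walk \<open>?g \<in> borel_measurable borel\<close> g, of n]
  let ?\<Phi> = "\<lambda>\<omega>. \<integral>q. iexp (\<theta> * increment c (tanh (S n \<omega>)) q) \<partial>step_measure"
  let ?h = "\<lambda>\<omega>. \<integral>q. ?g (jacobi_arg (S n \<omega>) (c * fst q) (snd q)) \<partial>step_measure"
  have h: "?h \<omega> = ?g (S n \<omega>) * ?\<Phi> \<omega>" if "\<omega> \<in> space M" for \<omega>
  proof -
    have s: "0 \<le> S n \<omega>" using that by (rule walk_nonneg[OF walk])
    have "?h \<omega> = (\<integral>q. ?g (S n \<omega>) * iexp (\<theta> * increment c (tanh (S n \<omega>)) q) \<partial>step_measure)"
    proof (rule integral_cong_AE)
      show "AE q in step_measure. ?g (jacobi_arg (S n \<omega>) (c * fst q) (snd q))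
          = ?g (S n \<omega>) * iexp (\<theta> * increment c (tanh (S n \<omega>)) q)"
        using ln_cosh_step[OF c(1) s]
      proof eventually_elim
        case (elim q)
        show ?case unfolding elim by (simp only: distrib_left exp_add of_real_add)
      qed
    qed measurable
    also have "\<dots> = ?g (S n \<omega>) * ?\<Phi> \<omega>"
      by (rule integral_mult_right_zero)
    finally show ?thesis .
  qed
  have i1: "integrable M (\<lambda>\<omega>. w * ?g (S n \<omega>))"
    by (intro integrable_mult_right M.integrable_const_bound[where B = 1]) auto
  have t: "0 \<le> 1 - (tanh (S n \<omega>))\<^sup>2 \<and> 1 - (tanh (S n \<omega>))\<^sup>2 \<le> 1" for \<omega>
    using tanh_real_bounds[of "S n \<omega>"] by (simp add: abs_square_le_1 abs_le_iff less_imp_le)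
  have i2: "integrable M (\<lambda>\<omega>. 1 - (tanh (S n \<omega>))\<^sup>2)"
    by (intro M.integrable_const_bound[where B = 1]) (use t in auto)
  have "(\<integral>\<omega>. ?g (S (Suc n) \<omega>) \<partial>M) - w * (\<integral>\<omega>. ?g (S n \<omega>) \<partial>M) = (\<integral>\<omega>. ?h \<omega> - w * ?g (S n \<omega>) \<partial>M)"
    unfolding E(2) Bochner_Integration.integral_diff[OF E(1) i1] integral_mult_right_zero ..
  also have "cmod \<dots> \<le> (\<integral>\<omega>. cmod (?h \<omega> - w * ?g (S n \<omega>)) \<partial>M)" by (rule integral_norm_bound)
  also have "\<dots> \<le> (\<integral>\<omega>. D1 + D2 * (1 - (tanh (S n \<omega>))\<^sup>2) \<partial>M)"
  proof (rule integral_mono)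
    show "integrable M (\<lambda>\<omega>. cmod (?h \<omega> - w * ?g (S n \<omega>)))"
      by (intro integrable_norm Bochner_Integration.integrable_diff E(1) i1)
    show "integrable M (\<lambda>\<omega>. D1 + D2 * (1 - (tanh (S n \<omega>))\<^sup>2))"
      by (intro Bochner_Integration.integrable_add integrable_mult_right i2 M.integrable_const)
    fix \<omega> assume \<omega>: "\<omega> \<in> space M"
    then have s: "0 \<le> S n \<omega>" by (rule walk_nonneg[OF walk])
    have "?h \<omega> - w * ?g (S n \<omega>) = ?g (S n \<omega>) * (?\<Phi> \<omega> - w)" unfolding h[OF \<omega>] by (simp only: algebra_simps)
    then have "cmod (?h \<omega> - w * ?g (S n \<omega>)) = cmod (?\<Phi> \<omega> - w)" by (simp only: norm_mult norm_exp_i_times mult_1_left)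
    then show "cmod (?h \<omega> - w * ?g (S n \<omega>)) \<le> D1 + D2 * (1 - (tanh (S n \<omega>))\<^sup>2)"
      using bound[OF tanh_bounds(1)[OF s] tanh_bounds(2)] by simp
  qed
  also have "\<dots> = D1 + D2 * (\<integral>\<omega>. 1 - (tanh (S n \<omega>))\<^sup>2 \<partial>M)"
    using i2 by (simp add: M.prob_space)
  finally show ?thesis .
qed

end
end

section \<open>Characteristic function of the chain\<close>

lemma cmod_iexp_diff_le: "cmod (iexp a - iexp b) \<le> \<bar>a - b\<bar>"
proof -
  have "iexp a - iexp b = iexp b * (iexp (a - b) - 1)"
    by (simp add: algebra_simps flip: exp_add)
  then have "cmod (iexp a - iexp b) = cmod (iexp (a - b) - 1)"
    by (simp only: norm_mult norm_exp_i_times mult_1_left)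
  also have "\<dots> \<le> \<bar>a - b\<bar>" using iexp_approx1[of "a - b" 0] by simp
  finally show ?thesis .
qed

context jacobi_step
begin

text \<open>With \<open>E\<^sub>k\<close> the mean of \<open>exp (- \<epsilon> ln (cosh S\<^sub>k))\<close>, the contraction reads
\<open>\<gamma> c\<^sup>2 E\<^sub>k \<le> E\<^sub>k - E\<^sub>k\<^sub>+\<^sub>1\<close>, and the right-hand side telescopes.\<close>
lemma walk_potential_bound:
  assumes walk: "jacobi_random_walk \<alpha> \<beta> (scaled_law \<nu> c) M S"
    and c: "0 < c" "c * K \<le> 1" and \<epsilon>: "0 \<le> \<epsilon>" "\<epsilon> \<le> 2" and \<gamma>: "0 < \<gamma>"
    and contraction: "\<And>u. 0 \<le> u \<Longrightarrow> u \<le> 1 \<Longrightarrow> (\<integral>q. exp (- \<epsilon> * increment c u q) \<partial>step_measure) \<le> 1 - \<gamma> * c\<^sup>2"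
  shows "c\<^sup>2 * (\<Sum>k<n. \<integral>\<omega>. 1 - (tanh (S k \<omega>))\<^sup>2 \<partial>M) \<le> 1 / \<gamma>"
proof -
  interpret M: prob_space M by (rule walk_prob_space[OF walk])
  note [measurable] = walk_measurable[OF walk]
  have [measurable]: "(cosh :: real \<Rightarrow> real) \<in> borel_measurable borel"
    by (auto intro!: borel_measurable_continuous_onI continuous_intros)
  define E where "E = (\<lambda>k. \<integral>\<omega>. exp (- \<epsilon> * ln (cosh (S k \<omega>))) \<partial>M)"
  have b: "exp (- \<epsilon> * ln (cosh x)) \<le> 1" for x :: real
    using ln_cosh_nonneg[of x] \<epsilon> by (simp add: mult_nonneg_nonneg)
  have i: "integrable M (\<lambda>\<omega>. exp (- \<epsilon> * ln (cosh (S k \<omega>))))" for k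
    by (rule M.integrable_const_bound[where B = 1]) (use b in auto)
  have E1: "0 \<le> E k" "E k \<le> 1" for k
  proof -
    show "0 \<le> E k" unfolding E_def by (rule integral_nonneg_AE) simp
    have "E k \<le> (\<integral>\<omega>. 1 \<partial>M)" unfolding E_def using b by (intro integral_mono i) auto
    then show "E k \<le> 1" by (simp add: M.prob_space)
  qed
  have step: "\<gamma> * c\<^sup>2 * E k \<le> E k - E (Suc k)" for k
    using walk_exp_step[OF walk c \<epsilon>(1) contraction, of k] by (simp add: E_def algebra_simps)
  have e: "(\<integral>\<omega>. 1 - (tanh (S k \<omega>))\<^sup>2 \<partial>M) \<le> E k" for k
    unfolding E_def one_minus_tanh_square
  proof (rule integral_mono[OF _ i])
    have "exp (- 2 * ln (cosh x)) \<le> 1" for x :: real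
      using ln_cosh_nonneg[of x] by simp
    then show "integrable M (\<lambda>\<omega>. exp (- 2 * ln (cosh (S k \<omega>))))"
      by (intro M.integrable_const_bound[where B = 1]) auto
    show "exp (- 2 * ln (cosh (S k \<omega>))) \<le> exp (- \<epsilon> * ln (cosh (S k \<omega>)))" for \<omega>
      using mult_right_mono[OF \<epsilon>(2) ln_cosh_nonneg[of "S k \<omega>"]] by simp
  qed
  have "\<gamma> * (c\<^sup>2 * (\<Sum>k<n. \<integral>\<omega>. 1 - (tanh (S k \<omega>))\<^sup>2 \<partial>M)) \<le> \<gamma> * (c\<^sup>2 * (\<Sum>k<n. E k))"
    using e \<gamma> by (intro mult_left_mono sum_mono) auto
  also have "\<dots> = (\<Sum>k<n. \<gamma> * c\<^sup>2 * E k)" by (simp add: sum_distrib_left mult.assoc)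
  also have "\<dots> \<le> (\<Sum>k<n. E k - E (Suc k))" by (rule sum_mono) (rule step)
  also have "\<dots> = E 0 - E n" by (rule sum_lessThan_telescope')
  also have "\<dots> \<le> 1" using E1[of n] E1[of 0] by linarith
  finally show ?thesis using \<gamma> by (simp add: field_simps)
qed

text \<open>Let \<open>F\<^sub>k\<close> be the characteristic function of \<open>ln (cosh S\<^sub>k)\<close> at \<open>\<theta>\<close> and \<open>w\<close> the approximate factor
of one step.  As \<open>\<bar>w\<bar> \<le> 1\<close>, the errors \<open>F\<^sub>k\<^sub>+\<^sub>1 - w F\<^sub>k\<close> just add up to a bound for \<open>F\<^sub>n - w\<^sup>n\<close>;
the part of them that involves \<open>1 - u\<^sup>2\<close> is summed by \<open>walk_potential_bound\<close>.  The last summand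
\<open>\<bar>\<theta>\<bar>\<close> accounts for this sum and for the passage from \<open>ln (cosh S\<^sub>n)\<close> to \<open>S\<^sub>n\<close>.\<close>
lemma walk_char_estimate:
  obtains D c0 where "0 \<le> D" "0 < c0"
    "\<And>c \<theta> n (M :: 'w measure) S. 0 < c \<Longrightarrow> c \<le> c0 \<Longrightarrow> \<bar>\<theta>\<bar> \<le> 1 \<Longrightarrow> jacobi_random_walk \<alpha> \<beta> (scaled_law \<nu> c) M S \<Longrightarrow>
      cmod ((\<integral>\<omega>. iexp (\<theta> * S n \<omega>) \<partial>M) - exp (n * (\<i> * \<theta> * mean_increment c - \<theta>\<^sup>2 * var_increment c / 2)))
      \<le> D * (n * (\<bar>\<theta>\<bar> * c^5 + \<theta>\<^sup>2 * c^3 + \<bar>\<theta>\<bar>^3 * c^3) + \<bar>\<theta>\<bar>)"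
proof -
  obtain C where C: "0 \<le> C" and step: "\<And>c u \<theta>. 0 < c \<Longrightarrow> c * K \<le> 1 \<Longrightarrow> 0 \<le> u \<Longrightarrow> u \<le> 1 \<Longrightarrow> \<bar>\<theta>\<bar> \<le> 1 \<Longrightarrow>
      cmod ((\<integral>q. iexp (\<theta> * increment c u q) \<partial>step_measure) - exp (\<i> * \<theta> * mean_increment c - \<theta>\<^sup>2 * var_increment c / 2))
      \<le> C * (\<bar>\<theta>\<bar> * c^5 + \<theta>\<^sup>2 * c^3 + \<bar>\<theta>\<bar>^3 * c^3 + \<bar>\<theta>\<bar> * c\<^sup>2 * (1 - u\<^sup>2))"
    by (rule char_increment_bound) blast
  obtain \<epsilon> \<gamma> c0 where \<epsilon>: "0 < \<epsilon>" "\<epsilon> \<le> 2" and \<gamma>: "0 < \<gamma>" and c0: "0 < c0" "c0 * K \<le> 1"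
    and contraction: "\<And>c u. 0 < c \<Longrightarrow> c \<le> c0 \<Longrightarrow> 0 \<le> u \<Longrightarrow> u \<le> 1 \<Longrightarrow>
        (\<integral>q. exp (- \<epsilon> * increment c u q) \<partial>step_measure) \<le> 1 - \<gamma> * c\<^sup>2"
    by (rule exp_increment_contraction) blast
  define D where "D = C + C / \<gamma> + ln 2"
  have D: "0 \<le> D" "C / \<gamma> + ln 2 \<le> D" "C \<le> D" using C \<gamma> by (auto simp: D_def)
  show ?thesis
  proof (rule that[OF D(1) c0(1)])
    fix c \<theta> :: real and n :: nat and M :: "'w measure" and S
    assume c: "0 < c" "c \<le> c0" and \<theta>: "\<bar>\<theta>\<bar> \<le> 1" and walk: "jacobi_random_walk \<alpha> \<beta> (scaled_law \<nu> c) M S"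
    interpret M: prob_space M by (rule walk_prob_space[OF walk])
    note [measurable] = walk_measurable[OF walk]
    have [measurable]: "(cosh :: real \<Rightarrow> real) \<in> borel_measurable borel"
      by (auto intro!: borel_measurable_continuous_onI continuous_intros)
    have cK: "c * K \<le> 1" using mult_right_mono[OF c(2), of K] c0(2) K_ge_1 by linarith
    define \<zeta> where "\<zeta> = \<i> * \<theta> * mean_increment c - \<theta>\<^sup>2 * var_increment c / 2"
    define w where "w = exp \<zeta>"
    have w: "cmod w \<le> 1"
    proof -
      have "0 \<le> var_increment c" using ab second_moment_pos by (simp add: var_increment_def)
      then show ?thesis by (simp add: w_def \<zeta>_def)
    qed
    define e where "e = (\<lambda>k. \<integral>\<omega>. 1 - (tanh (S k \<omega>))\<^sup>2 \<partial>M)"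
    define F where "F = (\<lambda>k. \<integral>\<omega>. iexp (\<theta> * ln (cosh (S k \<omega>))) \<partial>M)"
    define D1 where "D1 = C * (\<bar>\<theta>\<bar> * c^5 + \<theta>\<^sup>2 * c^3 + \<bar>\<theta>\<bar>^3 * c^3)"
    define D2 where "D2 = C * \<bar>\<theta>\<bar> * c\<^sup>2"
    have one: "cmod (F (Suc k) - w * F k) \<le> D1 + D2 * e k" for k
      unfolding F_def e_def
    proof (rule walk_char_step[OF walk c(1) cK])
      fix u :: real assume u: "0 \<le> u" "u \<le> 1"
      show "cmod ((\<integral>q. iexp (\<theta> * increment c u q) \<partial>step_measure) - w) \<le> D1 + D2 * (1 - u\<^sup>2)"
        using step[OF c(1) cK u \<theta>] by (simp add: w_def \<zeta>_def D1_def D2_def distrib_left mult.assoc)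
    qed
    have F0: "F 0 = 1"
    proof -
      have "F 0 = (\<integral>\<omega>. 1 \<partial>M)" unfolding F_def
      proof (rule integral_cong_AE)
        show "AE \<omega> in M. iexp (\<theta> * ln (cosh (S 0 \<omega>))) = 1"
          using walk_start[OF walk] by eventually_elim simp
      qed measurable
      then show ?thesis by (simp add: M.prob_space)
    qed
    have sum: "cmod (F k - w ^ k) \<le> k * D1 + D2 * (\<Sum>j<k. e j)" for k
    proof (induction k)
      case 0
      then show ?case by (simp add: F0)
    next
      case (Suc k)
      have "F (Suc k) - w ^ Suc k = (F (Suc k) - w * F k) + w * (F k - w ^ k)" by (simp add: algebra_simps)
      then have "cmod (F (Suc k) - w ^ Suc k) \<le> cmod (F (Suc k) - w * F k) + cmod w * cmod (F k - w ^ k)"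
        by (simp only: norm_mult[symmetric] norm_triangle_ineq)
      also have "\<dots> \<le> (D1 + D2 * e k) + 1 * (k * D1 + D2 * (\<Sum>j<k. e j))"
        using one[of k] Suc w by (intro add_mono mult_mono) auto
      also have "\<dots> = Suc k * D1 + D2 * (\<Sum>j<Suc k. e j)" by (simp add: algebra_simps)
      finally show ?case .
    qed
    have pot: "c\<^sup>2 * (\<Sum>j<n. e j) \<le> 1 / \<gamma>"
      unfolding e_def using walk_potential_bound[OF walk c(1) cK _ \<epsilon>(2) \<gamma> contraction[OF c], of n] \<epsilon>(1) by simp
    have "D2 * (\<Sum>j<n. e j) = C * \<bar>\<theta>\<bar> * (c\<^sup>2 * (\<Sum>j<n. e j))" by (simp add: D2_def mult.assoc)
    also have "\<dots> \<le> C * \<bar>\<theta>\<bar> * (1 / \<gamma>)" using C by (intro mult_left_mono pot) auto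
    finally have a: "cmod (F n - w ^ n) \<le> n * D1 + C / \<gamma> * \<bar>\<theta>\<bar>" using sum[of n] by simp
    have b: "cmod ((\<integral>\<omega>. iexp (\<theta> * S n \<omega>) \<partial>M) - F n) \<le> ln 2 * \<bar>\<theta>\<bar>"
    proof -
      have i: "integrable M (\<lambda>\<omega>. iexp (\<theta> * S n \<omega>))" "integrable M (\<lambda>\<omega>. iexp (\<theta> * ln (cosh (S n \<omega>))))"
        by (rule M.integrable_const_bound[where B = 1]; auto)+
      have "cmod ((\<integral>\<omega>. iexp (\<theta> * S n \<omega>) \<partial>M) - F n) = cmod (\<integral>\<omega>. iexp (\<theta> * S n \<omega>) - iexp (\<theta> * ln (cosh (S n \<omega>))) \<partial>M)"
        unfolding F_def by (simp only: Bochner_Integration.integral_diff[OF i])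
      also have "\<dots> \<le> (\<integral>\<omega>. cmod (iexp (\<theta> * S n \<omega>) - iexp (\<theta> * ln (cosh (S n \<omega>)))) \<partial>M)" by (rule integral_norm_bound)
      also have "\<dots> \<le> (\<integral>\<omega>. ln 2 * \<bar>\<theta>\<bar> \<partial>M)"
      proof (rule integral_mono)
        show "integrable M (\<lambda>\<omega>. cmod (iexp (\<theta> * S n \<omega>) - iexp (\<theta> * ln (cosh (S n \<omega>)))))"
          by (intro integrable_norm Bochner_Integration.integrable_diff i)
        fix \<omega> assume "\<omega> \<in> space M"
        then have s: "0 \<le> S n \<omega>" by (rule walk_nonneg[OF walk])
        have "cmod (iexp (\<theta> * S n \<omega>) - iexp (\<theta> * ln (cosh (S n \<omega>)))) \<le> \<bar>\<theta> * S n \<omega> - \<theta> * ln (cosh (S n \<omega>))\<bar>"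
          by (rule cmod_iexp_diff_le)
        also have "\<dots> = \<bar>\<theta>\<bar> * \<bar>S n \<omega> - ln (cosh (S n \<omega>))\<bar>" by (simp only: right_diff_distrib[symmetric] abs_mult)
        also have "\<dots> \<le> \<bar>\<theta>\<bar> * ln 2" by (intro mult_left_mono abs_diff_ln_cosh_le s) auto
        finally show "cmod (iexp (\<theta> * S n \<omega>) - iexp (\<theta> * ln (cosh (S n \<omega>)))) \<le> ln 2 * \<bar>\<theta>\<bar>" by (simp only: mult.commute)
      qed simp
      also have "\<dots> = ln 2 * \<bar>\<theta>\<bar>" by (simp add: M.prob_space)
      finally show ?thesis .
    qed
    have "w ^ n = exp (n * \<zeta>)" by (simp add: w_def exp_of_nat_mult)
    then have "cmod ((\<integral>\<omega>. iexp (\<theta> * S n \<omega>) \<partial>M) - exp (n * \<zeta>)) \<le> n * D1 + C / \<gamma> * \<bar>\<theta>\<bar> + ln 2 * \<bar>\<theta>\<bar>"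
      using a b norm_triangle_ineq[of "(\<integral>\<omega>. iexp (\<theta> * S n \<omega>) \<partial>M) - F n" "F n - w ^ n"] by simp
    also have "\<dots> = C * (n * (\<bar>\<theta>\<bar> * c^5 + \<theta>\<^sup>2 * c^3 + \<bar>\<theta>\<bar>^3 * c^3)) + (C / \<gamma> + ln 2) * \<bar>\<theta>\<bar>"
      by (simp only: D1_def algebra_simps)
    also have "\<dots> \<le> D * (n * (\<bar>\<theta>\<bar> * c^5 + \<theta>\<^sup>2 * c^3 + \<bar>\<theta>\<bar>^3 * c^3)) + D * \<bar>\<theta>\<bar>"
      using D c by (intro add_mono mult_right_mono mult_nonneg_nonneg add_nonneg_nonneg) auto
    also have "\<dots> = D * (n * (\<bar>\<theta>\<bar> * c^5 + \<theta>\<^sup>2 * c^3 + \<bar>\<theta>\<bar>^3 * c^3) + \<bar>\<theta>\<bar>)" by (simp only: distrib_left)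
    finally show "cmod ((\<integral>\<omega>. iexp (\<theta> * S n \<omega>) \<partial>M) - exp (n * (\<i> * \<theta> * mean_increment c - \<theta>\<^sup>2 * var_increment c / 2)))
      \<le> D * (n * (\<bar>\<theta>\<bar> * c^5 + \<theta>\<^sup>2 * c^3 + \<bar>\<theta>\<bar>^3 * c^3) + \<bar>\<theta>\<bar>)"
      by (simp only: \<zeta>_def)
  qed
qed

end

section \<open>Passage to the limit\<close>

lemma power_powr_eq:
  fixes x :: real
  assumes "0 < x"
  shows "(x powr a) ^ k = x powr (k * a)"
proof -
  have "(x powr a) ^ k = (x powr a) powr k" using assms by (intro powr_realpow[symmetric]) simp
  then show ?thesis by (simp only: powr_powr mult.commute)
qed

context jacobi_step
begin

definition "limit_shift = - (m4 * (1 - 4 * mean_z2 + 3 * mean_z4) / 12)"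

text \<open>With \<open>c = n\<^bsup>-r\<^esup>\<close> and \<open>\<theta> = t / a\<^sub>n\<close> one has \<open>n \<theta> c\<^sup>4 = t P\<^sub>n\<close> and \<open>n \<theta>\<^sup>2 c\<^sup>2 = t\<^sup>2 Q\<^sub>n\<close>, where \<open>P\<^sub>n \<rightarrow> p\<close>
and \<open>Q\<^sub>n \<rightarrow> q\<close> are the two given quotients.  The error terms of \<open>walk_char_estimate\<close> are \<open>\<bar>\<theta>\<bar>\<close>, which
tends to \<open>0\<close>, and products of \<open>\<bar>t\<bar>\<^sup>k P\<^sub>n\<close> or \<open>\<bar>t\<bar>\<^sup>k Q\<^sub>n\<close> with null sequences.  The exponent converges, since the centering cancels the part
of order \<open>c\<^sup>2\<close> of the mean exactly.\<close>
lemma scaled_walk_char_limit: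
  fixes M :: "real \<Rightarrow> 'w measure" and S :: "real \<Rightarrow> nat \<Rightarrow> 'w \<Rightarrow> real" and a :: "nat \<Rightarrow> real"
  assumes walk: "\<And>c. 0 < c \<Longrightarrow> c \<le> 1 \<Longrightarrow> jacobi_random_walk \<alpha> \<beta> (scaled_law \<nu> c) (M c) (S c)"
    and r: "0 < r"
    and a: "\<And>n. 1 \<le> n \<Longrightarrow> 0 < a n" "(\<lambda>n. 1 / a n) \<longlonglongrightarrow> 0"
    and p: "(\<lambda>n. real n powr (1 - 4 * r) / a n) \<longlonglongrightarrow> p"
    and q: "(\<lambda>n. real n powr (1 - 2 * r) / (a n)\<^sup>2) \<longlonglongrightarrow> q"
  shows "(\<lambda>n. char (distr (M (real n powr (- r))) borel
      (\<lambda>\<omega>. (S (real n powr (- r)) n \<omega> - m2 * (1 - mean_z2) / 2 * real n powr (1 - 2 * r)) / a n)) t)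
    \<longlonglongrightarrow> exp (\<i> * of_real (t * (p * limit_shift)) - of_real (t\<^sup>2 * (q * (m2 / (2 * (\<alpha> + 1)))) / 2))"
proof -
  obtain D c0 where D: "0 \<le> D" and c0: "0 < c0"
    and est: "\<And>c \<theta> n (M :: 'w measure) S. 0 < c \<Longrightarrow> c \<le> c0 \<Longrightarrow> \<bar>\<theta>\<bar> \<le> 1 \<Longrightarrow> jacobi_random_walk \<alpha> \<beta> (scaled_law \<nu> c) M S \<Longrightarrow>
      cmod ((\<integral>\<omega>. iexp (\<theta> * S n \<omega>) \<partial>M) - exp (n * (\<i> * \<theta> * mean_increment c - \<theta>\<^sup>2 * var_increment c / 2)))
      \<le> D * (n * (\<bar>\<theta>\<bar> * c^5 + \<theta>\<^sup>2 * c^3 + \<bar>\<theta>\<bar>^3 * c^3) + \<bar>\<theta>\<bar>)"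
    by (rule walk_char_estimate) blast
  define c where "c = (\<lambda>n. real n powr (- r))"
  define P where "P = (\<lambda>n. real n powr (1 - 4 * r) / a n)"
  define Q where "Q = (\<lambda>n. real n powr (1 - 2 * r) / (a n)\<^sup>2)"
  define b where "b = (\<lambda>n. m2 * (1 - mean_z2) / 2 * real n powr (1 - 2 * r))"
  define v where "v = m2 / (2 * (\<alpha> + 1))"
  let ?ch = "\<lambda>n. char (distr (M (c n)) borel (\<lambda>\<omega>. (S (c n) n \<omega> - b n) / a n)) t"
  let ?z = "\<lambda>n. exp (\<i> * of_real (t * (P n * limit_shift)) - of_real (t\<^sup>2 * (Q n * v) / 2))"
  let ?err = "\<lambda>n. D * (\<bar>t\<bar> * P n * c n + t\<^sup>2 * Q n * c n + \<bar>t\<bar>^3 * Q n * c n * (1 / a n) + \<bar>t\<bar> * (1 / a n))"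
  have clim: "c \<longlonglongrightarrow> 0"
    unfolding c_def by (rule tendsto_neg_powr) (use r filterlim_real_sequentially in auto)
  have zlim: "?z \<longlonglongrightarrow> exp (\<i> * of_real (t * (p * limit_shift)) - of_real (t\<^sup>2 * (q * v) / 2))"
    using p q unfolding P_def Q_def by (intro tendsto_intros) auto
  have "?err \<longlonglongrightarrow> D * (\<bar>t\<bar> * p * 0 + t\<^sup>2 * q * 0 + \<bar>t\<bar>^3 * q * 0 * 0 + \<bar>t\<bar> * 0)"
    using p q clim a(2) unfolding P_def Q_def by (intro tendsto_intros) auto
  then have errlim: "?err \<longlonglongrightarrow> 0" by simp
  have "(\<lambda>n. \<bar>t\<bar> * (1 / a n)) \<longlonglongrightarrow> \<bar>t\<bar> * 0" by (intro tendsto_intros a(2))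
  then have "eventually (\<lambda>n. \<bar>t\<bar> * (1 / a n) < 1) sequentially" by (rule order_tendstoD) simp
  moreover have "eventually (\<lambda>n. c n < c0) sequentially" using order_tendstoD(2)[OF clim c0] .
  moreover have "eventually (\<lambda>n::nat. 1 \<le> n) sequentially" by (rule eventually_ge_at_top)
  ultimately have "eventually (\<lambda>n. norm (?ch n - ?z n) \<le> ?err n) sequentially"
  proof eventually_elim
    case (elim n)
    define \<theta> where "\<theta> = t / a n"
    have an: "0 < a n" using a(1) elim by simp
    have n: "1 \<le> real n" using elim by simp
    have cn: "0 < c n" "c n \<le> 1" using n r powr_mono[of "- r" 0 "real n"] by (simp_all add: c_def)
    have \<theta>: "\<bar>\<theta>\<bar> \<le> 1" using elim an by (simp add: \<theta>_def)
    note w = walk[OF cn]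
    have cpow: "c n ^ k = real n powr (- (k * r))" for k using n by (simp add: c_def power_powr_eq)
    have nc2: "n * c n ^ 2 = real n powr (1 - 2 * r)" and nc4: "n * c n ^ 4 = real n powr (1 - 4 * r)"
      using n by (simp_all add: cpow powr_diff powr_minus divide_inverse)
    interpret M: prob_space "M (c n)" by (rule walk_prob_space[OF w])
    note [measurable] = walk_measurable[OF w]
    let ?I = "\<integral>\<omega>. iexp (\<theta> * S (c n) n \<omega>) \<partial>M (c n)"
    let ?Z = "n * (\<i> * \<theta> * mean_increment (c n) - \<theta>\<^sup>2 * var_increment (c n) / 2)"
    have "?ch n = (\<integral>\<omega>. iexp (t * ((S (c n) n \<omega> - b n) / a n)) \<partial>M (c n))"
      unfolding char_def by (rule integral_distr) auto
    also have "\<dots> = (\<integral>\<omega>. iexp (- \<theta> * b n) * iexp (\<theta> * S (c n) n \<omega>) \<partial>M (c n))"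
      by (intro Bochner_Integration.integral_cong refl)
        (simp add: \<theta>_def algebra_simps diff_divide_distrib flip: exp_add)
    also have "\<dots> = iexp (- \<theta> * b n) * ?I" by (rule integral_mult_right_zero)
    finally have ch: "?ch n = iexp (- \<theta> * b n) * ?I" .
    have z: "?z n = iexp (- \<theta> * b n) * exp ?Z"
    proof -
      have 1: "n * mean_increment (c n) - b n = real n powr (1 - 4 * r) * limit_shift"
        unfolding nc4[symmetric] b_def nc2[symmetric] by (simp add: mean_increment_def limit_shift_def field_simps)
      have 2: "t * (P n * limit_shift) = \<theta> * (n * mean_increment (c n) - b n)"
        unfolding 1 by (simp add: P_def \<theta>_def)
      have 3: "t\<^sup>2 * (Q n * v) / 2 = n * \<theta>\<^sup>2 * var_increment (c n) / 2"
        unfolding Q_def nc2[symmetric] by (simp add: \<theta>_def v_def var_increment_def power_divide)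
      show ?thesis
        unfolding 2 3 exp_add[symmetric] by (rule arg_cong[where f = exp]) (simp add: algebra_simps)
    qed
    have "norm (?ch n - ?z n) = cmod (?I - exp ?Z)"
      unfolding ch z right_diff_distrib[symmetric] norm_mult norm_exp_i_times by simp
    also have "\<dots> \<le> D * (n * (\<bar>\<theta>\<bar> * c n^5 + \<theta>\<^sup>2 * c n^3 + \<bar>\<theta>\<bar>^3 * c n^3) + \<bar>\<theta>\<bar>)"
      by (rule est[OF cn(1) _ \<theta> w]) (use elim in simp)
    also have "n * (\<bar>\<theta>\<bar> * c n^5 + \<theta>\<^sup>2 * c n^3 + \<bar>\<theta>\<bar>^3 * c n^3) + \<bar>\<theta>\<bar>
      = \<bar>t\<bar> * P n * c n + t\<^sup>2 * Q n * c n + \<bar>t\<bar>^3 * Q n * c n * (1 / a n) + \<bar>t\<bar> * (1 / a n)"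
    proof -
      have "n * (\<bar>\<theta>\<bar> * c n^5) = \<bar>\<theta>\<bar> * (n * c n ^ 4) * c n" by (simp add: eval_nat_numeral)
      moreover have "n * (\<theta>\<^sup>2 * c n^3) = \<theta>\<^sup>2 * (n * c n ^ 2) * c n" by (simp add: eval_nat_numeral)
      moreover have "n * (\<bar>\<theta>\<bar>^3 * c n^3) = \<bar>\<theta>\<bar>^3 * (n * c n ^ 2) * c n" by (simp add: eval_nat_numeral)
      moreover have "\<bar>\<theta>\<bar> = \<bar>t\<bar> * (1 / a n)" "\<theta>\<^sup>2 = t\<^sup>2 * (1 / (a n)\<^sup>2)"
        using an by (simp_all add: \<theta>_def power_divide)
      moreover have "\<bar>\<theta>\<bar>^3 = \<bar>t\<bar>^3 * (1 / (a n)\<^sup>2) * (1 / a n)"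
        using an by (simp add: \<theta>_def power_divide power3_eq_cube power2_eq_square)
      ultimately show ?thesis
        unfolding nc2 nc4 distrib_left P_def Q_def by (simp only: mult_ac divide_inverse mult_1_left)
    qed
    finally show ?case .
  qed
  then have "(\<lambda>n. ?ch n - ?z n) \<longlonglongrightarrow> 0" by (rule Lim_null_comparison[OF _ errlim])
  from tendsto_add[OF this zlim] show ?thesis by (simp add: c_def b_def v_def)
qed

end

text \<open>By scaling from the standard normal distribution.\<close>
lemma char_normal_law:
  assumes v: "0 < v"
  shows "real_distribution (normal_law \<mu> v)"
    and "char (normal_law \<mu> v) t = exp (\<i> * of_real (t * \<mu>) - of_real (t\<^sup>2 * v / 2))"
proof -
  interpret N: prob_space "normal_law \<mu> v"
    unfolding normal_law_def using v by (intro prob_space_normal_density) simp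
  show "real_distribution (normal_law \<mu> v)"
    by unfold_locales (simp_all add: normal_law_def)
  interpret std: prob_space std_normal_distribution by (rule prob_space_normal_density) simp
  have "distributed std_normal_distribution lborel (\<lambda>x. x) std_normal_density"
    by (auto simp: distributed_def intro!: distr_id2)
  from std.normal_density_affine[OF this, of "sqrt v" \<mu>] v
  have "normal_law \<mu> v = distr std_normal_distribution lborel (\<lambda>x. \<mu> + x * sqrt v)"
    by (simp add: distributed_def normal_law_def mult.commute)
  also have "char \<dots> t = (\<integral>x. iexp (t * (\<mu> + x * sqrt v)) \<partial>std_normal_distribution)"
    unfolding char_def by (rule integral_distr) auto
  also have "\<dots> = (\<integral>x. iexp (t * \<mu>) * iexp (t * sqrt v * x) \<partial>std_normal_distribution)"
    by (intro Bochner_Integration.integral_cong refl) (simp add: algebra_simps flip: exp_add)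
  also have "\<dots> = iexp (t * \<mu>) * char std_normal_distribution (t * sqrt v)"
    unfolding char_def by (rule integral_mult_right_zero)
  also have "\<dots> = exp (\<i> * of_real (t * \<mu>) - of_real (t\<^sup>2 * v / 2))"
  proof -
    have "- ((t * sqrt v)\<^sup>2) / 2 = - (t\<^sup>2 * v / 2)" using v by (simp add: power_mult_distrib)
    then have "char std_normal_distribution (t * sqrt v) = exp (of_real (- (t\<^sup>2 * v / 2)))"
      unfolding char_std_normal_distribution exp_of_real by (simp only:)
    then show ?thesis by (simp only: exp_add[symmetric]) simp
  qed
  finally show "char (normal_law \<mu> v) t = exp (\<i> * of_real (t * \<mu>) - of_real (t\<^sup>2 * v / 2))" .
qed

lemma weak_conv_m_Suc:
  assumes "weak_conv_m (\<lambda>n. N (Suc n)) N'"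
  shows "weak_conv_m N N'"
  unfolding weak_conv_m_def weak_conv_def
proof (intro allI impI)
  fix x assume "isCont (cdf N') x"
  then have "(\<lambda>n. cdf (N (Suc n)) x) \<longlonglongrightarrow> cdf N' x"
    using assms by (simp add: weak_conv_m_def weak_conv_def)
  then show "(\<lambda>n. cdf (N n) x) \<longlonglongrightarrow> cdf N' x" by (rule LIMSEQ_imp_Suc)
qed

text \<open>Continuity theorem of Levy.  The index \<open>n = 0\<close> is excluded from the assumptions because, in the
application, the scaling factor \<open>0 powr (- r)\<close> is \<open>0\<close> there, and nothing is known about the walk
with scaling factor \<open>0\<close>.\<close>
lemma tends_in_distribution_if_char:
  assumes "\<And>n. 1 \<le> n \<Longrightarrow> prob_space (M n) \<and> X n \<in> borel_measurable (M n)"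
    and "real_distribution N" and "\<And>t. (\<lambda>n. char (distr (M n) borel (X n)) t) \<longlonglongrightarrow> char N t"
  shows "tends_in_distribution M X N"
  unfolding tends_in_distribution_def
proof (rule weak_conv_m_Suc, rule levy_continuity)
  show "real_distribution (distr (M (Suc n)) borel (X (Suc n)))" for n
    using assms(1)[of "Suc n"] by (simp add: prob_space.real_distribution_distr)
  show "(\<lambda>n. char (distr (M (Suc n)) borel (X (Suc n))) t) \<longlonglongrightarrow> char N t" for t
    using LIMSEQ_Suc[OF assms(3)[of t]] .
qed (rule assms)

text \<open>The distribution function of a point mass at \<open>x\<close> is continuous at \<open>x - e\<close> and \<open>x + e\<close>, and
\<open>P (\<bar>X - x\<bar> > e) \<le> 1 - F (x + e) + F (x - e)\<close>.\<close>
lemma tends_in_probability_if_tends_in_distribution: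
  assumes rv: "\<And>n. 1 \<le> n \<Longrightarrow> prob_space (M n) \<and> X n \<in> borel_measurable (M n)"
    and "tends_in_distribution M X (return borel x)"
  shows "tends_in_probability M X x"
  unfolding tends_in_probability_def
proof (intro allI impI)
  fix e :: real assume e: "0 < e"
  let ?F = "\<lambda>n. cdf (distr (M n) borel (X n))"
  interpret R: prob_space "return borel x" by (rule prob_space_return) simp
  interpret R: real_distribution "return borel x" by unfold_locales simp_all
  have lim: "(\<lambda>n. ?F n y) \<longlonglongrightarrow> cdf (return borel x) y" if "y \<noteq> x" for y
  proof -
    have "isCont (cdf (return borel x)) y"
      using that by (simp add: R.isCont_cdf measure_return)
    then show ?thesis using assms(2) by (simp add: tends_in_distribution_def weak_conv_m_def weak_conv_def)
  qed
  have "(\<lambda>n. 1 - ?F n (x + e) + ?F n (x - e)) \<longlonglongrightarrow> 1 - cdf (return borel x) (x + e) + cdf (return borel x) (x - e)"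
    using e by (intro tendsto_intros lim) auto
  then have up: "(\<lambda>n. 1 - ?F n (x + e) + ?F n (x - e)) \<longlonglongrightarrow> 0"
    using e by (simp add: cdf_def measure_return)
  show "(\<lambda>n. measure (M n) {\<omega> \<in> space (M n). \<bar>X n \<omega> - x\<bar> > e}) \<longlonglongrightarrow> 0"
  proof (rule real_tendsto_sandwich[OF _ _ tendsto_const up])
    show "eventually (\<lambda>n. measure (M n) {\<omega> \<in> space (M n). \<bar>X n \<omega> - x\<bar> > e} \<le> 1 - ?F n (x + e) + ?F n (x - e)) sequentially"
      using eventually_ge_at_top[of 1]
    proof eventually_elim
      case (elim n)
      interpret M: prob_space "M n" using rv[OF elim] by simp
      have [measurable]: "X n \<in> borel_measurable (M n)" using rv[OF elim] by simp
      let ?A = "{\<omega> \<in> space (M n). X n \<omega> \<le> x + e}" and ?B = "{\<omega> \<in> space (M n). X n \<omega> \<le> x - e}"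
      have F: "?F n y = measure (M n) {\<omega> \<in> space (M n). X n \<omega> \<le> y}" for y
        unfolding cdf_def by (subst measure_distr) (auto intro!: arg_cong[where f = "measure (M n)"])
      have "measure (M n) {\<omega> \<in> space (M n). \<bar>X n \<omega> - x\<bar> > e} \<le> measure (M n) ((space (M n) - ?A) \<union> ?B)"
        by (rule M.finite_measure_mono) auto
      also have "\<dots> \<le> measure (M n) (space (M n) - ?A) + measure (M n) ?B"
        by (rule measure_Un_le) auto
      also have "measure (M n) (space (M n) - ?A) = 1 - measure (M n) ?A"
        by (rule M.prob_compl) auto
      finally show ?case unfolding F .
    qed
  qed simp
qed

text \<open>The complement of the support is a union of open null sets, and by the Lindelof property countably
many of them suffice.\<close>
lemma AE_bounded_if_compact_support:
  fixes \<nu> :: "real measure"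
  assumes sets: "sets \<nu> = sets borel" and "compact (measure_support \<nu>)"
  obtains K where "1 \<le> K" "AE x in \<nu>. \<bar>x\<bar> \<le> K"
proof -
  obtain K where K: "\<And>x. x \<in> measure_support \<nu> \<Longrightarrow> \<bar>x\<bar> \<le> K"
    using compact_imp_bounded[OF assms(2)] by (auto simp: bounded_iff)
  let ?F = "{U. open U \<and> emeasure \<nu> U = 0}"
  obtain F' where F': "F' \<subseteq> ?F" "countable F'" "\<Union>F' = \<Union>?F"
    by (rule Lindelof[of ?F]) auto
  have "(\<Union>U\<in>F'. U) \<in> null_sets \<nu>"
  proof (rule null_sets_UN'[OF F'(2)])
    fix U assume "U \<in> F'"
    then show "U \<in> null_sets \<nu>" using F'(1) by (auto simp: null_sets_def sets)
  qed
  then have "AE x in \<nu>. x \<notin> \<Union>F'" by (intro AE_not_in) simp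
  then have "AE x in \<nu>. \<bar>x\<bar> \<le> max 1 K"
  proof eventually_elim
    case (elim x)
    then have "x \<in> measure_support \<nu>"
      unfolding F'(3) measure_support_def by (auto simp: zero_less_iff_neq_zero)
    then show ?case using K by fastforce
  qed
  then show ?thesis by (intro that[of "max 1 K"]) auto
qed

text \<open>A vanishing moment of order \<open>k > 0\<close> forces the law to be concentrated at \<open>0\<close>.\<close>
lemma moment_pos:
  assumes "prob_space \<nu>" and sets: "sets \<nu> = sets borel" and nn: "AE x in \<nu>. 0 \<le> x"
    and "\<nu> \<noteq> return borel 0" and int: "integrable \<nu> (\<lambda>x. x ^ k)"
  shows "0 < moment \<nu> k"
proof (rule ccontr)
  interpret prob_space \<nu> by fact
  assume "\<not> 0 < moment \<nu> k"
  moreover have p: "AE x in \<nu>. 0 \<le> x ^ k" using nn by eventually_elim simp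
  then have "0 \<le> moment \<nu> k" unfolding moment_def by (rule integral_nonneg_AE)
  ultimately have 0: "moment \<nu> k = 0" by simp
  then have z: "AE x in \<nu>. x ^ k = 0"
    unfolding moment_def using integral_nonneg_eq_0_iff_AE[OF int p] by simp
  have "k \<noteq> 0"
  proof
    assume "k = 0"
    with 0 show False by (simp add: moment_def prob_space)
  qed
  with z have z: "AE x in \<nu>. x = 0" by simp
  have "\<nu> = return borel 0"
  proof (rule measure_eqI)
    fix A assume A: "A \<in> sets \<nu>"
    show "emeasure \<nu> A = emeasure (return borel 0) A"
    proof (cases "0 \<in> A")
      case True
      have "AE x in \<nu>. x \<in> A" using z by eventually_elim (use True in simp)
      then show ?thesis using True A emeasure_eq_1_AE[OF A] by (simp add: sets)
    next
      case False
      have "AE x in \<nu>. x \<notin> A" using z by eventually_elim (use False in auto)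
      then have "emeasure \<nu> A = 0" using A by (simp add: AE_iff_measurable[OF A] sets_eq_imp_space_eq[OF sets] AE_iff_null null_sets_def)
      then show ?thesis using False A by (simp add: sets)
    qed
  qed (simp add: sets)
  with assms show False by simp
qed

section \<open>The limit theorem\<close>

text \<open>The constants that come out of the expansion are those of the theorem; for the second one the key
is the factorisation
\<open>(\<alpha> + 1) (\<alpha> + 2) + 4 \<beta> (\<alpha> + 2) + 3 \<beta> (\<beta> - 1) = (\<alpha> + \<beta> + 1) (\<alpha> + 3 \<beta> + 2)\<close>.\<close>
lemma (in jacobi_step) drift_coefficient: "m2 * (1 - mean_z2) / 2 = (\<alpha> + \<beta> + 1) * m2 / (2 * (\<alpha> + 1))"
  unfolding mean_z2_def using ab by (simp add: field_simps)

lemma (in jacobi_step) limit_shift_eq: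
  "limit_shift = - ((\<alpha> + \<beta> + 1) * (\<alpha> + 3 * \<beta> + 2) * m4 / (12 * (\<alpha> + 1) * (\<alpha> + 2)))"
proof -
  have nz: "(\<alpha> + 1) * (\<alpha> + 2) \<noteq> 0" using ab by auto
  have "(1 - 4 * mean_z2 + 3 * mean_z4) * ((\<alpha> + 1) * (\<alpha> + 2)) = (\<alpha> + \<beta> + 1) * (\<alpha> + 3 * \<beta> + 2)"
  proof -
    have "mean_z2 * (\<alpha> + 1) = - \<beta>" "mean_z4 * ((\<alpha> + 1) * (\<alpha> + 2)) = \<beta> * (\<beta> - 1)"
      using ab nz by (auto simp: mean_z2_def mean_z4_def)
    then show ?thesis by algebra
  qed
  then have "1 - 4 * mean_z2 + 3 * mean_z4 = (\<alpha> + \<beta> + 1) * (\<alpha> + 3 * \<beta> + 2) / ((\<alpha> + 1) * (\<alpha> + 2))"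
    using nz by (simp add: eq_divide_eq)
  then show ?thesis
    by (simp only: limit_shift_def times_divide_eq_right divide_divide_eq_left mult_ac)
qed

theorem theorem4p7:
  fixes \<alpha> \<beta> \<rho> r :: real
    and \<nu> :: "real measure"
    and M :: "real \<Rightarrow> 'a measure"
    and S :: "real \<Rightarrow> nat \<Rightarrow> 'a \<Rightarrow> real"
  assumes "prob_space \<nu>" and "sets \<nu> = sets borel" and "emeasure \<nu> {..<0} = 0"
    and "\<nu> \<noteq> return borel 0"
    and "compact (measure_support \<nu>)"
    and "\<alpha> \<ge> \<beta>" and "\<beta> \<ge> - 1/2" and "\<alpha> > - 1/2"
    and "\<rho> = \<alpha> + \<beta> + 1"
    and "0 < r" and "r < 1/2"
    and "\<And>c. 0 < c \<Longrightarrow> c \<le> 1 \<Longrightarrow> jacobi_random_walk \<alpha> \<beta> (scaled_law \<nu> c) (M c) (S c)"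
  shows "(\<forall>k. integrable \<nu> (\<lambda>x. x ^ k) \<and> 0 < moment \<nu> k) \<and>
    (1/6 < r \<longrightarrow>
      tends_in_distribution (\<lambda>n. M (real n powr (- r)))
        (\<lambda>n \<omega>. (S (real n powr (- r)) n \<omega>
                  - \<rho> * moment \<nu> 2 / (2 * (\<alpha> + 1)) * real n powr (1 - 2 * r))
                / real n powr (1/2 - r))
        (normal_law 0 (moment \<nu> 2 / (2 * (\<alpha> + 1))))) \<and>
    (r = 1/6 \<longrightarrow>
      tends_in_distribution (\<lambda>n. M (real n powr (- 1/6)))
        (\<lambda>n \<omega>. (S (real n powr (- 1/6)) n \<omega>
                  - \<rho> * moment \<nu> 2 / (2 * (\<alpha> + 1)) * real n powr (2/3))
                / real n powr (1/3))
        (normal_law (- (\<rho> * (\<alpha> + 3 * \<beta> + 2) * moment \<nu> 4 / (12 * (\<alpha> + 1) * (\<alpha> + 2))))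
                    (moment \<nu> 2 / (2 * (\<alpha> + 1))))) \<and>
    (r < 1/6 \<longrightarrow>
      tends_in_probability (\<lambda>n. M (real n powr (- r)))
        (\<lambda>n \<omega>. (S (real n powr (- r)) n \<omega>
                  - \<rho> * moment \<nu> 2 / (2 * (\<alpha> + 1)) * real n powr (1 - 2 * r))
                / real n powr (1 - 4 * r))
        (- (\<rho> * (\<alpha> + 3 * \<beta> + 2) * moment \<nu> 4 / (12 * (\<alpha> + 1) * (\<alpha> + 2)))))"
proof -
  note sets = assms(2) and \<rho> = assms(9) and r = assms(10,11) and walk = assms(12)
  have nn: "AE x in \<nu>. 0 \<le> x"
  proof -
    have "{..<0} \<in> null_sets \<nu>" using assms(2,3) by (simp add: null_sets_def)
    then have "AE x in \<nu>. x \<notin> {..<0}" by (rule AE_not_in)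
    then show ?thesis by eventually_elim simp
  qed
  obtain K where K: "1 \<le> K" "AE x in \<nu>. \<bar>x\<bar> \<le> K"
    using AE_bounded_if_compact_support[OF assms(2,5)] .
  have AE_K: "AE x in \<nu>. 0 \<le> x \<and> x \<le> K" using nn K(2) by eventually_elim simp
  have int: "integrable \<nu> (\<lambda>x. x ^ k)" for k
  proof -
    interpret prob_space \<nu> by (rule assms(1))
    note [measurable_cong] = assms(2)
    show ?thesis
    proof (rule integrable_const_bound[where B = "K ^ k"])
      show "AE x in \<nu>. norm (x ^ k) \<le> K ^ k"
        using AE_K by eventually_elim (auto simp: power_abs intro: power_mono)
    qed measurable
  qed
  have pos: "0 < moment \<nu> k" for k by (rule moment_pos[OF assms(1,2) nn assms(4) int])
  interpret J: jacobi_step \<alpha> \<beta> \<nu> K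
    by (rule jacobi_step.intro) (fact assms(6) assms(7) assms(8) assms(1) assms(2) AE_K K(1) pos)+
  define v where "v = moment \<nu> 2 / (2 * (\<alpha> + 1))"
  have v: "0 < v" using pos[of 2] assms(8) by (simp add: v_def)
  define \<kappa> where "\<kappa> = - (\<rho> * (\<alpha> + 3 * \<beta> + 2) * moment \<nu> 4 / (12 * (\<alpha> + 1) * (\<alpha> + 2)))"
  have \<kappa>: "J.limit_shift = \<kappa>" by (simp add: J.limit_shift_eq \<kappa>_def \<rho>)
  define X where "X = (\<lambda>a (n::nat) \<omega>. (S (real n powr (- r)) n \<omega>
     - \<rho> * moment \<nu> 2 / (2 * (\<alpha> + 1)) * real n powr (1 - 2 * r)) / real n powr a)"
  have rv: "prob_space (M (real n powr (- r))) \<and> X a n \<in> borel_measurable (M (real n powr (- r)))" if "1 \<le> n" for n a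
  proof -
    have "real n powr (- r) \<le> real n powr 0" using that r by (intro powr_mono) auto
    then have w: "jacobi_random_walk \<alpha> \<beta> (scaled_law \<nu> (real n powr (- r))) (M (real n powr (- r))) (S (real n powr (- r)))"
      using that by (intro walk) auto
    note [measurable] = J.walk_measurable[OF w]
    show ?thesis using J.walk_prob_space[OF w] by (simp add: X_def)
  qed
  have inv: "(\<lambda>n. 1 / real n powr a) \<longlonglongrightarrow> 0" if "0 < a" for a
  proof -
    have "(\<lambda>n. real n powr (- a)) \<longlonglongrightarrow> 0"
      by (rule tendsto_neg_powr) (use that filterlim_real_sequentially in auto)
    then show ?thesis by (simp add: powr_minus divide_inverse)
  qed
  have lim: "(\<lambda>n. char (distr (M (real n powr (- r))) borel (X a n)) t)
      \<longlonglongrightarrow> exp (\<i> * of_real (t * (p * \<kappa>)) - of_real (t\<^sup>2 * (q * v) / 2))"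
    if "0 < a" "(\<lambda>n. real n powr (1 - 4 * r) / real n powr a) \<longlonglongrightarrow> p"
      "(\<lambda>n. real n powr (1 - 2 * r) / (real n powr a)\<^sup>2) \<longlonglongrightarrow> q" for a p q t
    using J.scaled_walk_char_limit[of M S r "\<lambda>n. real n powr a", OF walk r(1) _ inv[OF that(1)] that(2,3), of t]
    unfolding J.drift_coefficient \<rho>[symmetric] \<kappa> v_def[symmetric] X_def by simp
  have ratio: "(\<lambda>n. real n powr a / real n powr b) \<longlonglongrightarrow> (if a = b then 1 else 0)" if "a \<le> b" for a b
  proof (cases "a = b")
    case True
    have "eventually (\<lambda>n. real n powr a / real n powr b = 1) sequentially"
      using eventually_ge_at_top[of 1] by eventually_elim (simp add: True)
    then show ?thesis using True by (simp add: tendsto_eventually)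
  next
    case False
    then have "(\<lambda>n. real n powr (a - b)) \<longlonglongrightarrow> 0"
      by (intro tendsto_neg_powr) (use that filterlim_real_sequentially in auto)
    then show ?thesis using False by (simp add: powr_diff)
  qed
  have sq: "(real n powr a)\<^sup>2 = real n powr (2 * a)" for n a
    by (cases "n = 0") (simp_all add: power_powr_eq)
  have gauss: "tends_in_distribution (\<lambda>n. M (real n powr (- r))) (X (1/2 - r)) (normal_law (p * \<kappa>) v)"
    if "1/6 \<le> r" "p = (if r = 1/6 then 1 else 0)" for p
  proof (rule tends_in_distribution_if_char[OF rv char_normal_law(1)[OF v]])
    fix t
    have 1: "(\<lambda>n. real n powr (1 - 4 * r) / real n powr (1/2 - r)) \<longlonglongrightarrow> p"
      using ratio[of "1 - 4 * r" "1/2 - r"] that by (auto split: if_splits)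
    have 2: "(\<lambda>n. real n powr (1 - 2 * r) / (real n powr (1/2 - r))\<^sup>2) \<longlonglongrightarrow> 1"
      using ratio[of "1 - 2 * r" "2 * (1/2 - r)"] by (simp add: sq)
    show "(\<lambda>n. char (distr (M (real n powr (- r))) borel (X (1/2 - r) n)) t) \<longlonglongrightarrow> char (normal_law (p * \<kappa>) v) t"
      using lim[OF _ 1 2, of t] r by (simp add: char_normal_law(2)[OF v])
  qed
  have part1: "tends_in_distribution (\<lambda>n. M (real n powr (- r))) (X (1/2 - r)) (normal_law 0 v)" if "1/6 < r"
    using gauss[of 0] that by simp
  have part2: "tends_in_distribution (\<lambda>n. M (real n powr (- r))) (X (1/2 - r)) (normal_law \<kappa> v)" if "r = 1/6"
  proof -
    have "1/6 \<le> r" "(1::real) = (if r = 1/6 then 1 else 0)" using that by simp_all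
    from gauss[OF this] show ?thesis by (simp only: mult_1_left)
  qed
  have part3: "tends_in_probability (\<lambda>n. M (real n powr (- r))) (X (1 - 4 * r)) \<kappa>" if "r < 1/6"
  proof (rule tends_in_probability_if_tends_in_distribution[OF rv])
    show "tends_in_distribution (\<lambda>n. M (real n powr (- r))) (X (1 - 4 * r)) (return borel \<kappa>)"
    proof (rule tends_in_distribution_if_char[OF rv])
      interpret R: prob_space "return borel \<kappa>" by (rule prob_space_return) simp
      show "real_distribution (return borel \<kappa>)" by unfold_locales simp_all
      fix t
      have 1: "(\<lambda>n. real n powr (1 - 4 * r) / real n powr (1 - 4 * r)) \<longlonglongrightarrow> 1"
        using ratio[of "1 - 4 * r" "1 - 4 * r"] by simp
      have 2: "(\<lambda>n. real n powr (1 - 2 * r) / (real n powr (1 - 4 * r))\<^sup>2) \<longlonglongrightarrow> 0"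
        using ratio[of "1 - 2 * r" "2 * (1 - 4 * r)"] that by (simp add: sq split: if_splits)
      show "(\<lambda>n. char (distr (M (real n powr (- r))) borel (X (1 - 4 * r) n)) t) \<longlonglongrightarrow> char (return borel \<kappa>) t"
        using lim[OF _ 1 2, of t] that by (simp add: char_def integral_return)
    qed
  qed
  show ?thesis
  proof (intro conjI allI impI)
    fix k show "integrable \<nu> (\<lambda>x. x ^ k)" by (rule int)
    show "0 < moment \<nu> k" by (rule pos)
  next
    assume "1/6 < r"
    from part1[OF this] show "tends_in_distribution (\<lambda>n. M (real n powr (- r)))
        (\<lambda>n \<omega>. (S (real n powr (- r)) n \<omega>
                  - \<rho> * moment \<nu> 2 / (2 * (\<alpha> + 1)) * real n powr (1 - 2 * r))
                / real n powr (1/2 - r))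
        (normal_law 0 (moment \<nu> 2 / (2 * (\<alpha> + 1))))"
      by (simp only: X_def v_def)
  next
    assume r: "r = 1/6"
    have eqs: "1 - 2 * r = 2/3" "1/2 - r = 1/3" "- r = - 1/6" using r by simp_all
    from part2[OF r] show "tends_in_distribution (\<lambda>n. M (real n powr (- 1/6)))
        (\<lambda>n \<omega>. (S (real n powr (- 1/6)) n \<omega>
                  - \<rho> * moment \<nu> 2 / (2 * (\<alpha> + 1)) * real n powr (2/3))
                / real n powr (1/3))
        (normal_law (- (\<rho> * (\<alpha> + 3 * \<beta> + 2) * moment \<nu> 4 / (12 * (\<alpha> + 1) * (\<alpha> + 2))))
                    (moment \<nu> 2 / (2 * (\<alpha> + 1))))"
      by (simp only: X_def v_def \<kappa>_def eqs)
  next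
    assume "r < 1/6"
    from part3[OF this] show "tends_in_probability (\<lambda>n. M (real n powr (- r)))
        (\<lambda>n \<omega>. (S (real n powr (- r)) n \<omega>
                  - \<rho> * moment \<nu> 2 / (2 * (\<alpha> + 1)) * real n powr (1 - 2 * r))
                / real n powr (1 - 4 * r))
        (- (\<rho> * (\<alpha> + 3 * \<beta> + 2) * moment \<nu> 4 / (12 * (\<alpha> + 1) * (\<alpha> + 2))))"
      by (simp only: X_def \<kappa>_def)
  qed
qed

end
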